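(* Let $\mathcal A$ be as in the context. (a) If $[\cdot,\cdot]$ is a bracket of form degree $-1$ on $\Omega(\mathcal A)$ making $(\Omega(\mathcal A),\wedge,[\cdot,\cdot])$ a Gerstenhaber superalgebra, then $\Omega^1(\mathcal A)$ with bracket $\llbracket\alpha,\beta\rrbracket=[\alpha,\beta]$ and anchor $\rho(\alpha)=[\alpha,\cdot]|_{\mathcal A}$ is a Lie superalgebroid. (b) Conversely, if $(\Omega^1(\mathcal A),\llbracket\cdot,\cdot\rrbracket,\rho)$ is a Lie superalgebroid, then there is a bracket $[\cdot,\cdot]$ on $\Omega(\mathcal A)$ making $(\Omega(\mathcal A),\wedge,[\cdot,\cdot])$ a Gerstenhaber superalgebra with $[f,g]=0$, $[\alpha,f]=\rho(\alpha)(f)$ and $[\alpha,\beta]=\llbracket\alpha,\beta\rrbracket$ for $f,g\in\mathcal A$, $\alpha,\beta\in\Omega^1(\mathcal A)$. In particular, $\Omega(\mathcal A)$ admits a Gerstenhaber superalgebra structure (of this kind) if and only if $\Omega^1(\mathcal A)$ admits a Lie superalgebroid structure.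
   Context: $\mathcal A$ is a $\mathbb Z$-graded, associative, graded-commutative unital real algebra, regarded as supercommutative with parity $p$ = degree mod 2. $\Omega^1(\mathcal A)=\ker(\mathbf m:\mathcal A\otimes\mathcal A\to\mathcal A)$ with $\mathbf d a=a\otimes1-1\otimes a$, generated over $\mathcal A$ by $\mathbf d\mathcal A$; $\Omega(\mathcal A)=\bigoplus_{r\ge0}\Omega^r(\mathcal A)$, $\Omega^0(\mathcal A)=\mathcal A$, is the algebra of superforms generated over $\mathcal A$ by $\Omega^1(\mathcal A)$ with wedge product, bigraded by form degree $\deg$ (in $\mathbb Z$) and parity $p$ (in $\mathbb Z_2$). A Gerstenhaber superalgebra is a $\mathbb Z$-graded superalgebra $(\mathcal B,\wedge)$ with a bracket $[\cdot,\cdot]$ such that for bihomogeneous $\alpha,\beta,\gamma$: $[\alpha,\beta]=-(-1)^{(\deg\alpha-1)(\deg\beta-1)+p(\alpha)p(\beta)}[\beta,\alpha]$; $[\alpha,[\beta,\gamma]]=[[\alpha,\beta],\gamma]+(-1)^{(\deg\alpha-1)(\deg\beta-1)+p(\alpha)p(\beta)}[\beta,[\alpha,\gamma]]$; $[\alpha,\beta\wedge\gamma]=[\alpha,\beta]\wedge\gamma+(-1)^{(\deg\alpha-1)\deg\beta+p(\alpha)p(\beta)}\beta\wedge[\alpha,\gamma]$. Form degree $-1$ means $[\Omega^i,\Omega^j]\subseteq\Omega^{i+j-1}$. A Lie superalgebroid on $\Omega^1(\mathcal A)$ is an even $\mathcal A$-linear anchor $\rho:\Omega^1(\mathcal A)\to\operatorname{Der}(\mathcal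 A)$ (graded derivations) with a bilinear bracket making $\Omega^1(\mathcal A)$ a Lie superalgebra and satisfying $\llbracket\alpha,f\beta\rrbracket=\rho(\alpha)(f)\beta+(-1)^{p(\alpha)p(f)}f\llbracket\alpha,\beta\rrbracket$. *)

theory Defs
  imports "HOL-Analysis.Analysis" "HOL-Library.Function_Algebras"
begin

instantiation "fun" :: (type, real_vector) real_vector
begin
definition scaleR_fun :: "real \<Rightarrow> ('a \<Rightarrow> 'b) \<Rightarrow> 'a \<Rightarrow> 'b" where
  "scaleR_fun c f = (\<lambda>x. c *\<^sub>R f x)"
instance
  by standard (auto simp: scaleR_fun_def fun_eq_iff scaleR_add_right scaleR_add_left)
end

text \<open>A is the whole type 'a (an associative unital real algebra); its Z-grading is
  given by the family of subspaces G n, n :: int.  Parities are encoded as naturals 0/1.\<close>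

definition graded_supercomm_algebra :: "(int \<Rightarrow> 'a::real_algebra_1 set) \<Rightarrow> bool" where
  "graded_supercomm_algebra G \<longleftrightarrow>
     (\<forall>n. subspace (G n)) \<and>
     (\<forall>a. \<exists>!c. finite {n. c n \<noteq> 0} \<and> (\<forall>n. c n \<in> G n) \<and> a = (\<Sum>n\<in>{n. c n \<noteq> 0}. c n)) \<and>
     1 \<in> G 0 \<and>
     (\<forall>m n a b. a \<in> G m \<longrightarrow> b \<in> G n \<longrightarrow> a * b \<in> G (m + n)) \<and>
     (\<forall>m n a b. a \<in> G m \<longrightarrow> b \<in> G n \<longrightarrow>
        a * b = (if even (m * n) then b * a else - (b * a)))"

definition Apar :: "(int \<Rightarrow> 'a::real_algebra_1 set) \<Rightarrow> nat \<Rightarrow> 'a set" where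
  "Apar G p = span (\<Union>n\<in>{n. n mod 2 = int p}. G n)"

definition acomp :: "(int \<Rightarrow> 'a::real_algebra_1 set) \<Rightarrow> nat \<Rightarrow> 'a \<Rightarrow> 'a" where
  "acomp G p a = (THE b. b \<in> Apar G p \<and> a - b \<in> Apar G (1 - p))"

text \<open>Model of the real tensor product: a \<otimes> b is the bilinear form
  (\<phi>,\<psi>) \<mapsto> \<phi> a * \<psi> b on pairs of real-linear functionals; A \<otimes>_R A is the span
  of these (the canonical map V \<otimes> W \<rightarrow> Bil(V^* \<times> W^*) is injective).\<close>

type_synonym 'a tens = "('a \<Rightarrow> real) \<times> ('a \<Rightarrow> real) \<Rightarrow> real"

definition tensor :: "'a::real_vector \<Rightarrow> 'a \<Rightarrow> 'a tens" where
  "tensor a b = (\<lambda>(\<phi>, \<psi>). if linear \<phi> \<and> linear \<psi> then \<phi> a * \<psi> b else 0)"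

definition AtA :: "'a::real_vector tens set" where
  "AtA = span (range (case_prod tensor))"

text \<open>\<Omega>^1(A) = ker (m : A \<otimes> A \<rightarrow> A), m(a \<otimes> b) = a b.\<close>
definition Omega1 :: "'a::real_algebra_1 tens set" where
  "Omega1 = {t. \<exists>xs. t = sum_list (map (case_prod tensor) xs)
                  \<and> sum_list (map (\<lambda>(a, b). a * b) xs) = 0}"

definition dA :: "'a::real_algebra_1 \<Rightarrow> 'a tens" where
  "dA a = tensor a 1 - tensor 1 a"

text \<open>Left A-module structure: f \<cdot> (a \<otimes> b) = (f a) \<otimes> b.\<close>
definition lact :: "'a::real_algebra_1 \<Rightarrow> 'a tens \<Rightarrow> 'a tens" where
  "lact f t = (\<lambda>(\<phi>, \<psi>). if linear \<phi> \<and> linear \<psi> then t (\<lambda>x. \<phi> (f * x), \<psi>) else 0)"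

definition Tpar :: "(int \<Rightarrow> 'a::real_algebra_1 set) \<Rightarrow> nat \<Rightarrow> 'a tens set" where
  "Tpar G p = span {tensor a b | a b p1 p2. a \<in> Apar G p1 \<and> b \<in> Apar G p2 \<and> (p1 + p2) mod 2 = p}"

definition O1par :: "(int \<Rightarrow> 'a::real_algebra_1 set) \<Rightarrow> nat \<Rightarrow> 'a tens set" where
  "O1par G p = Omega1 \<inter> Tpar G p"

definition tcomp :: "(int \<Rightarrow> 'a::real_algebra_1 set) \<Rightarrow> nat \<Rightarrow> 'a tens \<Rightarrow> 'a tens" where
  "tcomp G p t = (THE s. s \<in> Tpar G p \<and> t - s \<in> Tpar G (1 - p))"

text \<open>Presentation: formal real combinations of tagged words (p, f, [(q1,\<alpha>1),...,(qr,\<alpha>r)])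
  standing for f \<wedge> \<alpha>1 \<wedge> ... \<wedge> \<alpha>r with f \<in> A of parity p and \<alpha>i \<in> \<Omega>^1(A) of parity qi,
  modulo the relations of the super exterior algebra over the supercommutative A
  (R-multilinearity, A-balancedness, super-antisymmetry).  Elements of \<Omega>(A) are
  the classes; we work with representatives and the equivalence oeq.\<close>

type_synonym 'a word = "nat \<times> 'a \<times> (nat \<times> 'a tens) list"
type_synonym 'a form = "'a word \<Rightarrow> real"

definition wd :: "'a word \<Rightarrow> 'a form" where
  "wd w = (\<lambda>u. if u = w then 1 else 0)"

definition valid_word :: "(int \<Rightarrow> 'a::real_algebra_1 set) \<Rightarrow> 'a word \<Rightarrow> bool" where
  "valid_word G w \<longleftrightarrow> (case w of (p, f, as) \<Rightarrow>
      p < 2 \<and> f \<in> Apar G p \<and> (\<forall>(q, \<alpha>) \<in> set as. q < 2 \<and> \<alpha> \<in> O1par G q))"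

definition wdeg :: "'a word \<Rightarrow> nat" where
  "wdeg w = length (snd (snd w))"

definition wpar :: "'a word \<Rightarrow> nat" where
  "wpar w = (fst w + sum_list (map fst (snd (snd w)))) mod 2"

definition Relators :: "(int \<Rightarrow> 'a::real_algebra_1 set) \<Rightarrow> 'a form set" where
  "Relators G =
     {wd (p, f + g, as) - wd (p, f, as) - wd (p, g, as) | p f g as.
        valid_word G (p, f, as) \<and> valid_word G (p, g, as)}
   \<union> {wd (p, c *\<^sub>R f, as) - c *\<^sub>R wd (p, f, as) | p c f as. valid_word G (p, f, as)}
   \<union> {wd (p, f, us @ [(q, \<alpha> + \<beta>)] @ vs) - wd (p, f, us @ [(q, \<alpha>)] @ vs)
        - wd (p, f, us @ [(q, \<beta>)] @ vs) | p f us q \<alpha> \<beta> vs.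
        valid_word G (p, f, us @ [(q, \<alpha>)] @ vs) \<and> valid_word G (p, f, us @ [(q, \<beta>)] @ vs)}
   \<union> {wd (p, f, us @ [((q' + q) mod 2, lact g \<alpha>)] @ vs)
        - ((-1) ^ (q' * sum_list (map fst us))) *\<^sub>R wd ((p + q') mod 2, f * g, us @ [(q, \<alpha>)] @ vs)
        | p f us q' g q \<alpha> vs.
        q' < 2 \<and> g \<in> Apar G q' \<and> valid_word G (p, f, us @ [(q, \<alpha>)] @ vs)
        \<and> valid_word G (p, f, us @ [((q' + q) mod 2, lact g \<alpha>)] @ vs)}
   \<union> {wd (p, f, us @ [(q1, \<alpha>1), (q2, \<alpha>2)] @ vs)
        + ((-1) ^ (q1 * q2)) *\<^sub>R wd (p, f, us @ [(q2, \<alpha>2), (q1, \<alpha>1)] @ vs)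
        | p f us q1 \<alpha>1 q2 \<alpha>2 vs. valid_word G (p, f, us @ [(q1, \<alpha>1), (q2, \<alpha>2)] @ vs)}"

definition Om :: "(int \<Rightarrow> 'a::real_algebra_1 set) \<Rightarrow> 'a form set" where
  "Om G = span (wd ` {w. valid_word G w})"

definition oeq :: "(int \<Rightarrow> 'a::real_algebra_1 set) \<Rightarrow> 'a form \<Rightarrow> 'a form \<Rightarrow> bool" where
  "oeq G x y \<longleftrightarrow> x - y \<in> span (Relators G)"

definition Ohom :: "(int \<Rightarrow> 'a::real_algebra_1 set) \<Rightarrow> nat \<Rightarrow> nat \<Rightarrow> 'a form set" where
  "Ohom G r p = {x \<in> Om G. \<exists>y \<in> span (wd ` {w. valid_word G w \<and> wdeg w = r \<and> wpar w = p}).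
                              oeq G x y}"

definition wmul :: "'a::real_algebra_1 word \<Rightarrow> 'a word \<Rightarrow> 'a form" where
  "wmul u w = (case u of (p, f, as) \<Rightarrow> case w of (q, g, bs) \<Rightarrow>
      ((-1) ^ (q * sum_list (map fst as))) *\<^sub>R wd ((p + q) mod 2, f * g, as @ bs))"

definition wedge :: "'a::real_algebra_1 form \<Rightarrow> 'a form \<Rightarrow> 'a form" where
  "wedge x y = (\<Sum>u\<in>{u. x u \<noteq> 0}. \<Sum>w\<in>{w. y w \<noteq> 0}. (x u * y w) *\<^sub>R wmul u w)"

definition embA :: "(int \<Rightarrow> 'a::real_algebra_1 set) \<Rightarrow> 'a \<Rightarrow> 'a form" where
  "embA G f = wd (0, acomp G 0 f, []) + wd (1, acomp G 1 f, [])"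

definition emb1 :: "(int \<Rightarrow> 'a::real_algebra_1 set) \<Rightarrow> 'a tens \<Rightarrow> 'a form" where
  "emb1 G \<alpha> = wd (0, 1, [(0, tcomp G 0 \<alpha>)]) + wd (0, 1, [(1, tcomp G 1 \<alpha>)])"

definition sgni :: "int \<Rightarrow> real" where
  "sgni k = (if even k then 1 else -1)"

definition gerstenhaber :: "(int \<Rightarrow> 'a::real_algebra_1 set) \<Rightarrow> ('a form \<Rightarrow> 'a form \<Rightarrow> 'a form) \<Rightarrow> bool" where
  "gerstenhaber G br \<longleftrightarrow>
     (\<forall>x \<in> Om G. \<forall>y \<in> Om G. br x y \<in> Om G) \<and>
     (\<forall>x x' y y'. x \<in> Om G \<longrightarrow> x' \<in> Om G \<longrightarrow> y \<in> Om G \<longrightarrow> y' \<in> Om G \<longrightarrow>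
        oeq G x x' \<longrightarrow> oeq G y y' \<longrightarrow> oeq G (br x y) (br x' y')) \<and>
     (\<forall>c x x' y. x \<in> Om G \<longrightarrow> x' \<in> Om G \<longrightarrow> y \<in> Om G \<longrightarrow>
        oeq G (br (c *\<^sub>R x + x') y) (c *\<^sub>R br x y + br x' y)) \<and>
     (\<forall>c x y y'. x \<in> Om G \<longrightarrow> y \<in> Om G \<longrightarrow> y' \<in> Om G \<longrightarrow>
        oeq G (br x (c *\<^sub>R y + y')) (c *\<^sub>R br x y + br x y')) \<and>
     (\<forall>r s p q x y. p < 2 \<longrightarrow> q < 2 \<longrightarrow> x \<in> Ohom G r p \<longrightarrow> y \<in> Ohom G s q \<longrightarrow>
        (if r + s = 0 then oeq G (br x y) 0
         else br x y \<in> Ohom G (r + s - 1) ((p + q) mod 2))) \<and>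
     (\<forall>r s p q x y. p < 2 \<longrightarrow> q < 2 \<longrightarrow> x \<in> Ohom G r p \<longrightarrow> y \<in> Ohom G s q \<longrightarrow>
        oeq G (br x y)
          (- (sgni ((int r - 1) * (int s - 1) + int (p * q)) *\<^sub>R br y x))) \<and>
     (\<forall>r s t p q u x y z. p < 2 \<longrightarrow> q < 2 \<longrightarrow> u < 2 \<longrightarrow>
        x \<in> Ohom G r p \<longrightarrow> y \<in> Ohom G s q \<longrightarrow> z \<in> Ohom G t u \<longrightarrow>
        oeq G (br x (br y z))
          (br (br x y) z + sgni ((int r - 1) * (int s - 1) + int (p * q)) *\<^sub>R br y (br x z))) \<and>
     (\<forall>r s t p q u x y z. p < 2 \<longrightarrow> q < 2 \<longrightarrow> u < 2 \<longrightarrow>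
        x \<in> Ohom G r p \<longrightarrow> y \<in> Ohom G s q \<longrightarrow> z \<in> Ohom G t u \<longrightarrow>
        oeq G (br x (wedge y z))
          (wedge (br x y) z + sgni ((int r - 1) * int s + int (p * q)) *\<^sub>R wedge y (br x z)))"

definition superderiv :: "(int \<Rightarrow> 'a::real_algebra_1 set) \<Rightarrow> nat \<Rightarrow> ('a \<Rightarrow> 'a) \<Rightarrow> bool" where
  "superderiv G p D \<longleftrightarrow> linear D \<and>
     (\<forall>q a. q < 2 \<longrightarrow> a \<in> Apar G q \<longrightarrow> D a \<in> Apar G ((p + q) mod 2)) \<and>
     (\<forall>q a b. q < 2 \<longrightarrow> a \<in> Apar G q \<longrightarrow> D (a * b) = D a * b + ((-1) ^ (p * q)) *\<^sub>R (a * D b))"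

definition DerA :: "(int \<Rightarrow> 'a::real_algebra_1 set) \<Rightarrow> ('a \<Rightarrow> 'a) set" where
  "DerA G = {D. \<exists>D0 D1. superderiv G 0 D0 \<and> superderiv G 1 D1 \<and> D = (\<lambda>a. D0 a + D1 a)}"

definition lie_superalgebroid :: "(int \<Rightarrow> 'a::real_algebra_1 set) \<Rightarrow> ('a tens \<Rightarrow> 'a tens \<Rightarrow> 'a tens)
     \<Rightarrow> ('a tens \<Rightarrow> 'a \<Rightarrow> 'a) \<Rightarrow> bool" where
  "lie_superalgebroid G brk \<rho> \<longleftrightarrow>
     \<comment> \<open>anchor: even, A-linear map \<Omega>^1(A) \<rightarrow> Der(A)\<close>
     (\<forall>\<alpha> \<in> Omega1. \<rho> \<alpha> \<in> DerA G) \<and>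
     (\<forall>c \<alpha> \<beta>. \<alpha> \<in> Omega1 \<longrightarrow> \<beta> \<in> Omega1 \<longrightarrow> \<rho> (c *\<^sub>R \<alpha> + \<beta>) = (\<lambda>a. c *\<^sub>R \<rho> \<alpha> a + \<rho> \<beta> a)) \<and>
     (\<forall>p \<alpha>. p < 2 \<longrightarrow> \<alpha> \<in> O1par G p \<longrightarrow> superderiv G p (\<rho> \<alpha>)) \<and>
     (\<forall>f \<alpha>. \<alpha> \<in> Omega1 \<longrightarrow> \<rho> (lact f \<alpha>) = (\<lambda>a. f * \<rho> \<alpha> a)) \<and>
     \<comment> \<open>Lie superalgebra structure on \<Omega>^1(A)\<close>
     (\<forall>\<alpha> \<in> Omega1. \<forall>\<beta> \<in> Omega1. brk \<alpha> \<beta> \<in> Omega1) \<and>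
     (\<forall>c \<alpha> \<alpha>' \<beta>. \<alpha> \<in> Omega1 \<longrightarrow> \<alpha>' \<in> Omega1 \<longrightarrow> \<beta> \<in> Omega1 \<longrightarrow>
        brk (c *\<^sub>R \<alpha> + \<alpha>') \<beta> = c *\<^sub>R brk \<alpha> \<beta> + brk \<alpha>' \<beta>) \<and>
     (\<forall>c \<alpha> \<beta> \<beta>'. \<alpha> \<in> Omega1 \<longrightarrow> \<beta> \<in> Omega1 \<longrightarrow> \<beta>' \<in> Omega1 \<longrightarrow>
        brk \<alpha> (c *\<^sub>R \<beta> + \<beta>') = c *\<^sub>R brk \<alpha> \<beta> + brk \<alpha> \<beta>') \<and>
     (\<forall>p q \<alpha> \<beta>. p < 2 \<longrightarrow> q < 2 \<longrightarrow> \<alpha> \<in> O1par G p \<longrightarrow> \<beta> \<in> O1par G q \<longrightarrow>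
        brk \<alpha> \<beta> \<in> O1par G ((p + q) mod 2)) \<and>
     (\<forall>p q \<alpha> \<beta>. p < 2 \<longrightarrow> q < 2 \<longrightarrow> \<alpha> \<in> O1par G p \<longrightarrow> \<beta> \<in> O1par G q \<longrightarrow>
        brk \<alpha> \<beta> = - (((-1) ^ (p * q)) *\<^sub>R brk \<beta> \<alpha>)) \<and>
     (\<forall>p q u \<alpha> \<beta> \<gamma>. p < 2 \<longrightarrow> q < 2 \<longrightarrow> u < 2 \<longrightarrow>
        \<alpha> \<in> O1par G p \<longrightarrow> \<beta> \<in> O1par G q \<longrightarrow> \<gamma> \<in> O1par G u \<longrightarrow>
        brk \<alpha> (brk \<beta> \<gamma>) = brk (brk \<alpha> \<beta>) \<gamma> + ((-1) ^ (p * q)) *\<^sub>R brk \<beta> (brk \<alpha> \<gamma>)) \<and>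
     \<comment> \<open>Leibniz rule\<close>
     (\<forall>p q \<alpha> f \<beta>. p < 2 \<longrightarrow> q < 2 \<longrightarrow> \<alpha> \<in> O1par G p \<longrightarrow> f \<in> Apar G q \<longrightarrow> \<beta> \<in> Omega1 \<longrightarrow>
        brk \<alpha> (lact f \<beta>) = lact (\<rho> \<alpha> f) \<beta> + ((-1) ^ (p * q)) *\<^sub>R lact f (brk \<alpha> \<beta>))"

end

theory Submission
  imports Defs
begin

text \<open>Left multiplication, followed by a linear projection onto a complement of the relations, represents
  the superforms faithfully by linear endomorphisms, so that congruence of representatives becomes
  equality in an associative algebra. A derivation of the superforms may be prescribed on functions
  and one-forms as soon as it respects the module structure: it is read off from a homomorphism into
  upper triangular two by two matrices.

  Given a Lie superalgebroid, this yields the derivations \<open>[f, _]\<close> and \<open>[\<alpha>, _]\<close>; for a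
  form \<open>X\<close> the derivation \<open>[X, _]\<close> is then prescribed on generators by
  antisymmetry. Antisymmetry and the Jacobi identity hold in general because both sides are
  derivations in each argument and agree on generators. The Jacobi identity for two one-forms and a
  function says that the anchor preserves brackets; this follows from the Jacobi identity for
  one-forms since the module of one-forms is faithful unless the algebra is one-dimensional, in which
  case all derivations vanish. Conversely, functions and one-forms embed into the superforms, so a
  bracket of degree \<open>-1\<close> restricts to an anchor and a bracket of one-forms, and the
  identities restrict as well.\<close>

text \<open>The classes of superforms depend on the grading \<open>G\<close>, so they do not form a
  type of their own. Calculation therefore takes place in the fixed type of linear endomorphisms of
  the form space, on the image \<open>T\<close> of the representation. Laws are controlled on
  \<open>T\<close> only, which is why membership in \<open>T\<close> accompanies most of them. The
  obstacle on the way to the bracket is that it is given on pairs of generators and has to be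
  extended in both arguments. The second argument is governed by derivations. For the first, values
  of \<open>[X, _]\<close> on generators can be prescribed by antisymmetry only once
  \<open>[f, _]\<close> and \<open>[\<alpha>, _]\<close> are known to obey product and module rules
  in \<open>f\<close> and \<open>\<alpha>\<close> themselves. These rules are again equalities of
  derivations, so they reduce to the algebroid axioms. Two gradings enter the signs independently,
  the shifted form degree \<open>deg - 1\<close> and the parity. Both are kept as integers, so that
  each sign identity is a statement about the evenness of an integer expression.\<close>

declare plus_fun_apply [simp del] zero_fun_apply [simp del] minus_apply [simp del]
  uminus_apply [simp del] One_nat_def [simp del]

lemma scaleR_fun_apply: "(c *\<^sub>R f) x = c *\<^sub>R f x"
  by (simp add: scaleR_fun_def)

lemmas fun_apply = plus_fun_apply zero_fun_apply minus_apply uminus_apply scaleR_fun_def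

lemma span_induct_cases [consumes 1, case_names subspace base]:
  assumes "x \<in> span B" and "subspace {x. P x}" and "\<And>b. b \<in> B \<Longrightarrow> P b"
  shows "P x"
  using span_induct[OF assms(1), of P] assms(2,3) by blast

lemma subspace_pointwise_linear:
  assumes "\<And>x y. P x \<Longrightarrow> P y \<Longrightarrow> P (x + y)" "\<And>c x. P x \<Longrightarrow>
      P (c *\<^sub>R x)" "P 0"
  shows "subspace {x. P x}"
  using assms by (auto simp: subspace_def)

section \<open>Signs as characters of the integers modulo two\<close>

lemma sgni_add: "sgni (a + b) = sgni a * sgni b"
  by (auto simp: sgni_def)

lemma minus_one_power_eq_sgni: "(-1) ^ n = sgni (int n)"
  by (auto simp: sgni_def)

lemma sgni_cong: "even (a - b) \<Longrightarrow> sgni a = sgni b"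
  by (auto simp: sgni_def)

lemma sgni_eq_iff: "sgni a = sgni b \<longleftrightarrow> even (a - b)"
  by (auto simp: sgni_def)

lemma sgni_mult_self [simp]: "sgni a * sgni a = 1"
  by (auto simp: sgni_def)

lemma sgni_mult_self_left [simp]: "sgni a * (sgni a * x) = x"
  by (simp flip: mult.assoc)

lemma less_two_cases: "(p::nat) < 2 \<Longrightarrow> p = 0 \<or> p = 1"
  by auto

subsection \<open>Parity components\<close>

lemma subspace_Apar: "subspace (Apar G p)"
  by (simp add: Apar_def)

lemma Apar_add: "a \<in> Apar G p \<Longrightarrow> b \<in> Apar G p \<Longrightarrow> a + b \<in> Apar G p"
  by (simp add: Apar_def span_add)

lemma Apar_scaleR: "a \<in> Apar G p \<Longrightarrow> c *\<^sub>R a \<in> Apar G p"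
  by (simp add: Apar_def span_scale)

lemma Apar_0 [simp]: "0 \<in> Apar G p"
  by (simp add: Apar_def span_zero)

section \<open>Tensors as bilinear forms and the left module action\<close>

lemma subspace_Tpar: "subspace (Tpar G p)"
  by (simp add: Tpar_def)

lemma tensor_add_left: "tensor (a + b) c = tensor a c + tensor b c"
  by (auto simp: tensor_def fun_eq_iff fun_apply linear_add algebra_simps)

lemma tensor_add_right: "tensor c (a + b) = tensor c a + tensor c b"
  by (auto simp: tensor_def fun_eq_iff fun_apply linear_add algebra_simps)

lemma tensor_scaleR_left: "tensor (r *\<^sub>R a) c = r *\<^sub>R tensor a c"
  by (auto simp: tensor_def fun_eq_iff fun_apply linear_scale)

lemma tensor_0 [simp]: "tensor 0 b = 0" "tensor b 0 = 0"
  by (auto simp: tensor_def fun_eq_iff fun_apply linear_0)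

lemma linear_mult_left_functional: "linear \<phi> \<Longrightarrow> linear (\<lambda>x. \<phi> (f * x))"
  for f :: "'a::real_algebra_1" and \<phi> :: "'a \<Rightarrow> real"
  by (simp add: linear_iff algebra_simps)

lemma lact_tensor [simp]: "lact f (tensor a b) = tensor (f * a) b"
  by (auto simp: lact_def tensor_def fun_eq_iff linear_mult_left_functional)

lemma lact_add [simp]: "lact f (s + t) = lact f s + lact f t"
  by (auto simp: lact_def fun_eq_iff fun_apply)

lemma lact_scaleR [simp]: "lact f (c *\<^sub>R t) = c *\<^sub>R lact f t"
  by (auto simp: lact_def fun_eq_iff fun_apply)

lemma linear_lact: "linear (lact f)"
  by (simp add: linear_iff)

lemma lact_zero [simp]: "lact f 0 = 0"
  by (rule linear_0[OF linear_lact])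

lemma lact_mult: "lact (f * g) t = lact f (lact g t)"
  by (auto simp: lact_def fun_eq_iff linear_mult_left_functional mult.assoc)

text \<open>An element of \<open>'a tens\<close> is an arbitrary function of two functionals, for
  which linearity in the acting element can fail. Tensors depend linearly on the first functional,
  and they vanish at nonlinear functionals, where \<open>lact\<close> puts 0; the latter is needed
  for the unit law.\<close>

lemma lact_AtA:
  assumes "t \<in> AtA"
  shows lact_add_left: "lact (f + g) t = lact f t + lact g t"
    and lact_scaleR_left: "lact (c *\<^sub>R f) t = c *\<^sub>R lact f t"
    and lact_one: "lact 1 t = t"
  using assms unfolding AtA_def atomize_conj
  by (induct rule: span_induct_cases)
     (auto simp: subspace_def tensor_add_left tensor_scaleR_left algebra_simps)

lemma sum_list_in_subspace: "subspace V \<Longrightarrow> (\<And>x. x \<in> set xs \<Longrightarrow> x \<in> V)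
    \<Longrightarrow> sum_list xs \<in> V"
  by (induct xs) (auto simp: subspace_def)

section \<open>The submodule of one-forms\<close>

lemma Omega1_subset_AtA: "Omega1 \<subseteq> AtA"
  unfolding Omega1_def AtA_def
proof clarify
  fix xs :: "('a \<times> 'a) list"
  show "sum_list (map (case_prod tensor) xs) \<in> span (range (case_prod tensor))"
    by (rule sum_list_in_subspace[OF subspace_span]) (auto intro!: span_base)
qed

text \<open>Membership means that some representing list has vanishing product, so closure is shown
  on lists: concatenation realises sums, scaling the left entries realises multiples.\<close>

lemma Omega1_subspace: "subspace Omega1"
proof -
  have "0 \<in> Omega1" unfolding Omega1_def by (auto intro: exI[of _ "[]"])
  moreover have "s + t \<in> Omega1" if "s \<in> Omega1" "t \<in> Omega1" for s t :: "'a tens"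
  proof -
    from that obtain xs ys where
      "s = sum_list (map (case_prod tensor) xs)" "sum_list (map (\<lambda>(a, b). a * b) xs) = 0"
      "t = sum_list (map (case_prod tensor) ys)" "sum_list (map (\<lambda>(a, b). a * b) ys) = 0"
      by (auto simp: Omega1_def)
    then show ?thesis unfolding Omega1_def by (auto intro!: exI[of _ "xs @ ys"])
  qed
  moreover have "c *\<^sub>R t \<in> Omega1" if "t \<in> Omega1" for c and t :: "'a tens"
  proof -
    from that obtain xs where xs:
      "t = sum_list (map (case_prod tensor) xs)" "sum_list (map (\<lambda>(a, b). a * b) xs) = 0"
      by (auto simp: Omega1_def)
    let ?ys = "map (\<lambda>(a, b). (c *\<^sub>R a, b)) xs"
    have "sum_list (map (case_prod tensor) ?ys) = c *\<^sub>R sum_list (map (case_prod tensor) xs)"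
      by (induct xs) (auto simp: tensor_scaleR_left scaleR_right_distrib)
    moreover have "sum_list (map (\<lambda>(a, b). a * b) ?ys) = c *\<^sub>R sum_list (map (\<lambda>(a, b). a
        * b) xs)"
      by (induct xs) (auto simp: scaleR_right_distrib)
    ultimately show ?thesis using xs unfolding Omega1_def by (auto intro!: exI[of _ ?ys])
  qed
  ultimately show ?thesis by (auto simp: subspace_def)
qed

lemmas Omega1_add = subspace_add[OF Omega1_subspace] and Omega1_scale = subspace_scale[OF Omega1_subspace]

lemma lact_Omega1:
  assumes "t \<in> Omega1" shows "lact f t \<in> Omega1"
proof -
  from assms obtain xs where xs:
    "t = sum_list (map (case_prod tensor) xs)" "sum_list (map (\<lambda>(a, b). a * b) xs) = 0"
    by (auto simp: Omega1_def)
  let ?ys = "map (\<lambda>(a, b). (f * a, b)) xs"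
  have "sum_list (map (case_prod tensor) ?ys) = lact f (sum_list (map (case_prod tensor) xs))"
    by (induct xs) auto
  moreover have "sum_list (map (\<lambda>(a, b). a * b) ?ys) = f * sum_list (map (\<lambda>(a, b). a * b) xs)"
    by (induct xs) (auto simp: algebra_simps)
  ultimately show ?thesis using xs unfolding Omega1_def by (auto intro!: exI[of _ ?ys])
qed

lemma dA_Omega1: "dA a \<in> Omega1"
  unfolding Omega1_def dA_def
  \<comment> \<open>The witness carries the minus sign in the left entry of its second pair; the
    products \<open>a * 1\<close> and \<open>-1 * a\<close> cancel.\<close>
  using tensor_scaleR_left[of "-1" 1 a]
  by (auto intro!: exI[of _ "[(a, 1), (-1, a)]"] simp: scaleR_minus_left)

lemma O1par_subspace: "subspace (O1par G p)"
  by (simp add: O1par_def subspace_inter Omega1_subspace subspace_Tpar)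

lemma O1par_add: "a \<in> O1par G p \<Longrightarrow> b \<in> O1par G p \<Longrightarrow> a + b \<in> O1par G p"
  by (rule subspace_add[OF O1par_subspace])

lemma O1par_scaleR: "a \<in> O1par G p \<Longrightarrow> c *\<^sub>R a \<in> O1par G p"
  by (rule subspace_scale[OF O1par_subspace])

lemma O1par_0 [simp]: "0 \<in> O1par G p"
  by (rule subspace_0[OF O1par_subspace])

lemma O1par_Omega1: "a \<in> O1par G p \<Longrightarrow> a \<in> Omega1"
  by (simp add: O1par_def)

lemma O1par_AtA: "a \<in> O1par G p \<Longrightarrow> a \<in> AtA"
  using Omega1_subset_AtA by (auto simp: O1par_def)

section \<open>Even and odd parts of the algebra\<close>

locale graded_algebra =
  fixes G :: "int \<Rightarrow> 'a::real_algebra_1 set"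
  assumes graded: "graded_supercomm_algebra G"
begin

lemma subspace_G: "subspace (G n)"
  using graded by (simp add: graded_supercomm_algebra_def)

lemma decomposition_unique:
  "\<exists>!c. finite {n. c n \<noteq> 0} \<and> (\<forall>n. c n \<in> G n) \<and> a = (\<Sum>n\<in>{n. c n
      \<noteq> 0}. c n)"
  using graded by (simp add: graded_supercomm_algebra_def)

lemma one_Apar [simp]: "1 \<in> Apar G 0"
  using graded by (auto simp: graded_supercomm_algebra_def Apar_def intro!: span_base exI[of _ "0::int"])

text \<open>The generators of the span are homogeneous of degrees congruent to \<open>p\<close>, and
  such expansions can be added and scaled. The result is an expansion of the kind covered by
  \<open>decomposition_unique\<close>, so its degrees are determined by the element.\<close>

lemma Apar_decomposition:
  assumes "a \<in> Apar G p"
  shows "\<exists>c. finite {n. c n \<noteq> 0} \<and> (\<forall>n. c n \<in> G n) \<and> a = (\<Sum>n\<in>{n.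
      c n \<noteq> 0}. c n)
    \<and> (\<forall>n. c n \<noteq> 0 \<longrightarrow> n mod 2 = int p)" (is "?P a")
  using assms unfolding Apar_def
proof (induct rule: span_induct_cases)
  case (base b)
  then obtain n where n: "n mod 2 = int p" "b \<in> G n" by auto
  have *: "{m. (if m = n then b else 0) \<noteq> 0} = (if b = 0 then {} else {n})" by auto
  show ?case
    by (rule exI[of _ "\<lambda>m. if m = n then b else 0"])
       (use n * in \<open>auto simp: subspace_0[OF subspace_G]\<close>)
next
  case subspace
  show ?case
  proof (rule subspace_pointwise_linear)
    fix x y :: 'a
    assume "?P (x)"
      and "?P (y)"
    then obtain c d where c: "finite {n. c n \<noteq> 0}" "\<And>n. c n \<in> G n"
        "x = (\<Sum>n\<in>{n. c n \<noteq> 0}. c n)" "\<And>n. c n \<noteq> 0 \<Longrightarrow> n mod 2 = int p"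
      and d: "finite {n. d n \<noteq> 0}" "\<And>n. d n \<in> G n"
        "y = (\<Sum>n\<in>{n. d n \<noteq> 0}. d n)" "\<And>n. d n \<noteq> 0 \<Longrightarrow> n mod 2 = int
            p" by blast
    let ?S = "{n. c n \<noteq> 0} \<union> {n. d n \<noteq> 0}"
    have "x = (\<Sum>n\<in>?S. c n)" "y = (\<Sum>n\<in>?S. d n)"
      using c d by (auto intro!: sum.mono_neutral_left)
    then have "x + y = (\<Sum>n\<in>?S. c n + d n)" by (simp add: sum.distrib)
    also have "\<dots> = (\<Sum>n\<in>{n. c n + d n \<noteq> 0}. c n + d n)"
      using c(1) d(1) by (intro sum.mono_neutral_right) auto
    finally have "x + y = (\<Sum>n\<in>{n. c n + d n \<noteq> 0}. c n + d n)" .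
    moreover have "finite {n. c n + d n \<noteq> 0}"
      by (rule finite_subset[of _ ?S]) (use c d in auto)
    moreover have "n mod 2 = int p" if "c n + d n \<noteq> 0" for n
      using c(4)[of n] d(4)[of n] that by (cases "c n = 0") auto
    ultimately show "?P (x + y)"
      using c(2) d(2) subspace_add[OF subspace_G] by (intro exI[of _ "\<lambda>n. c n + d n"]) auto
  next
    fix k :: real and x :: 'a
    assume "?P (x)"
    then obtain c where c: "finite {n. c n \<noteq> 0}" "\<And>n. c n \<in> G n"
        "x = (\<Sum>n\<in>{n. c n \<noteq> 0}. c n)" "\<And>n. c n \<noteq> 0 \<Longrightarrow> n mod 2 = int
            p" by blast
    have "k *\<^sub>R x = (\<Sum>n\<in>{n. k *\<^sub>R c n \<noteq> 0}. k *\<^sub>R c n)"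
      using c by (cases "k = 0") (auto simp: scaleR_sum_right)
    moreover have "finite {n. k *\<^sub>R c n \<noteq> 0}"
      by (rule finite_subset[OF _ c(1)]) auto
    ultimately show "?P (k *\<^sub>R x)"
      using c(2,4) subspace_scale[OF subspace_G] by (intro exI[of _ "\<lambda>n. k *\<^sub>R c n"]) auto
  next
    show "?P (0)"
      by (rule exI[of _ "\<lambda>_. 0"]) (simp add: subspace_0[OF subspace_G])
  qed
qed

text \<open>Both memberships yield the one homogeneous expansion of \<open>a\<close>, whose degrees
  would be even and odd at once.\<close>

lemma Apar_inter:
  assumes "a \<in> Apar G 0" "a \<in> Apar G 1" shows "a = 0"
proof -
  obtain c where c: "finite {n. c n \<noteq> 0}" "\<forall>n. c n \<in> G n"
    "a = (\<Sum>n\<in>{n. c n \<noteq> 0}. c n)" "\<And>n. c n \<noteq> 0 \<Longrightarrow> n mod 2 = 0"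
    using Apar_decomposition[OF assms(1)] by auto
  obtain d where d: "finite {n. d n \<noteq> 0}" "\<forall>n. d n \<in> G n"
    "a = (\<Sum>n\<in>{n. d n \<noteq> 0}. d n)" "\<And>n. d n \<noteq> 0 \<Longrightarrow> n mod 2 = 1"
    using Apar_decomposition[OF assms(2)] by auto
  have "c = d" using decomposition_unique[of a] c d by blast
  then have "c n = 0" for n using c(4)[of n] d(4)[of n] by (cases "c n = 0") auto
  then show ?thesis using c(3) by simp
qed

lemma Apar_exists: "\<exists>b\<in>Apar G 0. \<exists>c\<in>Apar G 1. a = b + c"
proof -
  obtain c where c: "finite {n. c n \<noteq> 0}" "\<And>n. c n \<in> G n" "a = (\<Sum>n\<in>{n. c n \<noteq> 0}. c n)"
    using decomposition_unique[of a] by blast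
  have split: "{n. c n \<noteq> 0} = {n. c n \<noteq> 0 \<and> n mod 2 = 0} \<union> {n. c n \<noteq> 0 \<and>
      n mod 2 = 1}" by auto
  have "a = (\<Sum>n\<in>{n. c n \<noteq> 0 \<and> n mod 2 = 0}. c n) + (\<Sum>n\<in>{n. c n \<noteq> 0 \<and>
      n mod 2 = 1}. c n)"
    unfolding c(3) by (subst split, rule sum.union_disjoint) (use c(1) in auto)
  moreover have "(\<Sum>n\<in>{n. c n \<noteq> 0 \<and> n mod 2 = int p}. c n) \<in> Apar G p" for p
    unfolding Apar_def by (rule span_sum, rule span_base) (use c(2) in auto)
  from this[of 0] this[of 1]
  have "(\<Sum>n\<in>{n. c n \<noteq> 0 \<and> n mod 2 = 0}. c n) \<in> Apar G 0"
       "(\<Sum>n\<in>{n. c n \<noteq> 0 \<and> n mod 2 = 1}. c n) \<in> Apar G 1" by simp_all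
  ultimately show ?thesis by blast
qed

lemma Apar_mult:
  assumes "a \<in> Apar G p" "b \<in> Apar G q" "p < 2" "q < 2"
  shows "a * b \<in> Apar G ((p + q) mod 2)"
  using assms(1) unfolding Apar_def[of G p]
proof (induct rule: span_induct_cases)
  case subspace
  show ?case
    by (rule subspace_pointwise_linear) (auto simp: distrib_right Apar_add Apar_scaleR)
next
  case (base a)
  then obtain m where m: "m mod 2 = int p" "a \<in> G m" by auto
  show ?case using assms(2) unfolding Apar_def[of G q]
  proof (induct rule: span_induct_cases)
    case subspace
    show ?case
      by (rule subspace_pointwise_linear) (auto simp: distrib_left Apar_add Apar_scaleR)
  next
    case (base b)
    then obtain n where n: "n mod 2 = int q" "b \<in> G n" by auto
    have "a * b \<in> G (m + n)" using m n graded unfolding graded_supercomm_algebra_def by blast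
    moreover have "(m + n) mod 2 = int ((p + q) mod 2)" using m n by (metis mod_add_eq of_nat_add
        of_nat_numeral zmod_int)
    ultimately show ?case by (auto simp: Apar_def intro!: span_base)
  qed
qed

lemma Apar_commute:
  assumes "a \<in> Apar G p" "b \<in> Apar G q" "p < 2" "q < 2"
  shows "a * b = sgni (int p * int q) *\<^sub>R (b * a)"
  using assms(1) unfolding Apar_def[of G p]
proof (induct rule: span_induct_cases)
  case subspace
  show ?case
    by (rule subspace_pointwise_linear) (auto simp: algebra_simps)
next
  case (base a)
  then obtain m where m: "m mod 2 = int p" "a \<in> G m" by auto
  show ?case using assms(2) unfolding Apar_def[of G q]
  proof (induct rule: span_induct_cases)
    case subspace
    show ?case
      by (rule subspace_pointwise_linear) (auto simp: algebra_simps)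
  next
    case (base b)
    then obtain n where n: "n mod 2 = int q" "b \<in> G n" by auto
    have "a * b = (if even (m * n) then b * a else - (b * a))"
      using m n graded unfolding graded_supercomm_algebra_def by blast
    moreover have "even (m * n) = even (int p * int q)"
      using m n by (metis even_mult_iff even_mod_2_iff)
    ultimately show ?case by (simp add: sgni_def)
  qed
qed

lemma acomp_unique:
  assumes "b \<in> Apar G p" "a - b \<in> Apar G (1 - p)" "p < 2"
  shows "acomp G p a = b"
  unfolding acomp_def
proof (rule the_equality)
  fix c assume c: "c \<in> Apar G p \<and> a - c \<in> Apar G (1 - p)"
  have "b - c \<in> Apar G p" "(a - c) - (a - b) \<in> Apar G (1 - p)"
    using c assms subspace_diff[OF subspace_Apar] by blast+
  then have "b - c \<in> Apar G p" "b - c \<in> Apar G (1 - p)" by simp_all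
  then have "b - c = 0" using Apar_inter[of "b - c"] less_two_cases[OF assms(3)] by auto
  then show "c = b" by simp
qed (use assms in auto)

lemma acomp_sum: "a \<in> Apar G 0 \<Longrightarrow> b \<in> Apar G 1 \<Longrightarrow> acomp G 0 (a + b) = a
    \<and> acomp G 1 (a + b) = b"
  by (auto intro!: acomp_unique)

lemma acomp_in: "p < 2 \<Longrightarrow> acomp G p a \<in> Apar G p"
  and acomp_decomp: "acomp G 0 a + acomp G 1 a = a"
proof -
  obtain b c where "b \<in> Apar G 0" "c \<in> Apar G 1" "a = b + c"
    using Apar_exists[of a] by blast
  with acomp_sum[of b c] have "acomp G 0 a \<in> Apar G 0 \<and> acomp G 1 a \<in> Apar G 1 \<and> acomp G 0 a
      + acomp G 1 a = a"
    by simp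
  note * = this
  from * show "acomp G p a \<in> Apar G p" if "p < 2"
    using less_two_cases[OF that] by auto
  from * show "acomp G 0 a + acomp G 1 a = a" by simp
qed

lemma acomp_linear:
  assumes "p < 2" shows "linear (acomp G p)"
proof
  show "acomp G p (x + y) = acomp G p x + acomp G p y" for x y
  proof -
    have *: "x + y = (acomp G 0 x + acomp G 0 y) + (acomp G 1 x + acomp G 1 y)"
      using acomp_decomp[of x] acomp_decomp[of y] by (simp add: algebra_simps)
    show ?thesis
      using acomp_sum[of "acomp G 0 x + acomp G 0 y" "acomp G 1 x + acomp G 1 y"]
        less_two_cases[OF assms] by (auto simp flip: * simp: acomp_in Apar_add)
  qed
  show "acomp G p (c *\<^sub>R x) = c *\<^sub>R acomp G p x" for c x
    using acomp_sum[of "c *\<^sub>R acomp G 0 x" "c *\<^sub>R acomp G 1 x"]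
      acomp_decomp[of x] less_two_cases[OF assms]
    by (auto simp: acomp_in Apar_scaleR simp flip: scaleR_add_right)
qed

lemma acomp_hom:
  assumes "a \<in> Apar G p" "p < 2" "q < 2"
  shows "acomp G q a = (if p = q then a else 0)"
  using assms acomp_sum[of a 0] acomp_sum[of 0 a] less_two_cases[of p] less_two_cases[of q] by auto

section \<open>Parity of tensors, detected by the grading involution\<close>

definition parity_map :: "'a \<Rightarrow> 'a" where
  "parity_map a = acomp G 0 a - acomp G 1 a"

lemma parity_map_linear: "linear parity_map"
  unfolding parity_map_def by (intro linear_compose_sub acomp_linear) auto

lemma parity_map_Apar: "a \<in> Apar G p \<Longrightarrow> p < 2 \<Longrightarrow> parity_map a = sgni (int p)
    *\<^sub>R a"
  by (auto simp: parity_map_def acomp_hom sgni_def dest!: less_two_cases)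

text \<open>\<open>Tpar\<close> ranges over all natural numbers as parities of the two factors. No
  integer has a residue of 2 or more modulo 2, so such factors come from the span of the empty
  set.\<close>

lemma Apar_ge2: "\<not> p < 2 \<Longrightarrow> Apar G p = {0}"
proof -
  assume "\<not> p < 2"
  then have "{n. n mod 2 = int p} = {}" by (auto simp: mod2_eq_if)
  then show ?thesis by (auto simp: Apar_def)
qed

text \<open>Precomposing both functionals with \<open>parity_map\<close> is the transpose of the
  grading involution on both tensor factors; each factor contributes the sign of its parity, and the
  signs multiply.\<close>

lemma Tpar_twist:
  assumes "t \<in> Tpar G p" "linear \<phi>" "linear \<psi>"
  shows "t (\<lambda>x. \<phi> (parity_map x), \<lambda>x. \<psi> (parity_map x)) = sgni (int p) * t (\<phi>, \<psi>)"
  using assms(1) unfolding Tpar_def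
proof (induct rule: span_induct_cases)
  case subspace
  show ?case
    by (rule subspace_pointwise_linear) (auto simp: algebra_simps fun_apply)
next
  case (base t)
  then obtain a b p1 p2 where t: "t = tensor a b" "a \<in> Apar G p1" "b \<in> Apar G p2" "(p1 + p2) mod 2 = p"
    by auto
  show ?case
  proof (cases "p1 < 2 \<and> p2 < 2")
    case True
    have "linear (\<lambda>x. \<phi> (parity_map x))" "linear (\<lambda>x. \<psi> (parity_map x))"
      using assms parity_map_linear linear_compose[unfolded o_def] by blast+
    moreover have "sgni (int p) = sgni (int p1) * sgni (int p2)"
      by (simp flip: sgni_add t(4)) (auto simp: sgni_def)
    ultimately show ?thesis using t True assms
      by (simp add: tensor_def parity_map_Apar linear_scale[OF assms(2)] linear_scale[OF assms(3)])
  next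
    case False
    then have "t = 0" using t Apar_ge2 by auto
    then show ?thesis by (simp add: fun_apply)
  qed
qed

lemma Tpar_zero_nonlinear:
  assumes "t \<in> Tpar G p" "\<not> (linear \<phi> \<and> linear \<psi>)" shows "t (\<phi>, \<psi>) = 0"
  using assms(1) unfolding Tpar_def
proof (induct rule: span_induct_cases)
  case subspace
  show ?case by (rule subspace_pointwise_linear) (auto simp: fun_apply)
next
  case (base t)
  then show ?case using assms(2) by (auto simp: tensor_def)
qed

text \<open>At linear functionals the twisted value equals that of \<open>t\<close> and that of
  \<open>-t\<close>; elsewhere tensors are 0 by convention.\<close>

lemma Tpar_inter:
  assumes "t \<in> Tpar G 0" "t \<in> Tpar G 1" shows "t = 0"
proof (rule ext, clarify)
  fix \<phi> \<psi> :: "'a \<Rightarrow> real"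
  show "t (\<phi>, \<psi>) = 0 (\<phi>, \<psi>)"
  proof (cases "linear \<phi> \<and> linear \<psi>")
    case True
    then show ?thesis using Tpar_twist[OF assms(1), of \<phi> \<psi>] Tpar_twist[OF assms(2), of \<phi> \<psi>]
      by (simp add: sgni_def fun_apply)
  qed (use Tpar_zero_nonlinear[OF assms(1)] in \<open>auto simp: fun_apply\<close>)
qed

lemma tensor_Tpar:
  "a \<in> Apar G p \<Longrightarrow> b \<in> Apar G q \<Longrightarrow> (p + q) mod 2 = r \<Longrightarrow>
      tensor a b \<in> Tpar G r"
  unfolding Tpar_def by (rule span_base) blast

text \<open>The kernel of multiplication is graded because multiplication respects parity: splitting
  both entries of every pair gives an even block \<open>E 0 0 @ E 1 1\<close> and an odd block
  \<open>E 0 1 @ E 1 0\<close>, whose products are the even and the odd part of zero.\<close>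

lemma Omega1_decompose:
  assumes "t \<in> Omega1"
  shows "\<exists>s0\<in>O1par G 0. \<exists>s1\<in>O1par G 1. t = s0 + s1"
proof -
  from assms obtain xs where xs:
    "t = sum_list (map (case_prod tensor) xs)" "sum_list (map (\<lambda>(a, b). a * b) xs) = 0"
    by (auto simp: Omega1_def)
  define E where "E p q = map (\<lambda>(a, b). (acomp G p a, acomp G q b)) xs" for p q
  let ?T = "\<lambda>xs :: ('a \<times> 'a) list. sum_list (map (case_prod tensor) xs)"
  let ?M = "\<lambda>xs :: ('a \<times> 'a) list. sum_list (map (\<lambda>(a, b). a * b) xs)"
  have T: "?T xs = ?T (E 0 0 @ E 1 1) + ?T (E 0 1 @ E 1 0)"
    unfolding E_def
  proof (induct xs)
    case (Cons x xs)
    obtain a b where x: "x = (a, b)" by force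
    have "tensor a b = tensor (acomp G 0 a + acomp G 1 a) (acomp G 0 b + acomp G 1 b)"
      by (simp add: acomp_decomp)
    then show ?case using Cons unfolding x by (simp add: tensor_add_left tensor_add_right add_ac)
  qed simp
  have M: "?M xs = ?M (E 0 0 @ E 1 1) + ?M (E 0 1 @ E 1 0)"
    unfolding E_def
  proof (induct xs)
    case (Cons x xs)
    obtain a b where x: "x = (a, b)" by force
    have "a * b = (acomp G 0 a + acomp G 1 a) * (acomp G 0 b + acomp G 1 b)"
      by (simp add: acomp_decomp)
    then show ?case using Cons unfolding x by (simp add: algebra_simps)
  qed simp
  have M01: "?M (E p q) \<in> Apar G ((p + q) mod 2)" if "p < 2" "q < 2" for p q
    unfolding E_def using that
    by (auto intro!: sum_list_in_subspace subspace_Apar Apar_mult simp: acomp_in)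
  have T01: "?T (E p q) \<in> Tpar G ((p + q) mod 2)" if "p < 2" "q < 2" for p q
    unfolding E_def using that
    by (auto intro!: sum_list_in_subspace subspace_Tpar tensor_Tpar[OF _ _ refl] simp: acomp_in)
  have m: "?M (E 0 0 @ E 1 1) \<in> Apar G 0" "?M (E 0 1 @ E 1 0) \<in> Apar G 1"
    using M01[of 0 0] M01[of 1 1] M01[of 0 1] M01[of 1 0] by (auto intro: Apar_add)
  have t: "?T (E 0 0 @ E 1 1) \<in> Tpar G 0" "?T (E 0 1 @ E 1 0) \<in> Tpar G 1"
    using T01[of 0 0] T01[of 1 1] T01[of 0 1] T01[of 1 0]
    by (auto intro: subspace_add[OF subspace_Tpar])
  have "?M (E 0 0 @ E 1 1) = 0" "?M (E 0 1 @ E 1 0) = 0"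
    using acomp_sum[OF m, folded M] acomp_hom[of 0 0 0] acomp_hom[of 0 0 1] by (simp_all add: xs(2))
  then have "?T (E 0 0 @ E 1 1) \<in> O1par G 0" "?T (E 0 1 @ E 1 0) \<in> O1par G 1"
    using t unfolding O1par_def Omega1_def by blast+
  then show ?thesis using T xs(1) by blast
qed

lemma tcomp_unique:
  assumes "b \<in> Tpar G p" "a - b \<in> Tpar G (1 - p)" "p < 2"
  shows "tcomp G p a = b"
  unfolding tcomp_def
proof (rule the_equality)
  fix c assume c: "c \<in> Tpar G p \<and> a - c \<in> Tpar G (1 - p)"
  have "b - c \<in> Tpar G p" "(a - c) - (a - b) \<in> Tpar G (1 - p)"
    using c assms subspace_diff[OF subspace_Tpar] by blast+
  then have "b - c \<in> Tpar G p" "b - c \<in> Tpar G (1 - p)" by simp_all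
  then have "b - c = 0" using Tpar_inter[of "b - c"] less_two_cases[OF assms(3)] by auto
  then show "c = b" by simp
qed (use assms in auto)

lemma tcomp_sum: "a \<in> O1par G 0 \<Longrightarrow> b \<in> O1par G 1 \<Longrightarrow> tcomp G 0 (a + b) = a
    \<and> tcomp G 1 (a + b) = b"
  by (auto intro!: tcomp_unique simp: O1par_def)

lemma tcomp:
  assumes "t \<in> Omega1"
  shows tcomp_in: "p < 2 \<Longrightarrow> tcomp G p t \<in> O1par G p"
    and tcomp_decomp: "tcomp G 0 t + tcomp G 1 t = t"
proof -
  obtain b c where "b \<in> O1par G 0" "c \<in> O1par G 1" "t = b + c"
    using Omega1_decompose[OF assms] by blast
  with tcomp_sum[of b c] have *: "tcomp G 0 t \<in> O1par G 0 \<and> tcomp G 1 t \<in> O1par G 1 \<and> tcomp G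
      0 t + tcomp G 1 t = t"
    by simp
  then show "tcomp G p t \<in> O1par G p" if "p < 2"
    using less_two_cases[OF that] by auto
  from * show "tcomp G 0 t + tcomp G 1 t = t" by simp
qed

lemma tcomp_hom:
  assumes "a \<in> O1par G p" "p < 2" "q < 2"
  shows "tcomp G q a = (if p = q then a else 0)"
  using assms tcomp_sum[of a 0] tcomp_sum[of 0 a] less_two_cases[of p] less_two_cases[of q] by auto

lemma tcomp_lincomb:
  assumes "s \<in> Omega1" "t \<in> Omega1" "p < 2"
  shows "tcomp G p (c *\<^sub>R s + t) = c *\<^sub>R tcomp G p s + tcomp G p t"
proof -
  have *: "c *\<^sub>R s + t = (c *\<^sub>R tcomp G 0 s + tcomp G 0 t) + (c *\<^sub>R tcomp G 1 s + tcomp G 1 t)"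
  proof -
    have "c *\<^sub>R s + t = c *\<^sub>R (tcomp G 0 s + tcomp G 1 s) + (tcomp G 0 t + tcomp G 1 t)"
      using assms by (simp add: tcomp_decomp)
    then show ?thesis by (simp add: scaleR_right_distrib add_ac)
  qed
  show ?thesis unfolding *
    using tcomp_sum[of "c *\<^sub>R tcomp G 0 s + tcomp G 0 t" "c *\<^sub>R tcomp G 1 s + tcomp G 1 t"]
      less_two_cases[OF assms(3)] assms(1,2)
    by (auto simp: tcomp_in O1par_add O1par_scaleR)
qed

lemma lact_O1par:
  assumes "f \<in> Apar G p" "t \<in> O1par G q" "p < 2" "q < 2"
  shows "lact f t \<in> O1par G ((p + q) mod 2)"
proof -
  have "t \<in> Tpar G q" using assms(2) by (simp add: O1par_def)
  then have "lact f t \<in> Tpar G ((p + q) mod 2)" unfolding Tpar_def[of G q]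
  proof (induct rule: span_induct_cases)
    case subspace
    show ?case
      by (rule subspace_pointwise_linear)
         (auto simp: subspace_add[OF subspace_Tpar] subspace_scale[OF subspace_Tpar] subspace_0[OF subspace_Tpar])
  next
    case (base t)
    then obtain a b p1 p2 where t: "t = tensor a b" "a \<in> Apar G p1" "b \<in> Apar G p2" "(p1 + p2) mod 2 = q"
      by auto
    show ?case
    proof (cases "p1 < 2")
      case True
      have "((p + p1) mod 2 + p2) mod 2 = (p + q) mod 2"
        unfolding t(4)[symmetric] by (simp add: mod_add_left_eq mod_add_right_eq add.assoc)
      then show ?thesis unfolding t(1) lact_tensor
        by (rule tensor_Tpar[OF Apar_mult[OF assms(1) t(2) assms(3) True] t(3)])
    next
      case False
      then show ?thesis using t Apar_ge2[of p1] by (auto simp: subspace_0[OF subspace_Tpar])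
    qed
  qed
  then show ?thesis using assms(2) by (simp add: O1par_def lact_Omega1)
qed

end

declare split_paired_All [simp del] split_paired_Ex [simp del]

subsection \<open>Formal combinations of words\<close>

lemma independent_wd: "independent (range (wd :: 'a word \<Rightarrow> 'a form))"
proof
  assume "dependent (range (wd :: 'a word \<Rightarrow> 'a form))"
  then obtain S and u :: "'a form \<Rightarrow> real" and v where
    S: "finite S" "S \<subseteq> range wd" "v \<in> S" "u v \<noteq> 0" "(\<Sum>v\<in>S. u v *\<^sub>R v) = 0"
    unfolding dependent_explicit by blast
  obtain w where w: "v = wd w" using S by blast
  have "(\<Sum>x\<in>S. u x *\<^sub>R x) w = (\<Sum>x\<in>S. u x * x w)"
    using S(1) by (induct S) (auto simp: fun_apply)
  also have "\<dots> = (\<Sum>x\<in>S. if x = v then u v else 0)"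
    by (rule sum.cong) (use S(2) in \<open>auto simp: w wd_def split: if_splits\<close>)
  also have "\<dots> = u v" using S by simp
  finally show False using S by (simp add: fun_apply)
qed

lemma inj_wd: "inj wd"
  by (rule injI) (auto simp: wd_def fun_eq_iff split: if_splits)

text \<open>Words are independent but do not span the form type, which also contains functions of
  infinite support. \<open>lext F\<close> is some linear extension, determined only on finite
  combinations of words.\<close>

definition lext :: "('a word \<Rightarrow> 'c::real_vector) \<Rightarrow> 'a form \<Rightarrow> 'c" where
  "lext F = (SOME g. linear g \<and> (\<forall>w. g (wd w) = F w))"

lemma lext: "linear (lext F)" "lext F (wd w) = F w"
proof -
  obtain g where "linear g" "\<And>x. x \<in> range wd \<Longrightarrow> g x = F (inv wd x)"
    using linear_independent_extend[OF independent_wd, of "\<lambda>x. F (inv wd x)"] by blast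
  then have "linear g \<and> (\<forall>w. g (wd w) = F w)"
    by (simp add: inv_f_f[OF inj_wd])
  then have "linear (lext F) \<and> (\<forall>w. lext F (wd w) = F w)"
    unfolding lext_def by (rule someI[where P = "\<lambda>g. linear g \<and> (\<forall>w. g (wd w) = F w)"])
  then show "linear (lext F)" "lext F (wd w) = F w" by auto
qed

lemmas linear_lext = lext(1) and lext_wd [simp] = lext(2)
lemmas lext_add [simp] = linear_add[OF linear_lext]
  and lext_diff [simp] = linear_diff[OF linear_lext]
  and lext_scaleR [simp] = linear_scale[OF linear_lext]
  and lext_neg [simp] = linear_neg[OF linear_lext]
  and lext_zero [simp] = linear_0[OF linear_lext]

lemma lext_span_in:
  assumes "x \<in> span B" "subspace V" "\<And>b. b \<in> B \<Longrightarrow> lext F b \<in> V"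
  shows "lext F x \<in> V"
  using assms(1)
  by (induct rule: span_induct_cases)
     (use assms(2,3) in \<open>auto simp: subspace_def\<close>)

text \<open>\<open>wedge\<close> sums over supports, and a sum over an infinite set is 0 by
  convention; finite supports are what make \<open>wedge\<close> a bilinear extension.\<close>

lemma span_wd_support:
  assumes "x \<in> span (wd ` W)"
  shows "finite {u. x u \<noteq> 0} \<and> {u. x u \<noteq> 0} \<subseteq> W"
  using assms
proof (induct rule: span_induct_cases)
  case subspace
  show ?case
  proof (rule subspace_pointwise_linear)
    fix x y :: "'a form"
    assume *: "finite {u. x u \<noteq> 0} \<and> {u. x u \<noteq> 0} \<subseteq> W" "finite {u. y u \<noteq> 0}
        \<and> {u. y u \<noteq> 0} \<subseteq> W"
    have "{u. (x + y) u \<noteq> 0} \<subseteq> {u. x u \<noteq> 0} \<union> {u. y u \<noteq> 0}" by (auto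
        simp: fun_apply)
    then show "finite {u. (x + y) u \<noteq> 0} \<and> {u. (x + y) u \<noteq> 0} \<subseteq> W"
      using * by (blast intro: finite_subset)
  next
    fix c and x :: "'a form"
    assume *: "finite {u. x u \<noteq> 0} \<and> {u. x u \<noteq> 0} \<subseteq> W"
    have "{u. (c *\<^sub>R x) u \<noteq> 0} \<subseteq> {u. x u \<noteq> 0}" by (auto simp: fun_apply)
    then show "finite {u. (c *\<^sub>R x) u \<noteq> 0} \<and> {u. (c *\<^sub>R x) u \<noteq> 0} \<subseteq> W"
      using * by (blast intro: finite_subset)
  qed (simp add: fun_apply)
next
  case (base b)
  then obtain w where w: "w \<in> W" "b = wd w" by auto
  then have "{u. b u \<noteq> 0} = {w}" by (auto simp: wd_def)
  then show ?case using w by simp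
qed

lemma form_expand:
  assumes "finite {u. x u \<noteq> 0}"
  shows "x = (\<Sum>u\<in>{u. x u \<noteq> 0}. x u *\<^sub>R wd u)"
proof
  fix w
  have "(\<Sum>u\<in>S. x u *\<^sub>R wd u) w = (\<Sum>u\<in>S. if u = w then x w else 0)" if "finite S" for S
    using that by (induct S) (auto simp: fun_apply wd_def)
  then show "x w = (\<Sum>u\<in>{u. x u \<noteq> 0}. x u *\<^sub>R wd u) w" using assms by simp
qed

text \<open>\<open>wedge\<close> extends \<open>wmul\<close> bilinearly, so words decide. This
  serves both the representation and the homomorphisms given on generators.\<close>

lemma lext_wedge_mult:
  fixes F :: "'a::real_algebra_1 word \<Rightarrow> 'c::real_algebra"
  assumes "x \<in> span (wd ` W)" "y \<in> span (wd ` W)"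
    and mult: "\<And>u w. u \<in> W \<Longrightarrow> w \<in> W \<Longrightarrow> lext F (wmul u w) = F u * F w"
  shows "lext F (wedge x y) = lext F x * lext F y"
proof -
  note fx = span_wd_support[OF assms(1)] and fy = span_wd_support[OF assms(2)]
  have "lext F (wedge x y) = (\<Sum>u\<in>{u. x u \<noteq> 0}. \<Sum>w\<in>{w. y w \<noteq> 0}. (x u * y w)
      *\<^sub>R lext F (wmul u w))"
    by (simp add: wedge_def linear_sum[OF linear_lext])
  also have "\<dots> = (\<Sum>u\<in>{u. x u \<noteq> 0}. \<Sum>w\<in>{w. y w \<noteq> 0}. (x u *\<^sub>R F u) *
      (y w *\<^sub>R F w))"
    using fx fy by (intro sum.cong refl) (simp add: mult subset_iff mult.commute)
  also have "\<dots> = (\<Sum>u\<in>{u. x u \<noteq> 0}. x u *\<^sub>R F u) * (\<Sum>w\<in>{w. y w \<noteq> 0}.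
      y w *\<^sub>R F w)"
    by (simp add: sum_product)
  also have "(\<Sum>u\<in>{u. x u \<noteq> 0}. x u *\<^sub>R F u) = lext F x"
    by (subst (3) form_expand) (use fx in \<open>auto simp: linear_sum[OF linear_lext]\<close>)
  also have "(\<Sum>u\<in>{u. y u \<noteq> 0}. y u *\<^sub>R F u) = lext F y"
    by (subst (3) form_expand) (use fy in \<open>auto simp: linear_sum[OF linear_lext]\<close>)
  finally show ?thesis .
qed

subsection \<open>The relations as a two-sided ideal\<close>

definition vlist :: "(int \<Rightarrow> 'a::real_algebra_1 set) \<Rightarrow> (nat \<times> 'a tens) list
    \<Rightarrow> bool" where
  "vlist G as \<longleftrightarrow> (\<forall>x \<in> set as. fst x < 2 \<and> snd x \<in> O1par G (fst x))"

lemma vlist_simps [simp]: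
  "vlist G []"
  "vlist G ((q, \<alpha>) # as) \<longleftrightarrow> q < 2 \<and> \<alpha> \<in> O1par G q \<and> vlist G as"
  "vlist G (as @ bs) \<longleftrightarrow> vlist G as \<and> vlist G bs"
  by (auto simp: vlist_def)

lemma valid_word_simp [simp]:
  "valid_word G (p, f, as) \<longleftrightarrow> p < 2 \<and> f \<in> Apar G p \<and> vlist G as"
  by (auto simp: valid_word_def vlist_def)

lemma wmul_simp: "wmul (p, f, as) (q, g, bs) =
    ((-1) ^ (q * sum_list (map fst as))) *\<^sub>R wd ((p + q) mod 2, f * g, as @ bs)"
  by (simp add: wmul_def)

definition Rid :: "(int \<Rightarrow> 'a::real_algebra_1 set) \<Rightarrow> 'a form set" where
  "Rid G = span (Relators G)"

lemma subspace_Rid: "subspace (Rid G)" by (simp add: Rid_def)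
lemma Rid_scale: "x \<in> Rid G \<Longrightarrow> c *\<^sub>R x \<in> Rid G" by (simp add: Rid_def span_scale)
lemma Rid_add: "x \<in> Rid G \<Longrightarrow> y \<in> Rid G \<Longrightarrow> x + y \<in> Rid G" by (simp
    add: Rid_def span_add)

lemma Rid_add0: "valid_word G (p, f, as) \<Longrightarrow> valid_word G (p, g, as) \<Longrightarrow>
    wd (p, f + g, as) - wd (p, f, as) - wd (p, g, as) \<in> Rid G"
  unfolding Rid_def Relators_def by (rule span_base, rule UnI1, rule UnI1, rule UnI1, rule UnI1, blast)

lemma Rid_scale0: "valid_word G (p, f, as) \<Longrightarrow> wd (p, c *\<^sub>R f, as) - c *\<^sub>R wd (p, f,
    as) \<in> Rid G"
  unfolding Rid_def Relators_def by (rule span_base, rule UnI1, rule UnI1, rule UnI1, rule UnI2, blast)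

lemma Rid_add1: "valid_word G (p, f, us @ [(q, \<alpha>)] @ vs) \<Longrightarrow> valid_word G (p, f, us @ [(q,
    \<beta>)] @ vs) \<Longrightarrow>
    wd (p, f, us @ [(q, \<alpha> + \<beta>)] @ vs) - wd (p, f, us @ [(q, \<alpha>)] @ vs) - wd (p, f, us @ [(q,
        \<beta>)] @ vs) \<in> Rid G"
  unfolding Rid_def Relators_def by (rule span_base, rule UnI1, rule UnI1, rule UnI2, blast)

lemma Rid_lact: "q' < 2 \<Longrightarrow> g \<in> Apar G q' \<Longrightarrow> valid_word G (p, f, us @ [(q,
    \<alpha>)] @ vs) \<Longrightarrow>
    valid_word G (p, f, us @ [((q' + q) mod 2, lact g \<alpha>)] @ vs) \<Longrightarrow>
    wd (p, f, us @ [((q' + q) mod 2, lact g \<alpha>)] @ vs)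
        - ((-1) ^ (q' * sum_list (map fst us))) *\<^sub>R wd ((p + q') mod 2, f * g, us @ [(q, \<alpha>)] @ vs)
            \<in> Rid G"
  unfolding Rid_def Relators_def by (rule span_base, rule UnI1, rule UnI2, blast)

lemma Rid_swap: "valid_word G (p, f, us @ [(q1, \<alpha>1), (q2, \<alpha>2)] @ vs) \<Longrightarrow>
    wd (p, f, us @ [(q1, \<alpha>1), (q2, \<alpha>2)] @ vs)
        + ((-1) ^ (q1 * q2)) *\<^sub>R wd (p, f, us @ [(q2, \<alpha>2), (q1, \<alpha>1)] @ vs) \<in> Rid G"
  unfolding Rid_def Relators_def by (rule span_base, rule UnI2, blast)

lemma Relators_cases [consumes 1, case_names add0 scale0 add1 lact swap]:
  assumes "x \<in> Relators G"
  obtains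
    p f g as where "x = wd (p, f + g, as) - wd (p, f, as) - wd (p, g, as)"
      "valid_word G (p, f, as)" "valid_word G (p, g, as)"
  | p c f as where "x = wd (p, c *\<^sub>R f, as) - c *\<^sub>R wd (p, f, as)" "valid_word G (p, f, as)"
  | p f us q \<alpha> \<beta> vs where "x = wd (p, f, us @ [(q, \<alpha> + \<beta>)] @ vs) - wd (p, f, us @
      [(q, \<alpha>)] @ vs)
        - wd (p, f, us @ [(q, \<beta>)] @ vs)"
      "valid_word G (p, f, us @ [(q, \<alpha>)] @ vs)" "valid_word G (p, f, us @ [(q, \<beta>)] @ vs)"
  | p f us q' g q \<alpha> vs where "x = wd (p, f, us @ [((q' + q) mod 2, lact g \<alpha>)] @ vs)
        - ((-1) ^ (q' * sum_list (map fst us))) *\<^sub>R wd ((p + q') mod 2, f * g, us @ [(q, \<alpha>)] @ vs)"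
      "q' < 2" "g \<in> Apar G q'" "valid_word G (p, f, us @ [(q, \<alpha>)] @ vs)"
      "valid_word G (p, f, us @ [((q' + q) mod 2, lact g \<alpha>)] @ vs)"
  | p f us q1 \<alpha>1 q2 \<alpha>2 vs where "x = wd (p, f, us @ [(q1, \<alpha>1), (q2, \<alpha>2)] @ vs)
        + ((-1) ^ (q1 * q2)) *\<^sub>R wd (p, f, us @ [(q2, \<alpha>2), (q1, \<alpha>1)] @ vs)"
      "valid_word G (p, f, us @ [(q1, \<alpha>1), (q2, \<alpha>2)] @ vs)"
  using assms unfolding Relators_def Un_iff mem_Collect_eq
  by (elim disjE exE conjE) blast+

definition hwords :: "(int \<Rightarrow> 'a::real_algebra_1 set) \<Rightarrow> nat \<Rightarrow> nat
    \<Rightarrow> 'a word set" where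
  "hwords G r p = {w. valid_word G w \<and> wdeg w = r \<and> wpar w = p}"

lemma hwords_simp: "(p, f, as) \<in> hwords G r d \<longleftrightarrow>
    valid_word G (p, f, as) \<and> length as = r \<and> (p + sum_list (map fst as)) mod 2 = d"
  by (simp add: hwords_def wdeg_def wpar_def)

context graded_algebra
begin

lemma wd_hwords: "(p, f, as) \<in> hwords G r d \<Longrightarrow> wd (p, f, as) \<in> span (wd ` hwords G r d)"
  by (rule span_base) blast

text \<open>All terms of a relator share form degree and parity. This places the relations inside
  \<open>Om G\<close>, and it later gives a relation a bidegree, hence a well-defined sign rule,
  when its bracket is shown to vanish.\<close>

lemma Relators_homogeneous:
  assumes x: "x \<in> Relators G"
  shows "\<exists>r d. x \<in> span (wd ` hwords G r d)"
  using x
proof (cases rule: Relators_cases)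
  case (add0 p f g as)
  show ?thesis
    by (rule exI[of _ "length as"], rule exI[of _ "(p + sum_list (map fst as)) mod 2"])
       (use add0 in \<open>auto intro!: span_diff wd_hwords simp: hwords_simp Apar_add\<close>)
next
  case (scale0 p c f as)
  show ?thesis
    by (rule exI[of _ "length as"], rule exI[of _ "(p + sum_list (map fst as)) mod 2"])
       (use scale0 in \<open>auto intro!: span_diff span_scale wd_hwords simp: hwords_simp Apar_scaleR\<close>)
next
  case (add1 p f us q \<alpha> \<beta> vs)
  show ?thesis
    by (rule exI[of _ "length us + length vs + 1"], rule exI[of _ "(p + sum_list (map fst us) + q + sum_list
        (map fst vs)) mod 2"])
       (use add1 in \<open>auto intro!: span_diff span_scale wd_hwords simp: hwords_simp O1par_add add_ac\<close>)
next
  case (lact p f us q' g q \<alpha> vs)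
  let ?d = "(p + (sum_list (map fst us) + ((q' + q) mod 2 + sum_list (map fst vs)))) mod 2"
  let ?r = "length us + length vs + 1"
  have "((p + q') mod 2 + (sum_list (map fst us) + (q + sum_list (map fst vs)))) mod 2 = ?d"
    by (auto simp: mod2_eq_if)
  then have "(p, f, us @ [((q' + q) mod 2, lact g \<alpha>)] @ vs) \<in> hwords G ?r ?d"
    "((p + q') mod 2, f * g, us @ [(q, \<alpha>)] @ vs) \<in> hwords G ?r ?d"
    using lact Apar_mult[of f p g q'] by (simp_all add: hwords_simp)
  then show ?thesis unfolding lact(1)
    by (intro exI span_diff span_scale wd_hwords)
next
  case (swap p f us q1 \<alpha>1 q2 \<alpha>2 vs)
  show ?thesis
    by (rule exI[of _ "length us + length vs + 2"], rule exI[of _ "(p + sum_list (map fst us) + q1 + q2 +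
        sum_list (map fst vs)) mod 2"])
       (use swap in \<open>auto intro!: span_add span_scale wd_hwords simp: hwords_simp add_ac\<close>)
qed

lemma Rid_subset_Om: "Rid G \<subseteq> Om G"
proof -
  have "x \<in> Om G" if "x \<in> Relators G" for x
  proof -
    from Relators_homogeneous[OF that] obtain r d where "x \<in> span (wd ` hwords G r d)" by blast
    then show ?thesis unfolding Om_def
      using span_mono[of "wd ` hwords G r d" "wd ` {w. valid_word G w}"] by (auto simp: hwords_def)
  qed
  then show ?thesis unfolding Rid_def by (intro span_minimal) (auto simp: Om_def)
qed

text \<open>Left multiplication prepends the one-forms of \<open>u\<close>; up to a common sign the
  result is a relator of the same kind with longer words.\<close>

lemma Rid_left_ideal:
  assumes u: "valid_word G u" and x: "x \<in> Rid G"
  shows "lext (wmul u) x \<in> Rid G"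
  using x unfolding Rid_def
proof (rule lext_span_in)
  obtain r h bs where ueq: "u = (r, h, bs)" by (cases u)
  let ?b = "sum_list (map fst bs)"
  note v = u[unfolded ueq, simplified]
  note mult = Apar_mult[of h r, OF v[THEN conjunct2, THEN conjunct1] _ v[THEN conjunct1]]
  fix x assume "x \<in> Relators G"
  then have "lext (wmul u) x \<in> Rid G"
  proof (cases rule: Relators_cases)
    case (add0 p f g as)
    have "lext (wmul u) x = ((-1) ^ (p * ?b)) *\<^sub>R (wd ((r + p) mod 2, h * f + h * g, bs @ as)
        - wd ((r + p) mod 2, h * f, bs @ as) - wd ((r + p) mod 2, h * g, bs @ as))"
      by (simp add: add0(1) ueq wmul_simp algebra_simps)
    also have "\<dots> \<in> Rid G" by (intro Rid_scale Rid_add0) (use v add0 mult in auto)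
    finally show ?thesis .
  next
    case (scale0 p c f as)
    have "lext (wmul u) x = ((-1) ^ (p * ?b)) *\<^sub>R (wd ((r + p) mod 2, c *\<^sub>R (h * f), bs @ as)
        - c *\<^sub>R wd ((r + p) mod 2, h * f, bs @ as))"
      by (simp add: scale0(1) ueq wmul_simp algebra_simps)
    also have "\<dots> \<in> Rid G" by (intro Rid_scale Rid_scale0) (use v scale0 mult in auto)
    finally show ?thesis .
  next
    case (add1 p f us q \<alpha> \<beta> vs)
    have "lext (wmul u) x = ((-1) ^ (p * ?b)) *\<^sub>R (wd ((r + p) mod 2, h * f, (bs @ us) @ [(q, \<alpha> +
        \<beta>)] @ vs)
        - wd ((r + p) mod 2, h * f, (bs @ us) @ [(q, \<alpha>)] @ vs) - wd ((r + p) mod 2, h * f, (bs @ us) @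
            [(q, \<beta>)] @ vs))"
      by (simp add: add1(1) ueq wmul_simp algebra_simps)
    also have "\<dots> \<in> Rid G" by (intro Rid_scale Rid_add1) (use v add1 mult in auto)
    finally show ?thesis .
  next
    case (lact p f us q' g q \<alpha> vs)
    have t: "(r + (p + q') mod 2) mod 2 = ((r + p) mod 2 + q') mod 2" by presburger
    \<comment> \<open>Extracting \<open>g\<close> raises the coefficient parity from
      \<open>p\<close> to \<open>p + q'\<close>, so the second word acquires an extra sign in
      passing \<open>bs\<close>. The longer prefix \<open>bs @ us\<close> demands exactly this
      sign.\<close>
    have s: "(-1 :: real) ^ (q' * sum_list (map fst us)) * (-1) ^ ((p + q') mod 2 * ?b)
      = (-1) ^ (p * ?b) * (-1) ^ (q' * sum_list (map fst (bs @ us)))"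
      by (auto simp: minus_one_power_iff)
    have "lext (wmul u) x = ((-1) ^ (p * ?b)) *\<^sub>R (wd ((r + p) mod 2, h * f, (bs @ us) @ [((q' + q) mod
        2, lact g \<alpha>)] @ vs)
        - ((-1) ^ (q' * sum_list (map fst (bs @ us)))) *\<^sub>R wd (((r + p) mod 2 + q') mod 2, h * f * g, (bs
            @ us) @ [(q, \<alpha>)] @ vs))"
      unfolding scaleR_diff_right scaleR_scaleR s[symmetric]
      by (simp add: lact(1) ueq wmul_simp t mult.assoc)
    also have "\<dots> \<in> Rid G" by (intro Rid_scale Rid_lact) (use v lact mult in auto)
    finally show ?thesis .
  next
    case (swap p f us q1 \<alpha>1 q2 \<alpha>2 vs)
    have "lext (wmul u) x = ((-1) ^ (p * ?b)) *\<^sub>R (wd ((r + p) mod 2, h * f, (bs @ us) @ [(q1,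
        \<alpha>1), (q2, \<alpha>2)] @ vs)
        + ((-1) ^ (q1 * q2)) *\<^sub>R wd ((r + p) mod 2, h * f, (bs @ us) @ [(q2, \<alpha>2), (q1, \<alpha>1)]
            @ vs))"
      by (simp add: swap(1) ueq wmul_simp algebra_simps)
    also have "\<dots> \<in> Rid G" by (intro Rid_scale Rid_swap) (use v swap mult in auto)
    finally show ?thesis .
  qed
  then show "lext (wmul u) x \<in> span (Relators G)" by (simp add: Rid_def)
qed simp

lemma Rid_right_ideal:
  assumes u: "valid_word G u" and x: "x \<in> Rid G"
  shows "lext (\<lambda>w. wmul w u) x \<in> Rid G"
  using x unfolding Rid_def
proof (rule lext_span_in)
  obtain r h bs where ueq: "u = (r, h, bs)" by (cases u)
  note v = u[unfolded ueq, simplified]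
  note mult = Apar_mult[of _ _ h r, OF _ v[THEN conjunct2, THEN conjunct1] _ v[THEN conjunct1]]
  fix x assume "x \<in> Relators G"
  then have "lext (\<lambda>w. wmul w u) x \<in> Rid G"
  proof (cases rule: Relators_cases)
    case (add0 p f g as)
    have "lext (\<lambda>w. wmul w u) x = ((-1) ^ (r * sum_list (map fst as))) *\<^sub>R (wd ((p + r) mod 2, f
        * h + g * h, as @ bs)
        - wd ((p + r) mod 2, f * h, as @ bs) - wd ((p + r) mod 2, g * h, as @ bs))"
      by (simp add: add0(1) ueq wmul_simp algebra_simps)
    also have "\<dots> \<in> Rid G" by (intro Rid_scale Rid_add0) (use v add0 mult in auto)
    finally show ?thesis .
  next
    case (scale0 p c f as)
    have "lext (\<lambda>w. wmul w u) x = ((-1) ^ (r * sum_list (map fst as))) *\<^sub>R (wd ((p + r) mod 2, c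
        *\<^sub>R (f * h), as @ bs)
        - c *\<^sub>R wd ((p + r) mod 2, f * h, as @ bs))"
      by (simp add: scale0(1) ueq wmul_simp algebra_simps)
    also have "\<dots> \<in> Rid G" by (intro Rid_scale Rid_scale0) (use v scale0 mult in auto)
    finally show ?thesis .
  next
    case (add1 p f us q \<alpha> \<beta> vs)
    have "lext (\<lambda>w. wmul w u) x = ((-1) ^ (r * (sum_list (map fst us) + (q + sum_list (map fst vs)))))
        *\<^sub>R
        (wd ((p + r) mod 2, f * h, us @ [(q, \<alpha> + \<beta>)] @ (vs @ bs))
        - wd ((p + r) mod 2, f * h, us @ [(q, \<alpha>)] @ (vs @ bs)) - wd ((p + r) mod 2, f * h, us @ [(q,
            \<beta>)] @ (vs @ bs)))"
      by (simp add: add1(1) ueq wmul_simp scaleR_diff_right)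
    also have "\<dots> \<in> Rid G" by (intro Rid_scale Rid_add1) (use v add1 mult in auto)
    finally show ?thesis .
  next
    case (lact p f us q' g q \<alpha> vs)
    let ?s = "(-1 :: real) ^ (r * (sum_list (map fst us) + ((q' + q) mod 2 + sum_list (map fst vs))))"
    let ?w = "\<lambda>f. wd (((p + r) mod 2 + q') mod 2, f, us @ [(q, \<alpha>)] @ (vs @ bs))"
    have t: "((p + q') mod 2 + r) mod 2 = ((p + r) mod 2 + q') mod 2" by presburger
    have gh: "g * h = sgni (int q' * int r) *\<^sub>R (h * g)"
      using Apar_commute[of g q' h r] v lact by simp
    have s: "(-1 :: real) ^ (q' * sum_list (map fst us)) * (-1) ^ (r * (sum_list (map fst us) + (q + sum_list
        (map fst vs))))
      = ?s * (-1) ^ (q' * sum_list (map fst us)) * sgni (int q' * int r)"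
      by (auto simp: minus_one_power_iff sgni_def)
    have "lext (\<lambda>w. wmul w u) x = ?s *\<^sub>R wd ((p + r) mod 2, f * h, us @ [((q' + q) mod 2, lact g
        \<alpha>)] @ (vs @ bs))
        - (?s * (-1) ^ (q' * sum_list (map fst us)) * sgni (int q' * int r)) *\<^sub>R ?w (sgni (int q' * int
            r) *\<^sub>R (f * h * g))"
      unfolding s[symmetric]
      by (simp add: lact(1) ueq wmul_simp t mult.assoc gh)
    \<comment> \<open>Right multiplication leaves \<open>g\<close> to the left of \<open>h\<close>,
      whereas the module relator has it on the right. Exchanging them changes the coefficient by a
      scalar, which costs one scaling relator, the second summand.\<close>
    also have "\<dots> = ?s *\<^sub>R (wd ((p + r) mod 2, f * h, us @ [((q' + q) mod 2, lact g \<alpha>)] @ (vs @ bs))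
        - (-1) ^ (q' * sum_list (map fst us)) *\<^sub>R ?w (f * h * g))
      + (- (?s * (-1) ^ (q' * sum_list (map fst us)) * sgni (int q' * int r))) *\<^sub>R
          (?w (sgni (int q' * int r) *\<^sub>R (f * h * g)) - sgni (int q' * int r) *\<^sub>R ?w (f * h * g))"
      by (simp add: algebra_simps)
    also have "\<dots> \<in> Rid G"
      by (intro Rid_add Rid_scale Rid_lact Rid_scale0) (use v lact mult Apar_mult in \<open>auto intro!:
          Apar_mult\<close>)
    finally show ?thesis .
  next
    case (swap p f us q1 \<alpha>1 q2 \<alpha>2 vs)
    have "lext (\<lambda>w. wmul w u) x = ((-1) ^ (r * (sum_list (map fst us) + (q1 + (q2 + sum_list (map fst
        vs)))))) *\<^sub>R (wd ((p + r) mod 2, f * h, us @ [(q1, \<alpha>1), (q2, \<alpha>2)] @ (vs @ bs))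
        + ((-1) ^ (q1 * q2)) *\<^sub>R wd ((p + r) mod 2, f * h, us @ [(q2, \<alpha>2), (q1, \<alpha>1)] @ (vs
            @ bs)))"
      by (simp add: swap(1) ueq wmul_simp scaleR_add_right add.left_commute)
    also have "\<dots> \<in> Rid G" by (intro Rid_scale Rid_swap) (use v swap mult in auto)
    finally show ?thesis .
  qed
  then show "lext (\<lambda>w. wmul w u) x \<in> span (Relators G)" by (simp add: Rid_def)
qed simp

end

subsection \<open>Two auxiliary algebras\<close>

text \<open>A type on which composition gives an algebra structure, so that classes of forms can be
  multiplied and compared by plain equality.\<close>

typedef (overloaded) 'b endo = "{f :: 'b::real_vector \<Rightarrow> 'b. linear f}"
  morphisms apply_endo Endo
  by (rule exI[of _ "\<lambda>x. x"]) (simp add: linear_iff)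

lemma endo_eqI: "(\<And>x. apply_endo a x = apply_endo b x) \<Longrightarrow> a = b"
  by (metis apply_endo_inject ext)

lemma linear_apply_endo: "linear (apply_endo a)"
  using apply_endo by blast

lemmas apply_endo_linear [simp] =
  linear_add[OF linear_apply_endo] linear_scale[OF linear_apply_endo]
  linear_0[OF linear_apply_endo] linear_diff[OF linear_apply_endo] linear_neg[OF linear_apply_endo]

lemma Endo_inverse': "linear f \<Longrightarrow> apply_endo (Endo f) = f"
  by (simp add: Endo_inverse)

instantiation endo :: (real_vector) real_algebra
begin

definition plus_endo :: "'a endo \<Rightarrow> 'a endo \<Rightarrow> 'a endo" where
  "a + b = Endo (\<lambda>x. apply_endo a x + apply_endo b x)"
definition minus_endo :: "'a endo \<Rightarrow> 'a endo \<Rightarrow> 'a endo" where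
  "a - b = Endo (\<lambda>x. apply_endo a x - apply_endo b x)"
definition uminus_endo :: "'a endo \<Rightarrow> 'a endo" where
  "- a = Endo (\<lambda>x. - apply_endo a x)"
definition zero_endo :: "'a endo" where
  "0 = Endo (\<lambda>x. 0)"
definition times_endo :: "'a endo \<Rightarrow> 'a endo \<Rightarrow> 'a endo" where
  "a * b = Endo (\<lambda>x. apply_endo a (apply_endo b x))"
definition scaleR_endo :: "real \<Rightarrow> 'a endo \<Rightarrow> 'a endo" where
  "c *\<^sub>R a = Endo (\<lambda>x. c *\<^sub>R apply_endo a x)"

lemma apply_endo_simps [simp]:
  "apply_endo (a + b) x = apply_endo a x + apply_endo b x"
  "apply_endo (a - b) x = apply_endo a x - apply_endo b x"
  "apply_endo (- a) x = - apply_endo a x"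
  "apply_endo 0 x = 0"
  "apply_endo (a * b) x = apply_endo a (apply_endo b x)"
  "apply_endo (c *\<^sub>R a) x = c *\<^sub>R apply_endo a x"
  unfolding plus_endo_def minus_endo_def uminus_endo_def zero_endo_def times_endo_def scaleR_endo_def
  by (subst Endo_inverse', simp add: linear_iff algebra_simps, simp)+

instance
  by standard (auto intro!: endo_eqI simp: algebra_simps)

end

text \<open>\<open>Tri a d b\<close> stands for the matrix with diagonal \<open>a\<close>,
  \<open>b\<close> and upper right corner \<open>d\<close>. The corner of a product,
  \<open>a * d' + d * b'\<close>, is a Leibniz rule twisted by \<open>a\<close>.\<close>

datatype 'b tri = Tri (tri_a: 'b) (tri_d: 'b) (tri_b: 'b)

instantiation tri :: (real_algebra) real_algebra
begin

definition plus_tri :: "'a tri \<Rightarrow> 'a tri \<Rightarrow> 'a tri" where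
  "x + y = Tri (tri_a x + tri_a y) (tri_d x + tri_d y) (tri_b x + tri_b y)"
definition minus_tri :: "'a tri \<Rightarrow> 'a tri \<Rightarrow> 'a tri" where
  "x - y = Tri (tri_a x - tri_a y) (tri_d x - tri_d y) (tri_b x - tri_b y)"
definition uminus_tri :: "'a tri \<Rightarrow> 'a tri" where
  "- x = Tri (- tri_a x) (- tri_d x) (- tri_b x)"
definition zero_tri :: "'a tri" where
  "0 = Tri 0 0 0"
definition times_tri :: "'a tri \<Rightarrow> 'a tri \<Rightarrow> 'a tri" where
  "x * y = Tri (tri_a x * tri_a y) (tri_a x * tri_d y + tri_d x * tri_b y) (tri_b x * tri_b y)"
definition scaleR_tri :: "real \<Rightarrow> 'a tri \<Rightarrow> 'a tri" where
  "c *\<^sub>R x = Tri (c *\<^sub>R tri_a x) (c *\<^sub>R tri_d x) (c *\<^sub>R tri_b x)"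

lemmas tri_defs = plus_tri_def minus_tri_def uminus_tri_def zero_tri_def times_tri_def scaleR_tri_def

instance
  by standard (auto simp: tri_defs algebra_simps)

end

lemma tri_sel_simps [simp]:
  "tri_a (x + y) = tri_a x + tri_a y" "tri_d (x + y) = tri_d x + tri_d y" "tri_b (x + y) = tri_b x + tri_b y"
  "tri_a (c *\<^sub>R x) = c *\<^sub>R tri_a x" "tri_d (c *\<^sub>R x) = c *\<^sub>R tri_d x" "tri_b (c
      *\<^sub>R x) = c *\<^sub>R tri_b x"
  "tri_a (x * y) = tri_a x * tri_a y" "tri_d (x * y) = tri_a x * tri_d y + tri_d x * tri_b y"
  "tri_b (x * y) = tri_b x * tri_b y"
  "tri_a 0 = 0" "tri_d 0 = 0" "tri_b 0 = 0"
  by (simp_all add: tri_defs)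

subsection \<open>Homomorphisms defined on generators\<close>

definition lprod :: "(nat \<Rightarrow> 'a tens \<Rightarrow> 'c::real_algebra) \<Rightarrow> 'c \<Rightarrow>
    (nat \<times> 'a tens) list \<Rightarrow> 'c" where
  "lprod \<phi> x as = foldl (\<lambda>y (q, \<alpha>). y * \<phi> q \<alpha>) x as"

lemma lprod_simps [simp]:
  "lprod \<phi> x [] = x"
  "lprod \<phi> x ((q, \<alpha>) # as) = lprod \<phi> (x * \<phi> q \<alpha>) as"
  "lprod \<phi> x (as @ bs) = lprod \<phi> (lprod \<phi> x as) bs"
  by (simp_all add: lprod_def)

lemma lprod_linear:
  "lprod \<phi> (x + y) as = lprod \<phi> x as + lprod \<phi> y as"
  "lprod \<phi> (x - y) as = lprod \<phi> x as - lprod \<phi> y as"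
  "lprod \<phi> (- x) as = - lprod \<phi> x as"
  "lprod \<phi> (c *\<^sub>R x) as = c *\<^sub>R lprod \<phi> x as"
  by (induct as arbitrary: x y) (auto simp: algebra_simps)

lemma lprod_mult: "lprod \<phi> (x * y) as = x * lprod \<phi> y as"
  by (induct as arbitrary: x y) (auto simp: mult.assoc)

definition wmap :: "(nat \<Rightarrow> 'a \<Rightarrow> 'c::real_algebra) \<Rightarrow> (nat \<Rightarrow> 'a
    tens \<Rightarrow> 'c) \<Rightarrow> 'a word \<Rightarrow> 'c" where
  "wmap \<phi>0 \<phi>1 w = (case w of (p, f, as) \<Rightarrow> lprod \<phi>1 (\<phi>0 p f) as)"

lemma wmap_simp [simp]: "wmap \<phi>0 \<phi>1 (p, f, as) = lprod \<phi>1 (\<phi>0 p f) as"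
  by (simp add: wmap_def)

text \<open>The universal property of the presentation, for values in an associative algebra. A word
  is sent to a product that begins with the value of its coefficient, so no unit of the target
  enters.\<close>

locale generator_maps = graded_algebra G for G :: "int \<Rightarrow> 'a::real_algebra_1 set" +
  fixes \<phi>0 :: "nat \<Rightarrow> 'a \<Rightarrow> 'c::real_algebra" and \<phi>1 :: "nat \<Rightarrow> 'a
      tens \<Rightarrow> 'c"
  assumes hom_add0: "\<And>p f g. p < 2 \<Longrightarrow> f \<in> Apar G p \<Longrightarrow> g \<in> Apar G p
      \<Longrightarrow> \<phi>0 p (f + g) = \<phi>0 p f + \<phi>0 p g"
    and hom_scale0: "\<And>p f c. p < 2 \<Longrightarrow> f \<in> Apar G p \<Longrightarrow> \<phi>0 p (c
        *\<^sub>R f) = c *\<^sub>R \<phi>0 p f"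
    and hom_add1: "\<And>q \<alpha> \<beta>. q < 2 \<Longrightarrow> \<alpha> \<in> O1par G q \<Longrightarrow>
        \<beta> \<in> O1par G q \<Longrightarrow> \<phi>1 q (\<alpha> + \<beta>) = \<phi>1 q \<alpha> + \<phi>1
            q \<beta>"
    and mult0: "\<And>p q f g. p < 2 \<Longrightarrow> q < 2 \<Longrightarrow> f \<in> Apar G p
        \<Longrightarrow> g \<in> Apar G q \<Longrightarrow>
      \<phi>0 ((p + q) mod 2) (f * g) = \<phi>0 p f * \<phi>0 q g"
    and lact1: "\<And>p q f \<alpha>. p < 2 \<Longrightarrow> q < 2 \<Longrightarrow> f \<in> Apar G p
        \<Longrightarrow> \<alpha> \<in> O1par G q \<Longrightarrow>
      \<phi>1 ((p + q) mod 2) (lact f \<alpha>) = \<phi>0 p f * \<phi>1 q \<alpha>"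
    and comm01: "\<And>p q f \<alpha>. p < 2 \<Longrightarrow> q < 2 \<Longrightarrow> f \<in> Apar G p
        \<Longrightarrow> \<alpha> \<in> O1par G q \<Longrightarrow>
      \<phi>1 q \<alpha> * \<phi>0 p f = sgni (int p * int q) *\<^sub>R (\<phi>0 p f * \<phi>1 q \<alpha>)"
    and comm11: "\<And>p q \<alpha> \<beta>. p < 2 \<Longrightarrow> q < 2 \<Longrightarrow> \<alpha> \<in>
        O1par G p \<Longrightarrow> \<beta> \<in> O1par G q \<Longrightarrow>
      \<phi>1 p \<alpha> * \<phi>1 q \<beta> = - (sgni (int p * int q) *\<^sub>R (\<phi>1 q \<beta> * \<phi>1 p
          \<alpha>))"
begin

lemma lprod_commute:
  assumes "vlist G as" "p < 2" "f \<in> Apar G p"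
  shows "lprod \<phi>1 (x * \<phi>0 p f) as = ((-1) ^ (p * sum_list (map fst as))) *\<^sub>R (lprod \<phi>1 x
      as * \<phi>0 p f)"
  using assms(1)
proof (induct as rule: rev_induct)
  case (snoc a as)
  obtain q \<alpha> where a: "a = (q, \<alpha>)" by force
  have "\<phi>0 p f * \<phi>1 q \<alpha> = sgni (int p * int q) *\<^sub>R (\<phi>1 q \<alpha> * \<phi>0 p f)"
    using comm01[of p q f \<alpha>] snoc(2) assms by (simp add: a)
  then show ?case using snoc
    by (simp add: a mult.assoc minus_one_power_eq_sgni sgni_add distrib_left mult_ac)
qed simp

lemma lext_wmul:
  assumes "valid_word G u" "valid_word G w"
  shows "lext (wmap \<phi>0 \<phi>1) (wmul u w) = wmap \<phi>0 \<phi>1 u * wmap \<phi>0 \<phi>1 w"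
proof -
  obtain p f as q g bs where uw: "u = (p, f, as)" "w = (q, g, bs)" by (cases u, cases w)
  have v: "p < 2" "f \<in> Apar G p" "vlist G as" "q < 2" "g \<in> Apar G q"
    using assms uw by auto
  \<comment> \<open>The sign inside \<open>wmul\<close> and the sign from moving the second
    coefficient across the first list are the same power of -1 and cancel.\<close>
  have "(-1 :: real) ^ k * (-1) ^ k = 1" for k :: nat by (simp add: minus_one_power_iff)
  then show ?thesis using v
    by (simp add: uw wmul_simp mult0 lprod_commute lprod_linear) (simp add: lprod_mult)
qed

lemma lext_Relators:
  assumes x: "x \<in> Relators G"
  shows "lext (wmap \<phi>0 \<phi>1) x = 0"
  using x
proof (cases rule: Relators_cases)
  case (add0 p f g as)
  then show ?thesis by (simp add: hom_add0 lprod_linear)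
next
  case (scale0 p c f as)
  then show ?thesis by (simp add: hom_scale0 lprod_linear)
next
  case (add1 p f us q \<alpha> \<beta> vs)
  then show ?thesis by (simp add: hom_add1 lprod_linear distrib_left)
next
  case (lact p f us q' g q \<alpha> vs)
  have "(-1 :: real) ^ k * (-1) ^ k = 1" for k :: nat by (simp add: minus_one_power_iff)
  with lact show ?thesis
    by (simp add: lact1 mult0 lprod_commute lprod_linear mult.assoc)
next
  case (swap p f us q1 \<alpha>1 q2 \<alpha>2 vs)
  have "lprod \<phi>1 (\<phi>0 p f) us * \<phi>1 q1 \<alpha>1 * \<phi>1 q2 \<alpha>2
      = - (sgni (int q1 * int q2) *\<^sub>R (lprod \<phi>1 (\<phi>0 p f) us * \<phi>1 q2 \<alpha>2 * \<phi>1 q1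
          \<alpha>1))"
    using comm11[of q1 q2 \<alpha>1 \<alpha>2] swap(2) by (simp add: mult.assoc)
  then show ?thesis
    by (simp add: swap(1) lprod_linear minus_one_power_eq_sgni)
qed

lemma lext_Rid: "x \<in> Rid G \<Longrightarrow> lext (wmap \<phi>0 \<phi>1) x = 0"
  using lext_span_in[of x "Relators G" "{0}"] lext_Relators by (auto simp: Rid_def)

lemma lext_wedge:
  "x \<in> Om G \<Longrightarrow> y \<in> Om G \<Longrightarrow>
    lext (wmap \<phi>0 \<phi>1) (wedge x y) = lext (wmap \<phi>0 \<phi>1) x * lext (wmap \<phi>0 \<phi>1) y"
  unfolding Om_def by (rule lext_wedge_mult) (auto simp: lext_wmul)

end

subsection \<open>A faithful representation of the superforms\<close>

text \<open>A basis \<open>B\<close> of \<open>I\<close> is extended to a basis \<open>C\<close> of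
  \<open>V\<close>; \<open>N\<close> kills \<open>B\<close> and fixes the rest of \<open>C\<close>.
  Since \<open>construct\<close> takes all its values in the span of the images, \<open>N\<close> is
  total and always lands in \<open>V\<close>.\<close>

lemma projection_modulo_exists:
  assumes "subspace I" "subspace V" "I \<subseteq> (V :: 'v::real_vector set)"
  shows "\<exists>N. linear N \<and> (\<forall>x. N x \<in> V) \<and> (\<forall>x\<in>I. N x = 0) \<and>
      (\<forall>x\<in>V. N x - x \<in> I) \<and> (\<forall>x. N (N x) = N x)"
proof -
  obtain B where B: "B \<subseteq> I" "independent B" "I \<subseteq> span B" by (rule maximal_independent_subset)
  obtain C where C: "B \<subseteq> C" "C \<subseteq> V" "independent C" "V \<subseteq> span C"
    using maximal_independent_subset_extend[of B V] B assms by blast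
  define f where "f b = (if b \<in> B then 0 else b)" for b :: 'v
  define N where "N = construct C f"
  have lin: "linear N" unfolding N_def by (rule linear_construct[OF C(3)])
  have N: "N b = f b" if "b \<in> C" for b using construct_basis[OF C(3) that] N_def by metis
  have sV: "span C \<subseteq> V" using C assms by (simp add: span_minimal)
  have Nf: "N x \<in> span (f ` C)" for x using construct_in_span[OF C(3)] N_def by metis
  have "N x \<in> V" for x
  proof -
    note Nf[of x]
    moreover have "f ` C \<subseteq> V" using C(2) assms(2) by (auto simp: f_def subspace_0)
    ultimately show ?thesis using span_minimal[of "f ` C" V] assms by blast
  qed
  moreover have "N x = 0" if "x \<in> I" for x
  proof -
    have "x \<in> span B" using that B by blast
    then show ?thesis
      by (induct rule: span_induct_cases)
         (use N C(1) in \<open>auto simp: subspace_def linear_add[OF lin] linear_scale[OF lin] linear_0[OF lin]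
            f_def\<close>)
  qed
  moreover have "N x - x \<in> I" if "x \<in> V" for x
  proof -
    have "x \<in> span C" using that C by blast
    then show ?thesis
    proof (induct rule: span_induct_cases)
      case subspace
      have "linear (\<lambda>x. N x - x)" by (intro linear_compose_sub lin linear_ident)
      from linear_subspace_vimage[OF this assms(1)] show ?case by (simp add: vimage_def)
    next
      case (base b)
      then show ?case using N[of b] B(1) assms(1)
        by (auto simp: f_def subspace_0 subspace_neg)
    qed
  qed
  moreover have "N (N x) = N x" for x
    using Nf[of x]
    by (induct rule: span_induct_cases)
       (use N in \<open>auto simp: subspace_def linear_add[OF lin] linear_scale[OF lin] linear_0[OF lin]
           f_def\<close>)
  ultimately show ?thesis using lin by blast
qed

context graded_algebra
begin

lemma subspace_Om: "subspace (Om G)" by (simp add: Om_def)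
lemmas Om_add = subspace_add[OF subspace_Om] and Om_scale = subspace_scale[OF subspace_Om]
  and Om_0 = subspace_0[OF subspace_Om] and Om_neg = subspace_neg[OF subspace_Om]
  and Om_diff = subspace_diff[OF subspace_Om]

text \<open>A linear normal form. Being total, it also moves functions that are not combinations of
  valid words into \<open>Om G\<close>.\<close>

definition nf :: "'a form \<Rightarrow> 'a form" where
  "nf = (SOME N. linear N \<and> (\<forall>x. N x \<in> Om G) \<and> (\<forall>x\<in>Rid G. N x = 0) \<and>
      (\<forall>x\<in>Om G. N x - x \<in> Rid G)
    \<and> (\<forall>x. N (N x) = N x))"

lemma nf:
  shows linear_nf: "linear nf" and nf_Om: "nf x \<in> Om G" and nf_Rid: "x \<in> Rid G \<Longrightarrow> nf x = 0"
    and nf_diff: "x \<in> Om G \<Longrightarrow> nf x - x \<in> Rid G" and nf_nf: "nf (nf x) = nf x"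
  using someI_ex[OF projection_modulo_exists[OF subspace_Rid subspace_Om Rid_subset_Om], folded nf_def]
  by auto

lemma nf_cong:
  assumes "x - y \<in> Rid G" shows "nf x = nf y"
  using nf_Rid[OF assms] by (simp add: linear_diff[OF linear_nf])

lemma wd_Om: "valid_word G w \<Longrightarrow> wd w \<in> Om G"
  unfolding Om_def by (rule span_base) simp

lemma wmul_Om:
  assumes "valid_word G u" "valid_word G w" shows "wmul u w \<in> Om G"
  using assms
  by (cases u, cases w) (auto simp: wmul_simp intro!: Om_scale wd_Om Apar_mult)

text \<open>The inner \<open>nf\<close> makes the operator depend only on the class of its argument;
  the outer one makes congruent products equal.\<close>

definition lmul :: "'a word \<Rightarrow> 'a form endo" where
  "lmul u = Endo (\<lambda>x. nf (lext (wmul u) (nf x)))"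

lemma apply_lmul: "apply_endo (lmul u) x = nf (lext (wmul u) (nf x))"
  unfolding lmul_def
  by (subst Endo_inverse')
     (auto intro!: linear_compose[OF linear_nf linear_compose[OF linear_lext linear_nf], unfolded o_def])

definition \<Phi> :: "'a form \<Rightarrow> 'a form endo" where "\<Phi> = lext lmul"

lemma linear_\<Phi>: "linear \<Phi>" by (simp add: \<Phi>_def linear_lext)
lemma \<Phi>_wd: "\<Phi> (wd w) = lmul w" by (simp add: \<Phi>_def)

lemmas \<Phi>_simps [simp] = linear_add[OF linear_\<Phi>] linear_diff[OF linear_\<Phi>]
  linear_scale[OF linear_\<Phi>] linear_neg[OF linear_\<Phi>] linear_0[OF linear_\<Phi>]

text \<open>An identity of forms and not merely a congruence: coefficient parities are stored
  reduced modulo 2, and the signs depend on them only modulo 2.\<close>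

lemma wmul_assoc: "lext (wmul u) (wmul v w) = lext (\<lambda>z. wmul z w) (wmul u v)"
proof -
  obtain p f as q g bs r h cs where "u = (p, f, as)" "v = (q, g, bs)" "w = (r, h, cs)"
    by (cases u, cases v, cases w)
  moreover have "(p + (q + r) mod 2) mod 2 = ((p + q) mod 2 + r) mod 2"
    by (simp add: mod_simps add.assoc)
  moreover have "(-1 :: real) ^ (r * sum_list (map fst bs)) * (-1) ^ ((q + r) mod 2 * sum_list (map fst as))
    = (-1) ^ (q * sum_list (map fst as)) * (-1) ^ (r * (sum_list (map fst as) + sum_list (map fst bs)))"
    by (auto simp: minus_one_power_iff)
  ultimately show ?thesis by (simp add: wmul_simp mult.assoc)
qed

lemma nf_lext_wmul_cong:
  assumes "valid_word G u" "x - y \<in> Rid G"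
  shows "nf (lext (wmul u) x) = nf (lext (wmul u) y)"
  by (rule nf_cong) (use Rid_left_ideal[OF assms] in simp)

text \<open>Rewrites the action of \<open>x\<close> on a word as right multiplication of
  \<open>x\<close> by that word, which is how the right ideal property of the relations reaches the
  representation.\<close>

lemma apply_\<Phi>_wd:
  assumes "x \<in> Om G" "valid_word G v"
  shows "apply_endo (\<Phi> x) (wd v) = nf (lext (\<lambda>u. wmul u v) x)"
  using assms(1) unfolding Om_def
proof (induct rule: span_induct_cases)
  case subspace
  show ?case by (rule subspace_pointwise_linear)
    (auto simp: linear_add[OF linear_nf] linear_scale[OF linear_nf] linear_0[OF linear_nf])
next
  case (base b)
  then obtain u where u: "b = wd u" "valid_word G u" by auto
  then show ?case using nf_lext_wmul_cong[OF u(2) nf_diff[OF wd_Om[OF assms(2)]]]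
    by (simp add: \<Phi>_wd apply_lmul)
qed

lemma endo_eq_on_words:
  assumes "\<And>x. apply_endo a x = apply_endo a (nf x)" "\<And>x. apply_endo b x = apply_endo b (nf x)"
    and "\<And>v. valid_word G v \<Longrightarrow> apply_endo a (wd v) = apply_endo b (wd v)"
  shows "a = b"
proof (rule endo_eqI)
  fix x
  have "apply_endo a y = apply_endo b y" if "y \<in> Om G" for y
    using that unfolding Om_def
    by (induct rule: span_induct_cases) (use assms(3) in \<open>auto simp: subspace_def\<close>)
  then show "apply_endo a x = apply_endo b x" using assms(1,2) nf_Om by metis
qed

lemma apply_\<Phi>_nf:
  assumes "x \<in> Om G" shows "apply_endo (\<Phi> x) y = apply_endo (\<Phi> x) (nf y)"
  using assms unfolding Om_def
  by (induct rule: span_induct_cases) (auto simp: subspace_def \<Phi>_wd apply_lmul nf_nf)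

lemma \<Phi>_Rid:
  assumes "x \<in> Rid G" shows "\<Phi> x = 0"
proof -
  have x: "x \<in> Om G" using assms Rid_subset_Om by blast
  show ?thesis
    by (rule endo_eq_on_words)
       (use apply_\<Phi>_nf[OF x] in \<open>auto simp: apply_\<Phi>_wd[OF x] nf_Rid[OF Rid_right_ideal[OF _
           assms]]\<close>)
qed

lemma valid_one: "valid_word G (0, 1, [])" by simp

lemma lext_wmul_one: "x \<in> Om G \<Longrightarrow> lext (\<lambda>u. wmul u (0, 1, [])) x = x"
  unfolding Om_def by (induct rule: span_induct_cases) (auto simp: subspace_def wmul_simp)

text \<open>Acting on the unit word returns \<open>nf x\<close>, which gives faithfulness.\<close>

lemma \<Phi>_eq_0_iff: "x \<in> Om G \<Longrightarrow> \<Phi> x = 0 \<longleftrightarrow> x \<in> Rid G"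
proof
  assume x: "x \<in> Om G" "\<Phi> x = 0"
  then have "nf x = 0"
    using apply_\<Phi>_wd[OF x(1) valid_one] by (simp add: lext_wmul_one)
  then show "x \<in> Rid G" using nf_diff[OF x(1)] subspace_neg[OF subspace_Rid, of "- x" G] by simp
qed (rule \<Phi>_Rid)

lemma \<Phi>_wmul:
  assumes "valid_word G u" "valid_word G w"
  shows "\<Phi> (wmul u w) = lmul u * lmul w"
proof (rule endo_eq_on_words)
  note uw = wmul_Om[OF assms]
  show "apply_endo (\<Phi> (wmul u w)) x = apply_endo (\<Phi> (wmul u w)) (nf x)" for x
    by (rule apply_\<Phi>_nf[OF uw])
  show "apply_endo (lmul u * lmul w) x = apply_endo (lmul u * lmul w) (nf x)" for x
    by (simp add: apply_lmul nf_nf)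
  fix v assume v: "valid_word G v"
  have "apply_endo (lmul w) (wd v) = nf (wmul w v)"
    using nf_lext_wmul_cong[OF assms(2) nf_diff[OF wd_Om[OF v]]] by (simp add: apply_lmul)
  \<comment> \<open>Normalising between the two multiplications changes the argument by a relation
    only, which the left ideal property absorbs.\<close>
  moreover have "nf (nf (wmul w v)) - wmul w v \<in> Rid G"
    using wmul_Om[OF assms(2) v] by (simp add: nf_nf nf_diff)
  from nf_lext_wmul_cong[OF assms(1) this]
  have "apply_endo (lmul u) (nf (wmul w v)) = nf (lext (wmul u) (wmul w v))"
    by (simp add: apply_lmul)
  ultimately show "apply_endo (\<Phi> (wmul u w)) (wd v) = apply_endo (lmul u * lmul w) (wd v)"
    by (simp add: apply_\<Phi>_wd[OF uw v] wmul_assoc)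
qed

lemma \<Phi>_wedge: "x \<in> Om G \<Longrightarrow> y \<in> Om G \<Longrightarrow> \<Phi> (wedge x y) = \<Phi>
    x * \<Phi> y"
  unfolding Om_def \<Phi>_def by (rule lext_wedge_mult) (use \<Phi>_wmul in \<open>auto simp: \<Phi>_def\<close>)

text \<open>The dictionary between congruence and equality: the laws stated with \<open>oeq\<close>
  are proved and used through it.\<close>

lemma oeq_iff_\<Phi>: "x \<in> Om G \<Longrightarrow> y \<in> Om G \<Longrightarrow> oeq G x y
    \<longleftrightarrow> \<Phi> x = \<Phi> y"
  using \<Phi>_eq_0_iff[of "x - y"] Om_diff by (auto simp: oeq_def Rid_def)

subsection \<open>Generators and the bigrading\<close>

lemma wd_zero0_Rid: "p < 2 \<Longrightarrow> vlist G as \<Longrightarrow> wd (p, 0, as) \<in> Rid G"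
  using Rid_scale0[of G p 0 as 0] by simp

lemma wd_zero1_Rid: "p < 2 \<Longrightarrow> f \<in> Apar G p \<Longrightarrow> q < 2 \<Longrightarrow> wd (p,
    f, [(q, 0)]) \<in> Rid G"
  using Rid_scale[OF Rid_add1[of G p f "[]" q 0 "[]" 0], of "-1"] by simp

definition i0 :: "'a \<Rightarrow> 'a form endo" where "i0 f = \<Phi> (embA G f)"
definition i1 :: "'a tens \<Rightarrow> 'a form endo" where "i1 \<alpha> = \<Phi> (emb1 G \<alpha>)"

lemma embA_Om: "embA G f \<in> Om G"
  unfolding embA_def by (intro Om_add wd_Om) (simp_all add: acomp_in)

lemma emb1_Om: "\<alpha> \<in> Omega1 \<Longrightarrow> emb1 G \<alpha> \<in> Om G"
  unfolding emb1_def by (intro Om_add wd_Om) (simp_all add: tcomp_in)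

lemma lmul_Rid: "wd w \<in> Rid G \<Longrightarrow> lmul w = 0"
  using \<Phi>_Rid[of "wd w"] by (simp add: \<Phi>_wd)

lemma lmul_Nil:
  assumes "p < 2" "f \<in> Apar G p" shows "lmul (p, f, []) = i0 f"
  using less_two_cases[OF assms(1)] assms(2)
  by (auto simp: i0_def embA_def \<Phi>_wd acomp_hom[where p = p] lmul_Rid wd_zero0_Rid)

lemma lmul_single:
  assumes "q < 2" "\<alpha> \<in> O1par G q" shows "lmul (0, 1, [(q, \<alpha>)]) = i1 \<alpha>"
  using less_two_cases[OF assms(1)] assms(2)
  by (auto simp: i1_def emb1_def \<Phi>_wd tcomp_hom[where p = q] lmul_Rid wd_zero1_Rid)

lemma i0_decomp: "i0 f = i0 (acomp G 0 f) + i0 (acomp G 1 f)"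
  using lmul_Nil[of 0 "acomp G 0 f"] lmul_Nil[of 1 "acomp G 1 f"]
  by (simp add: i0_def[of f] embA_def \<Phi>_wd acomp_in)

lemma i1_decomp: "\<alpha> \<in> Omega1 \<Longrightarrow> i1 \<alpha> = i1 (tcomp G 0 \<alpha>) + i1 (tcomp G 1
    \<alpha>)"
  using lmul_single[of 0 "tcomp G 0 \<alpha>"] lmul_single[of 1 "tcomp G 1 \<alpha>"]
  by (simp add: i1_def[of \<alpha>] emb1_def \<Phi>_wd tcomp_in)

section \<open>Linearity and commutation relations of the generators\<close>

lemma i0_hom_lincomb:
  assumes "p < 2" "f \<in> Apar G p" "g \<in> Apar G p"
  shows "i0 (c *\<^sub>R f + g) = c *\<^sub>R i0 f + i0 g"
proof -
  have "\<Phi> (wd (p, c *\<^sub>R f + g, [])) = \<Phi> (wd (p, c *\<^sub>R f, [])) + \<Phi> (wd (p, g, []))"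
    using \<Phi>_Rid[OF Rid_add0[of G p "c *\<^sub>R f" "[]" g]] assms by (simp add: Apar_scaleR algebra_simps)
  moreover have "\<Phi> (wd (p, c *\<^sub>R f, [])) = c *\<^sub>R \<Phi> (wd (p, f, []))"
    using \<Phi>_Rid[OF Rid_scale0[of G p f "[]" c]] assms by simp
  ultimately show ?thesis using assms by (simp add: \<Phi>_wd lmul_Nil Apar_scaleR Apar_add)
qed

lemma linear_i0: "linear i0"
proof -
  have "i0 (c *\<^sub>R f + g) = c *\<^sub>R i0 f + i0 g" for c f g
    unfolding i0_decomp[of "c *\<^sub>R f + g"] i0_decomp[of f] i0_decomp[of g]
    by (simp add: linear_add[OF acomp_linear] linear_scale[OF acomp_linear]
        i0_hom_lincomb[of 0] i0_hom_lincomb[of 1] acomp_in scaleR_right_distrib)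
  from this[of 1] this[of _ _ 0] show ?thesis
    by (intro linearI) (auto simp: i0_hom_lincomb[of 0 0 0 "-1"], metis add_cancel_right_right scaleR_one)
qed

lemmas i0_simps [simp] = linear_add[OF linear_i0] linear_scale[OF linear_i0] linear_0[OF linear_i0]
  linear_neg[OF linear_i0] linear_diff[OF linear_i0]

lemma i1_hom_lincomb:
  assumes "q < 2" "\<alpha> \<in> O1par G q" "\<beta> \<in> O1par G q"
  shows "i1 (c *\<^sub>R \<alpha> + \<beta>) = c *\<^sub>R i1 \<alpha> + i1 \<beta>"
proof -
  have "\<Phi> (wd (0, 1, [(q, c *\<^sub>R \<alpha> + \<beta>)])) = \<Phi> (wd (0, 1, [(q, c *\<^sub>R
      \<alpha>)])) + \<Phi> (wd (0, 1, [(q, \<beta>)]))"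
    using \<Phi>_Rid[OF Rid_add1[of G 0 1 "[]" q "c *\<^sub>R \<alpha>" "[]" \<beta>]] assms by (simp add:
        O1par_scaleR algebra_simps)
  moreover have "\<Phi> (wd (0, 1, [(q, c *\<^sub>R \<alpha>)])) = c *\<^sub>R \<Phi> (wd (0, 1, [(q, \<alpha>)]))"
  proof -
    \<comment> \<open>A scalar leaves the one-form slot by way of the coefficient: it acts as the
      function \<open>c *\<^sub>R 1\<close>, which the module relator moves to the front, where the
      scaling relator extracts \<open>c\<close>.\<close>
    have l: "lact (c *\<^sub>R 1) \<alpha> = c *\<^sub>R \<alpha>"
      using assms by (simp add: lact_scaleR_left lact_one O1par_AtA)
    have "\<Phi> (wd (0, 1, [(q, c *\<^sub>R \<alpha>)])) = \<Phi> (wd (0, c *\<^sub>R 1, [(q, \<alpha>)]))"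
      using \<Phi>_Rid[OF Rid_lact[of 0 "c *\<^sub>R 1" G 0 1 "[]" q \<alpha> "[]"]] assms
      by (simp add: l O1par_scaleR Apar_scaleR)
    then show ?thesis using \<Phi>_Rid[OF Rid_scale0[of G 0 1 "[(q, \<alpha>)]" c]] assms by simp
  qed
  ultimately show ?thesis using assms by (simp add: \<Phi>_wd lmul_single O1par_scaleR O1par_add)
qed

lemma i1_lincomb:
  assumes "\<alpha> \<in> Omega1" "\<beta> \<in> Omega1"
  shows "i1 (c *\<^sub>R \<alpha> + \<beta>) = c *\<^sub>R i1 \<alpha> + i1 \<beta>"
proof -
  have *: "c *\<^sub>R \<alpha> + \<beta> \<in> Omega1"
    using assms by (simp add: Omega1_add Omega1_scale)
  show ?thesis
    unfolding i1_decomp[OF *] i1_decomp[OF assms(1)] i1_decomp[OF assms(2)]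
    using assms by (simp add: tcomp_lincomb i1_hom_lincomb[of 0] i1_hom_lincomb[of 1] tcomp_in scaleR_right_distrib)
qed

lemma i1_0 [simp]: "i1 0 = 0"
  using i1_hom_lincomb[of 0 0 0 "-1"] by simp

lemma i1_add: "\<alpha> \<in> Omega1 \<Longrightarrow> \<beta> \<in> Omega1 \<Longrightarrow> i1 (\<alpha> +
    \<beta>) = i1 \<alpha> + i1 \<beta>"
  using i1_lincomb[of \<alpha> \<beta> 1] by simp

lemma i1_scale: "\<alpha> \<in> Omega1 \<Longrightarrow> i1 (c *\<^sub>R \<alpha>) = c *\<^sub>R i1 \<alpha>"
  using i1_lincomb[of \<alpha> 0 c] by (simp add: subspace_0[OF Omega1_subspace])

lemma i0_mult:
  assumes "p < 2" "q < 2" "f \<in> Apar G p" "g \<in> Apar G q"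
  shows "i0 (f * g) = i0 f * i0 g"
  using \<Phi>_wmul[of "(p, f, [])" "(q, g, [])"] assms
  by (simp add: wmul_simp \<Phi>_wd lmul_Nil Apar_mult)

lemma lmul_snoc:
  assumes "valid_word G (p, f, as)" "q < 2" "\<alpha> \<in> O1par G q"
  shows "lmul (p, f, as @ [(q, \<alpha>)]) = lmul (p, f, as) * i1 \<alpha>"
  using \<Phi>_wmul[of "(p, f, as)" "(0, 1, [(q, \<alpha>)])"] assms
  by (simp add: wmul_simp \<Phi>_wd lmul_single)

lemma i1_lact:
  assumes "p < 2" "q < 2" "f \<in> Apar G p" "\<alpha> \<in> O1par G q"
  shows "i1 (lact f \<alpha>) = i0 f * i1 \<alpha>"
  using \<Phi>_Rid[OF Rid_lact[of p f G 0 1 "[]" q \<alpha> "[]"]] lmul_snoc[of p f "[]" q \<alpha>] assms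
  by (simp add: lact_O1par \<Phi>_wd lmul_Nil lmul_single)

lemma i1_i0_commute:
  assumes "p < 2" "q < 2" "f \<in> Apar G p" "\<alpha> \<in> O1par G q"
  shows "i1 \<alpha> * i0 f = sgni (int p * int q) *\<^sub>R (i0 f * i1 \<alpha>)"
  using \<Phi>_wmul[of "(0, 1, [(q, \<alpha>)])" "(p, f, [])"] lmul_snoc[of p f "[]" q \<alpha>] assms
  by (simp add: wmul_simp \<Phi>_wd lmul_Nil lmul_single minus_one_power_eq_sgni)

lemma i1_i1_commute:
  assumes "p < 2" "q < 2" "\<alpha> \<in> O1par G p" "\<beta> \<in> O1par G q"
  shows "i1 \<alpha> * i1 \<beta> = - (sgni (int p * int q) *\<^sub>R (i1 \<beta> * i1 \<alpha>))"
  using \<Phi>_Rid[OF Rid_swap[of G 0 1 "[]" p \<alpha> q \<beta> "[]"]]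
    lmul_snoc[of 0 1 "[(p, \<alpha>)]" q \<beta>] lmul_snoc[of 0 1 "[(q, \<beta>)]" p \<alpha>] assms
  by (simp add: \<Phi>_wd lmul_single minus_one_power_eq_sgni eq_neg_iff_add_eq_0)

lemma i0_i0_commute:
  assumes "p < 2" "q < 2" "f \<in> Apar G p" "g \<in> Apar G q"
  shows "i0 f * i0 g = sgni (int p * int q) *\<^sub>R (i0 g * i0 f)"
  using Apar_commute[of f p g q] assms
  by (simp flip: i0_mult[of p q f g] i0_mult[of q p g f])

text \<open>\<open>T\<close> is the image of the superforms under \<open>\<Phi>\<close> and \<open>S r p\<close>
  that of the forms of degree \<open>r\<close> and parity \<open>p\<close>. Both indices are integers,
  so that \<open>S r p = {0}\<close> for \<open>r < 0\<close>, and only the class of \<open>p\<close> modulo 2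
  matters.\<close>

definition hom_words :: "int \<Rightarrow> int \<Rightarrow> 'a word set" where
  "hom_words r p = {w. valid_word G w \<and> int (wdeg w) = r \<and> even (int (wpar w) - p)}"

definition S :: "int \<Rightarrow> int \<Rightarrow> 'a form endo set" where
  "S r p = span (lmul ` hom_words r p)"

definition T :: "'a form endo set" where
  "T = span (lmul ` {w. valid_word G w})"

lemma hom_words_iff: "(d, f, as) \<in> hom_words r p \<longleftrightarrow> valid_word G (d, f, as) \<and> int
    (length as) = r
    \<and> even (int d + int (sum_list (map fst as)) - p)"
  by (auto simp: hom_words_def wdeg_def wpar_def of_nat_mod)

lemma lmul_image: "span (lmul ` W) = \<Phi> ` span (wd ` W)"
proof -
  have "lmul ` W = \<Phi> ` wd ` W" by (auto simp: \<Phi>_wd image_iff)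
  then show ?thesis by (simp add: span_linear_image[OF linear_\<Phi>])
qed

lemma T_eq: "T = \<Phi> ` Om G"
  by (simp add: T_def Om_def lmul_image)

lemma subspace_S: "subspace (S r p)" by (simp add: S_def)
lemma subspace_T: "subspace T" by (simp add: T_def)
lemmas S_add = subspace_add[OF subspace_S] and S_scale = subspace_scale[OF subspace_S]
  and S_0 [simp] = subspace_0[OF subspace_S] and S_neg = subspace_neg[OF subspace_S]
  and S_diff = subspace_diff[OF subspace_S]
lemmas T_add = subspace_add[OF subspace_T] and T_scale = subspace_scale[OF subspace_T]
  and T_0 [simp] = subspace_0[OF subspace_T]

section \<open>Products and supercommutativity in the bigraded image\<close>

lemma S_T: "x \<in> S r p \<Longrightarrow> x \<in> T"
  unfolding S_def T_def by (erule set_mp[OF span_mono, rotated]) (auto simp: hom_words_def)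

lemma S_cong: "even (p - q) \<Longrightarrow> S r p = S r q"
  unfolding S_def hom_words_def by (rule arg_cong[of _ _ "\<lambda>W. span (lmul ` W)"]) auto

lemma S_neg_degree: "r < 0 \<Longrightarrow> S r p = {0}"
  unfolding S_def hom_words_def by auto

lemma lmul_S: "(d, f, as) \<in> hom_words r p \<Longrightarrow> lmul (d, f, as) \<in> S r p"
  unfolding S_def by (rule span_base) blast

lemma i0_S: "d < 2 \<Longrightarrow> f \<in> Apar G d \<Longrightarrow> even (int d - p) \<Longrightarrow> i0 f
    \<in> S 0 p"
  using lmul_S[of d f "[]" 0 p] by (simp add: hom_words_iff lmul_Nil)

lemma i1_S: "d < 2 \<Longrightarrow> \<alpha> \<in> O1par G d \<Longrightarrow> even (int d - p)
    \<Longrightarrow> i1 \<alpha> \<in> S 1 p"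
  using lmul_S[of 0 1 "[(d, \<alpha>)]" 1 p] by (simp add: hom_words_iff lmul_single)

lemma S_mult:
  assumes "x \<in> S r p" "y \<in> S s q"
  shows "x * y \<in> S (r + s) (p + q)"
  using assms(1) unfolding S_def[of r p]
proof (induct rule: span_induct_cases)
  case subspace
  show ?case by (rule subspace_pointwise_linear) (auto simp: distrib_right S_add S_scale)
next
  case (base u)
  then obtain d f as where u: "u = lmul (d, f, as)" "(d, f, as) \<in> hom_words r p" by auto
  show ?case using assms(2) unfolding S_def[of s q]
  proof (induct rule: span_induct_cases)
    case subspace
    show ?case by (rule subspace_pointwise_linear) (auto simp: distrib_left S_add S_scale)
  next
    case (base w)
    then obtain d' g bs where w: "w = lmul (d', g, bs)" "(d', g, bs) \<in> hom_words s q" by auto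
    have "u * w = \<Phi> (wmul (d, f, as) (d', g, bs))"
      using u w by (subst \<Phi>_wmul) (auto simp: hom_words_iff)
    moreover have "((d + d') mod 2, f * g, as @ bs) \<in> hom_words (r + s) (p + q)"
      using u(2) w(2) Apar_mult[of f d g d'] by (auto simp: hom_words_iff of_nat_mod)
    ultimately show ?case by (simp add: wmul_simp \<Phi>_wd lmul_S S_scale)
  qed
qed

lemma wedge_Om:
  assumes "x \<in> Om G" "y \<in> Om G" shows "wedge x y \<in> Om G"
  unfolding wedge_def
  using span_wd_support[OF assms(1)[unfolded Om_def]] span_wd_support[OF assms(2)[unfolded Om_def]]
  by (intro subspace_sum[OF subspace_Om] Om_scale wmul_Om) auto

lemma T_mult: "x \<in> T \<Longrightarrow> y \<in> T \<Longrightarrow> x * y \<in> T"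
  by (auto simp: T_eq simp flip: \<Phi>_wedge intro: wedge_Om)

text \<open>Words arise by appending one-forms to a coefficient. The predicate takes degree and
  parity as arguments so that signs depending on them can be carried along.\<close>

lemma S_induct [consumes 1, case_names subspace base step]:
  assumes x: "x \<in> S r p"
    and sub: "\<And>r p. subspace {x. P r p x}"
    and base: "\<And>d f p. d < 2 \<Longrightarrow> f \<in> Apar G d \<Longrightarrow> even (int d - p)
        \<Longrightarrow> P 0 p (i0 f)"
    and step: "\<And>r p y q \<alpha>. y \<in> S r p \<Longrightarrow> P r p y \<Longrightarrow> q < 2
        \<Longrightarrow> \<alpha> \<in> O1par G q \<Longrightarrow>
      P (r + 1) (p + int q) (y * i1 \<alpha>)"
  shows "P r p x"
  using x unfolding S_def
proof (induct rule: span_induct_cases)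
  case subspace
  show ?case by (rule sub)
next
  case (base b)
  then obtain d f as where b: "b = lmul (d, f, as)" "(d, f, as) \<in> hom_words r p" by auto
  have "(d, f, as) \<in> hom_words r p \<Longrightarrow> P r p (lmul (d, f, as))" for r p
  proof (induct as arbitrary: r p rule: rev_induct)
    case Nil
    then show ?case using assms(3)[of d f p] by (auto simp: hom_words_iff lmul_Nil)
  next
    case (snoc a as)
    obtain q \<alpha> where a: "a = (q, \<alpha>)" by force
    have h: "(d, f, as) \<in> hom_words (r - 1) (p - int q)" "q < 2" "\<alpha> \<in> O1par G q"
      using snoc(2) by (auto simp: a hom_words_iff algebra_simps)
    from step[OF lmul_S[OF h(1)] snoc(1)[OF h(1)] h(2,3)] show ?case
      using h by (simp add: a lmul_snoc hom_words_iff)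
  qed
  then show ?case using b by simp
qed

lemma T_induct [consumes 1, case_names subspace hom]:
  assumes "x \<in> T" "subspace {x. P x}" "\<And>r p y. y \<in> S r p \<Longrightarrow> P y"
  shows "P x"
  using assms(1) unfolding T_def
proof (induct rule: span_induct_cases)
  case (base b)
  then obtain d f as where "b = lmul (d, f, as)" "valid_word G (d, f, as)" by auto
  then have "b \<in> S (int (length as)) (int d + int (sum_list (map fst as)))"
    by (auto intro!: lmul_S simp: hom_words_iff)
  then show ?case by (rule assms(3))
qed (rule assms(2))

lemma S_i0_commute:
  assumes "x \<in> S r p" "d < 2" "f \<in> Apar G d"
  shows "x * i0 f = sgni (p * int d) *\<^sub>R (i0 f * x)"
  using assms(1)
proof (induct rule: S_induct)
  case (subspace r p)
  show ?case by (rule subspace_pointwise_linear) (auto simp: algebra_simps)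
next
  case (base d' g p)
  have "sgni (p * int d) = sgni (int d' * int d)" using base by (simp add: sgni_eq_iff flip: left_diff_distrib)
  then show ?case using i0_i0_commute[of d' d g f] base assms by simp
next
  case (step r p y q \<alpha>)
  have "y * i1 \<alpha> * i0 f = sgni (int d * int q) *\<^sub>R (y * i0 f * i1 \<alpha>)"
    using i1_i0_commute[OF assms(2) step(3) assms(3) step(4)] by (simp add: mult.assoc)
  also have "y * i0 f = sgni (p * int d) *\<^sub>R (i0 f * y)" by (rule step)
  finally show ?case by (simp add: mult.assoc sgni_add distrib_right mult.commute[of "int q"] mult.commute[of
      "sgni (p * int d)"])
qed

lemma S_i1_commute:
  assumes "x \<in> S r p" "d < 2" "\<alpha> \<in> O1par G d"
  shows "x * i1 \<alpha> = sgni (r + p * int d) *\<^sub>R (i1 \<alpha> * x)"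
  using assms(1)
proof (induct rule: S_induct)
  case (subspace r p)
  show ?case by (rule subspace_pointwise_linear) (auto simp: algebra_simps)
next
  case (base d' g p)
  have "sgni (p * int d) = sgni (int d' * int d)" using base by (simp add: sgni_eq_iff flip: left_diff_distrib)
  then show ?case using i1_i0_commute[of d' d g \<alpha>] base assms by simp
next
  case (step r p y q \<beta>)
  have "y * i1 \<beta> * i1 \<alpha> = - (sgni (int q * int d) *\<^sub>R (y * i1 \<alpha> * i1 \<beta>))"
    using i1_i1_commute[OF step(3) assms(2) step(4) assms(3)] by (simp add: mult.assoc)
  also have "y * i1 \<alpha> = sgni (r + p * int d) *\<^sub>R (i1 \<alpha> * y)" by (rule step)
  finally have "y * i1 \<beta> * i1 \<alpha> = (- (sgni (int q * int d) * sgni (r + p * int d))) *\<^sub>R (i1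
      \<alpha> * (y * i1 \<beta>))"
    by (simp add: mult.assoc)
  moreover have "- (sgni (int q * int d) * sgni (r + p * int d)) = sgni (r + 1 + (p + int q) * int d)"
    by (auto simp: sgni_def)
  ultimately show ?case by simp
qed

text \<open>The factor \<open>y\<close> is dismantled one generator at a time, and each passes
  \<open>x\<close> by one of the two preceding lemmas. Degree and parity contribute to the sign
  separately.\<close>

lemma S_commute:
  assumes "y \<in> S s q" "x \<in> S r p"
  shows "x * y = sgni (r * s + p * q) *\<^sub>R (y * x)"
  using assms(1)
proof (induct rule: S_induct)
  case (subspace s q)
  show ?case by (rule subspace_pointwise_linear) (auto simp: algebra_simps)
next
  case (base d g q)
  have "sgni (p * int d) = sgni (p * q)" using base by (simp add: sgni_eq_iff flip: right_diff_distrib)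
  then show ?case using S_i0_commute[OF assms(2) base(1,2)] by simp
next
  case (step s q y d \<alpha>)
  have "x * (y * i1 \<alpha>) = sgni (r * s + p * q) *\<^sub>R (y * (x * i1 \<alpha>))"
    using step by (simp add: mult.assoc flip: mult.assoc[of x])
  also have "x * i1 \<alpha> = sgni (r + p * int d) *\<^sub>R (i1 \<alpha> * x)"
    by (rule S_i1_commute[OF assms(2) step(3,4)])
  finally have "x * (y * i1 \<alpha>) = (sgni (r * s + p * q) * sgni (r + p * int d)) *\<^sub>R (y * i1 \<alpha> * x)"
    by (simp add: mult.assoc)
  moreover have "sgni (r * s + p * q) * sgni (r + p * int d) = sgni (r * (s + 1) + p * (q + int d))"
    by (simp add: algebra_simps flip: sgni_add)
  ultimately show ?case by simp
qed

subsection \<open>Derivations\<close>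

text \<open>Superderivations of \<open>T\<close> of form degree \<open>k\<close> and parity
  \<open>d\<close>, as maps of the whole endomorphism type: apart from linearity nothing is asked
  outside \<open>T\<close>. Only the left factor is homogeneous, since the sign depends on it
  alone.\<close>

definition der :: "int \<Rightarrow> int \<Rightarrow> ('a form endo \<Rightarrow> 'a form endo) \<Rightarrow>
    bool" where
  "der k d D \<longleftrightarrow> linear D \<and> (\<forall>r p x. x \<in> S r p \<longrightarrow> D x \<in> S
      (r + k) (p + d)) \<and>
    (\<forall>r p x y. x \<in> S r p \<longrightarrow> y \<in> T \<longrightarrow> D (x * y) = D x * y + sgni
        (k * r + d * p) *\<^sub>R (x * D y))"

lemma derD:
  assumes "der k d D"
  shows der_linear: "linear D" and der_S: "x \<in> S r p \<Longrightarrow> D x \<in> S (r + k) (p + d)"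
    and der_mult: "x \<in> S r p \<Longrightarrow> y \<in> T \<Longrightarrow> D (x * y) = D x * y + sgni (k *
        r + d * p) *\<^sub>R (x * D y)"
  using assms by (auto simp: der_def)

lemma der_T:
  assumes "der k d D" "x \<in> T" shows "D x \<in> T"
  using assms(2)
proof (induct rule: T_induct)
  case subspace
  show ?case using linear_subspace_vimage[OF der_linear[OF assms(1)] subspace_T] by (simp add: vimage_def)
qed (rule S_T[OF der_S[OF assms(1)]])

lemma der_cong: "der k d D \<Longrightarrow> k = k' \<Longrightarrow> even (d - d') \<Longrightarrow> der k' d' D"
proof -
  assume D: "der k d D" "k = k'" and d: "even (d - d')"
  have "S (r + k) (p + d) = S (r + k) (p + d')" for r p using d by (intro S_cong) simp
  moreover have "sgni (k * r + d * p) = sgni (k * r + d' * p)" for r p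
    using d by (intro sgni_cong) (simp flip: left_diff_distrib)
  ultimately show "der k' d' D" using D by (simp add: der_def)
qed

lemma der_lincomb:
  assumes "der k d D" "der k d E"
  shows "der k d (\<lambda>x. c *\<^sub>R D x + E x)"
  unfolding der_def
  by (intro conjI allI impI linear_compose_add linear_compose_scale_right der_linear[OF assms(1)] der_linear[OF
      assms(2)])
     (auto simp: der_mult[OF assms(1)] der_mult[OF assms(2)] der_S[OF assms(1)] der_S[OF assms(2)]
       S_add S_scale algebra_simps)

lemma der_zero: "der k d (\<lambda>x. 0)"
  by (auto simp: der_def linear_zero)

lemma der_scale: "der k d D \<Longrightarrow> der k d (\<lambda>x. c *\<^sub>R D x)"
  using der_lincomb[OF _ der_zero] by force

text \<open>Supercommutativity moves \<open>z\<close> past \<open>x\<close>; the resulting sign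
  accounts for the added bidegree \<open>(s, q)\<close>.\<close>

lemma der_left_mult:
  assumes "der k d D" "z \<in> S s q"
  shows "der (k + s) (d + q) (\<lambda>x. z * D x)"
  unfolding der_def
proof (intro conjI allI impI)
  show "linear (\<lambda>x. z * D x)"
    by (intro linearI) (auto simp: linear_add[OF der_linear[OF assms(1)]] linear_scale[OF der_linear[OF
        assms(1)]] algebra_simps)
next
  fix r p x assume x: "x \<in> S r p"
  show "z * D x \<in> S (r + (k + s)) (p + (d + q))"
    using S_mult[OF assms(2) der_S[OF assms(1) x]] by (simp add: add_ac)
  fix y assume y: "y \<in> T"
  have "z * (x * D y) = sgni (s * r + q * p) *\<^sub>R (x * (z * D y))"
    using S_commute[OF x assms(2)] by (simp flip: mult.assoc)
  then show "z * D (x * y) = z * D x * y + sgni ((k + s) * r + (d + q) * p) *\<^sub>R (x * (z * D y))"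
    by (simp add: der_mult[OF assms(1) x y] distrib_left mult.assoc)
       (simp add: algebra_simps flip: sgni_add)
qed

text \<open>The sign of the supercommutator is the one for which the mixed terms
  \<open>D x * E y\<close> and \<open>E x * D y\<close> cancel.\<close>

lemma der_commutator:
  assumes D: "der k d D" and E: "der l e E"
  shows "der (k + l) (d + e) (\<lambda>x. D (E x) - sgni (k * l + d * e) *\<^sub>R E (D x))"
  unfolding der_def
proof (intro conjI allI impI)
  note l = der_linear[OF D] der_linear[OF E]
  show "linear (\<lambda>x. D (E x) - sgni (k * l + d * e) *\<^sub>R E (D x))"
    by (intro linearI) (auto simp: linear_add[OF l(1)] linear_add[OF l(2)] linear_scale[OF l(1)]
        linear_scale[OF l(2)] algebra_simps)
  fix r p x assume x: "x \<in> S r p"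
  have "D (E x) \<in> S (r + (k + l)) (p + (d + e))" "E (D x) \<in> S (r + (k + l)) (p + (d + e))"
    using der_S[OF D der_S[OF E x]] der_S[OF E der_S[OF D x]] by (simp_all add: add_ac)
  then show "D (E x) - sgni (k * l + d * e) *\<^sub>R E (D x) \<in> S (r + (k + l)) (p + (d + e))"
    by (simp add: S_diff S_scale)
  fix y assume y: "y \<in> T"
  have *: "D (E (x * y)) = D (E x) * y + sgni (k * (r + l) + d * (p + e)) *\<^sub>R (E x * D y)
      + sgni (l * r + e * p) *\<^sub>R (D x * E y + sgni (k * r + d * p) *\<^sub>R (x * D (E y)))"
    by (simp add: der_mult[OF E x y] linear_add[OF l(1)] linear_scale[OF l(1)]
        der_mult[OF D der_S[OF E x] y] der_mult[OF D x der_T[OF E y]])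
  have **: "E (D (x * y)) = E (D x) * y + sgni (l * (r + k) + e * (p + d)) *\<^sub>R (D x * E y)
      + sgni (k * r + d * p) *\<^sub>R (E x * D y + sgni (l * r + e * p) *\<^sub>R (x * E (D y)))"
    by (simp add: der_mult[OF D x y] linear_add[OF l(2)] linear_scale[OF l(2)]
        der_mult[OF E der_S[OF D x] y] der_mult[OF E x der_T[OF D y]])
  have s: "sgni (k * (r + l) + d * (p + e)) = sgni (k * l + d * e) * sgni (k * r + d * p)"
    "sgni (k * l + d * e) * sgni (l * (r + k) + e * (p + d)) = sgni (l * r + e * p)"
    "sgni ((k + l) * r + (d + e) * p) = sgni (l * r + e * p) * sgni (k * r + d * p)"
    by (auto simp: sgni_def)
  show "D (E (x * y)) - sgni (k * l + d * e) *\<^sub>R E (D (x * y)) =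
      (D (E x) - sgni (k * l + d * e) *\<^sub>R E (D x)) * y
      + sgni ((k + l) * r + (d + e) * p) *\<^sub>R (x * (D (E y) - sgni (k * l + d * e) *\<^sub>R E (D y)))"
    unfolding * ** s(3) scaleR_add_right scaleR_scaleR mult.assoc[symmetric] s(2)
    unfolding s(1) by (simp add: algebra_simps)
qed

text \<open>Uniqueness for derivations prescribed on generators; the later identities between
  brackets are reduced to generators through it.\<close>

lemma der_eqI:
  assumes D: "der k d D" and E: "der k d E"
    and g0: "\<And>q f. q < 2 \<Longrightarrow> f \<in> Apar G q \<Longrightarrow> D (i0 f) = E (i0 f)"
    and g1: "\<And>q \<alpha>. q < 2 \<Longrightarrow> \<alpha> \<in> O1par G q \<Longrightarrow> D (i1
        \<alpha>) = E (i1 \<alpha>)"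
    and x: "x \<in> T"
  shows "D x = E x"
proof -
  note l = der_linear[OF D] der_linear[OF E]
  have sub: "subspace {x. D x = E x}"
    by (rule subspace_pointwise_linear)
       (auto simp: linear_add[OF l(1)] linear_add[OF l(2)] linear_scale[OF l(1)] linear_scale[OF l(2)]
           linear_0[OF l(1)] linear_0[OF l(2)])
  from x show ?thesis
  proof (induct rule: T_induct)
    case (hom r p y)
    then show ?case
    proof (induct rule: S_induct)
      case (step r p y q \<alpha>)
      have "i1 \<alpha> \<in> T" using i1_S[OF step(3,4), of "int q"] S_T by simp
      then show ?case using step by (simp add: der_mult[OF D step(1)] der_mult[OF E step(1)] g1)
    qed (use sub g0 in auto)
  qed (rule sub)
qed

section \<open>Derivations with prescribed values on generators\<close>

lemma section_exists: "\<exists>g. linear g \<and> (\<forall>x. g x \<in> Om G) \<and> (\<forall>x\<in>T.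
    \<Phi> (g x) = x)"
  using linear_exists_right_inverse_on[OF linear_\<Phi> subspace_Om] by (fastforce simp: T_eq)

text \<open>A linear choice of representatives, so that linear maps of forms induce linear maps of
  classes.\<close>

definition sec :: "'a form endo \<Rightarrow> 'a form" where
  "sec = (SOME g. linear g \<and> (\<forall>x. g x \<in> Om G) \<and> (\<forall>x\<in>T. \<Phi> (g x) = x))"

lemma sec: "linear sec" "sec x \<in> Om G" "x \<in> T \<Longrightarrow> \<Phi> (sec x) = x"
  using someI_ex[OF section_exists, folded sec_def] by auto

lemma sec_\<Phi>: "x \<in> Om G \<Longrightarrow> sec (\<Phi> x) - x \<in> Rid G"
  using \<Phi>_eq_0_iff[of "sec (\<Phi> x) - x"] sec(2,3)[of "\<Phi> x"] Om_diff
  by (auto simp: T_eq)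

lemma S_eq: "S r p = \<Phi> ` span (wd ` hom_words r p)"
  by (simp add: S_def lmul_image)

lemma hw_Om: "x \<in> span (wd ` hom_words r p) \<Longrightarrow> x \<in> Om G"
  unfolding Om_def by (erule set_mp[OF span_mono, rotated]) (auto simp: hom_words_def)

text \<open>A derivation is the off-diagonal entry of a homomorphism into upper triangular matrices
  whose diagonal consists of the identity and the sign twist.\<close>

lemma der_exists:
  fixes D0 :: "nat \<Rightarrow> 'a \<Rightarrow> 'a form endo" and D1 :: "nat \<Rightarrow> 'a tens
      \<Rightarrow> 'a form endo"
  assumes lin0: "\<And>p f g c. p < 2 \<Longrightarrow> f \<in> Apar G p \<Longrightarrow> g \<in> Apar G p
      \<Longrightarrow> D0 p (c *\<^sub>R f + g) = c *\<^sub>R D0 p f + D0 p g"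
    and lin1: "\<And>p \<alpha> \<beta> c. p < 2 \<Longrightarrow> \<alpha> \<in> O1par G p \<Longrightarrow>
        \<beta> \<in> O1par G p \<Longrightarrow> D1 p (\<alpha> + \<beta>) = D1 p \<alpha> + D1 p \<beta>"
    and in0: "\<And>p f. p < 2 \<Longrightarrow> f \<in> Apar G p \<Longrightarrow> D0 p f \<in> S k (int p + d)"
    and in1: "\<And>p \<alpha>. p < 2 \<Longrightarrow> \<alpha> \<in> O1par G p \<Longrightarrow> D1 p
        \<alpha> \<in> S (1 + k) (int p + d)"
    and mult0: "\<And>p q f g. p < 2 \<Longrightarrow> q < 2 \<Longrightarrow> f \<in> Apar G p
        \<Longrightarrow> g \<in> Apar G q \<Longrightarrow>
      D0 ((p + q) mod 2) (f * g) = D0 p f * i0 g + sgni (d * int p) *\<^sub>R (i0 f * D0 q g)"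
    and mult1: "\<And>p q f \<alpha>. p < 2 \<Longrightarrow> q < 2 \<Longrightarrow> f \<in> Apar G p
        \<Longrightarrow> \<alpha> \<in> O1par G q \<Longrightarrow>
      D1 ((p + q) mod 2) (lact f \<alpha>) = D0 p f * i1 \<alpha> + sgni (d * int p) *\<^sub>R (i0 f * D1 q \<alpha>)"
  shows "\<exists>D. der k d D \<and> (\<forall>p f. p < 2 \<longrightarrow> f \<in> Apar G p \<longrightarrow>
      D (i0 f) = D0 p f)
    \<and> (\<forall>p \<alpha>. p < 2 \<longrightarrow> \<alpha> \<in> O1par G p \<longrightarrow> D (i1
        \<alpha>) = D1 p \<alpha>)"
proof -
  \<comment> \<open>On bidegree \<open>(r, s)\<close> the upper diagonal entry has to carry the sign
    \<open>sgni (k * r + d * s)\<close>; a function has \<open>r = 0\<close> and a one-form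
    \<open>r = 1\<close>.\<close>
  define \<phi>0 where "\<phi>0 p f = Tri (sgni (d * int p) *\<^sub>R i0 f) (D0 p f) (i0 f)" for p f
  define \<phi>1 where "\<phi>1 p \<alpha> = Tri (sgni (k + d * int p) *\<^sub>R i1 \<alpha>) (D1 p \<alpha>)
      (i1 \<alpha>)" for p \<alpha>
  have lin0s: "D0 p (c *\<^sub>R f) = c *\<^sub>R D0 p f" if "p < 2" "f \<in> Apar G p" for p f c
    using lin0[of p f 0 c] lin0[of p 0 0 "-1"] that by simp
  have i0S: "i0 f \<in> S 0 (int p)" if "p < 2" "f \<in> Apar G p" for p f using i0_S that by simp
  have i1S: "i1 f \<in> S 1 (int p)" if "p < 2" "f \<in> O1par G p" for p f using i1_S that by simp
  interpret gm: generator_maps G \<phi>0 \<phi>1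
  proof
    show "\<phi>0 p (f + g) = \<phi>0 p f + \<phi>0 p g" if "p < 2" "f \<in> Apar G p" "g \<in> Apar G p" for p f g
      using lin0[of p f g 1] that by (simp add: \<phi>0_def tri_defs algebra_simps)
    show "\<phi>0 p (c *\<^sub>R f) = c *\<^sub>R \<phi>0 p f" if "p < 2" "f \<in> Apar G p" for p f c
      using lin0s that by (simp add: \<phi>0_def tri_defs algebra_simps)
    show "\<phi>1 q (\<alpha> + \<beta>) = \<phi>1 q \<alpha> + \<phi>1 q \<beta>" if "q < 2" "\<alpha> \<in>
        O1par G q" "\<beta> \<in> O1par G q" for q \<alpha> \<beta>
      using lin1[of q \<alpha> \<beta>] i1_add[of \<alpha> \<beta>] that by (simp add: \<phi>1_def tri_defs
          algebra_simps O1par_Omega1)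
    show "\<phi>0 ((p + q) mod 2) (f * g) = \<phi>0 p f * \<phi>0 q g"
      if "p < 2" "q < 2" "f \<in> Apar G p" "g \<in> Apar G q" for p q f g
    proof -
      have "sgni (d * int ((p + q) mod 2)) = sgni (d * int p) * sgni (d * int q)"
        by (auto simp: sgni_def of_nat_mod)
      then show ?thesis
        using mult0[OF that] i0_mult[OF that] by (simp add: \<phi>0_def tri_defs add.commute)
    qed
    show "\<phi>1 ((p + q) mod 2) (lact f \<alpha>) = \<phi>0 p f * \<phi>1 q \<alpha>"
      if "p < 2" "q < 2" "f \<in> Apar G p" "\<alpha> \<in> O1par G q" for p q f \<alpha>
    proof -
      have "sgni (k + d * int ((p + q) mod 2)) = sgni (d * int p) * sgni (k + d * int q)"
        by (auto simp: sgni_def of_nat_mod)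
      then show ?thesis
        using mult1[OF that] i1_lact[OF that] by (simp add: \<phi>1_def \<phi>0_def tri_defs add.commute)
    qed
    \<comment> \<open>The prescribed values lie in the bigraded image with known bidegree, so they
      supercommute with the generators; this yields the corner of the commutation relation, here and
      for two one-forms below.\<close>
    show "\<phi>1 q \<alpha> * \<phi>0 p f = sgni (int p * int q) *\<^sub>R (\<phi>0 p f * \<phi>1 q \<alpha>)"
      if "p < 2" "q < 2" "f \<in> Apar G p" "\<alpha> \<in> O1par G q" for p q f \<alpha>
    proof -
      have 1: "i1 \<alpha> * D0 p f = sgni (k + int q * (int p + d)) *\<^sub>R (D0 p f * i1 \<alpha>)"
        using S_commute[OF in0[of p f] i1S[of q \<alpha>]] that by simp
      have 2: "D1 q \<alpha> * i0 f = sgni ((int q + d) * int p) *\<^sub>R (i0 f * D1 q \<alpha>)"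
        using S_commute[OF i0S[of p f] in1[of q \<alpha>]] that by simp
      have 3: "sgni (k + d * int q) * sgni (k + int q * (int p + d)) = sgni (int p * int q)"
        "sgni ((int q + d) * int p) = sgni (int p * int q) * sgni (d * int p)"
        by (auto simp: sgni_def)
      show ?thesis
        using i1_i0_commute[OF that]
        by (simp add: \<phi>1_def \<phi>0_def tri_defs 1 2[unfolded 3] 3(1) scaleR_add_right mult_ac)
    qed
    show "\<phi>1 p \<alpha> * \<phi>1 q \<beta> = - (sgni (int p * int q) *\<^sub>R (\<phi>1 q \<beta> *
        \<phi>1 p \<alpha>))"
      if "p < 2" "q < 2" "\<alpha> \<in> O1par G p" "\<beta> \<in> O1par G q" for p q \<alpha> \<beta>
    proof -
      have 1: "i1 \<alpha> * D1 q \<beta> = sgni ((1 + k) + int p * (int q + d)) *\<^sub>R (D1 q \<beta> * i1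
          \<alpha>)"
        using S_commute[OF in1[of q \<beta>] i1S[of p \<alpha>]] that by simp
      have 2: "D1 p \<alpha> * i1 \<beta> = sgni ((1 + k) + (int p + d) * int q) *\<^sub>R (i1 \<beta> * D1 p
          \<alpha>)"
        using S_commute[OF i1S[of q \<beta>] in1[of p \<alpha>]] that by simp
      have 3: "sgni (k + d * int p) * sgni ((1 + k) + int p * (int q + d)) = - sgni (int p * int q)"
        "sgni ((1 + k) + (int p + d) * int q) = - (sgni (int p * int q) * sgni (k + d * int q))"
        by (auto simp: sgni_def)
      show ?thesis
        using i1_i1_commute[OF that]
        by (simp add: \<phi>1_def tri_defs 1 2[unfolded 3] 3(1) scaleR_add_right mult_ac)
    qed
  qed
  define \<Psi> where "\<Psi> = lext (wmap \<phi>0 \<phi>1)"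
  define D where "D x = tri_d (\<Psi> (sec x))" for x
  have lin\<Psi>: "linear \<Psi>" by (simp add: \<Psi>_def linear_lext)
  have linD: "linear D"
    by (intro linearI) (auto simp: D_def linear_add[OF sec(1)] linear_scale[OF sec(1)]
        linear_add[OF lin\<Psi>] linear_scale[OF lin\<Psi>])
  \<comment> \<open>\<open>sec\<close> may return another representative than \<open>x\<close>, but
    the homomorphism annihilates the difference.\<close>
  have D\<Phi>: "D (\<Phi> x) = tri_d (\<Psi> x)" if "x \<in> Om G" for x
    using gm.lext_Rid[OF sec_\<Phi>[OF that]] by (simp add: D_def \<Psi>_def)
  \<comment> \<open>With the representation in the lower diagonal entry and its sign twist in the
    upper one, the corner of a matrix product becomes the required Leibniz rule.\<close>
  have word: "tri_b (\<Psi> (wd (p, f, as))) = lmul (p, f, as)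
      \<and> tri_a (\<Psi> (wd (p, f, as))) = sgni (k * r + d * s) *\<^sub>R lmul (p, f, as)
      \<and> tri_d (\<Psi> (wd (p, f, as))) \<in> S (r + k) (s + d)" if "(p, f, as) \<in> hom_words r s" for p
          f as r s
    using that
  proof (induct as arbitrary: r s rule: rev_induct)
    case Nil
    have "sgni (d * int p) = sgni (d * s)" using Nil by (simp add: hom_words_iff sgni_eq_iff flip: right_diff_distrib)
    moreover have "S k (int p + d) = S k (s + d)" using Nil by (intro S_cong) (simp add: hom_words_iff)
    ultimately show ?case using Nil in0[of p f] by (auto simp: \<Psi>_def \<phi>0_def hom_words_iff lmul_Nil)
  next
    case (snoc a as)
    obtain q \<alpha> where a: "a = (q, \<alpha>)" by force
    have h: "(p, f, as) \<in> hom_words (r - 1) (s - int q)" "q < 2" "\<alpha> \<in> O1par G q"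
      using snoc(2) by (auto simp: a hom_words_iff algebra_simps)
    have l: "lmul (p, f, as @ [a]) = lmul (p, f, as) * i1 \<alpha>"
      using h by (simp add: a lmul_snoc hom_words_iff)
    have \<Psi>: "\<Psi> (wd (p, f, as @ [a])) = \<Psi> (wd (p, f, as)) * \<phi>1 q \<alpha>"
      by (simp add: \<Psi>_def a)
    note IH = snoc(1)[OF h(1)]
    have sg: "sgni (k * r + d * s) = sgni (k * (r - 1) + d * (s - int q)) * sgni (k + d * int q)"
      by (auto simp: sgni_def)
    have "lmul (p, f, as) * D1 q \<alpha> \<in> S (r + k) (s + d)"
      using S_mult[OF lmul_S[OF h(1)] in1[OF h(2,3)]] by (simp add: algebra_simps)
    moreover have "tri_d (\<Psi> (wd (p, f, as))) * i1 \<alpha> \<in> S (r + k) (s + d)"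
      using S_mult[of "tri_d (\<Psi> (wd (p, f, as)))" "r - 1 + k" "s - int q + d" "i1 \<alpha>" 1 "int q"] IH
          i1S[OF h(2,3)]
      by (simp add: algebra_simps)
    ultimately show ?case unfolding l \<Psi>
      using IH by (simp add: \<phi>1_def S_add S_scale sg mult.commute)
  qed
  have hom: "tri_a (\<Psi> x) = sgni (k * r + d * s) *\<^sub>R \<Phi> x \<and> tri_d (\<Psi> x) \<in> S (r + k)
      (s + d)"
    if "x \<in> span (wd ` hom_words r s)" for x r s
    using that
  proof (induct rule: span_induct_cases)
    case subspace
    show ?case by (rule subspace_pointwise_linear)
      (auto simp: linear_add[OF lin\<Psi>] linear_scale[OF lin\<Psi>] linear_0[OF lin\<Psi>] S_add S_scale
          scaleR_add_right)
  next
    case (base b)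
    then obtain p f as where "b = wd (p, f, as)" "(p, f, as) \<in> hom_words r s" by auto
    then show ?case using word[of p f as r s] by (simp add: \<Phi>_wd)
  qed
  have all: "tri_b (\<Psi> x) = \<Phi> x" if "x \<in> Om G" for x
    using that unfolding Om_def
  proof (induct rule: span_induct_cases)
    case subspace
    show ?case by (rule subspace_pointwise_linear)
      (auto simp: linear_add[OF lin\<Psi>] linear_scale[OF lin\<Psi>] linear_0[OF lin\<Psi>])
  next
    case (base b)
    then obtain p f as where b: "b = wd (p, f, as)" "valid_word G (p, f, as)" by auto
    then have "(p, f, as) \<in> hom_words (int (length as)) (int p + int (sum_list (map fst as)))" by (simp
        add: hom_words_iff)
    then show ?case using word b by (simp add: \<Phi>_wd)
  qed
  have "der k d D"
    unfolding der_def
  proof (intro conjI allI impI linD)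
    fix r p x assume "x \<in> S r p"
    then obtain x' where x': "x' \<in> span (wd ` hom_words r p)" "x = \<Phi> x'" by (auto simp: S_eq)
    note xO = hw_Om[OF x'(1)]
    show "D x \<in> S (r + k) (p + d)" using hom[OF x'(1)] by (simp add: x'(2) D\<Phi>[OF xO])
    fix y assume "y \<in> T"
    then obtain y' where y': "y' \<in> Om G" "y = \<Phi> y'" by (auto simp: T_eq)
    have "D (x * y) = tri_d (\<Psi> (wedge x' y'))"
      using D\<Phi>[OF wedge_Om[OF xO y'(1)]] by (simp add: x' y' \<Phi>_wedge[OF xO y'(1)])
    also have "\<Psi> (wedge x' y') = \<Psi> x' * \<Psi> y'"
      unfolding \<Psi>_def by (rule gm.lext_wedge[OF xO y'(1)])
    finally show "D (x * y) = D x * y + sgni (k * r + d * p) *\<^sub>R (x * D y)"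
      using hom[OF x'(1)] all[OF y'(1)] by (simp add: x' y' D\<Phi> xO)
  qed
  moreover have "D (i0 f) = D0 p f" if "p < 2" "f \<in> Apar G p" for p f
    using D\<Phi>[of "wd (p, f, [])"] that by (simp add: wd_Om \<Phi>_wd lmul_Nil \<Psi>_def \<phi>0_def)
  moreover have "D (i1 \<alpha>) = D1 q \<alpha>" if "q < 2" "\<alpha> \<in> O1par G q" for q \<alpha>
  proof -
    have "D0 0 (1 * 1) = D0 0 1 * i0 1 + i0 1 * D0 0 1"
      using mult0[of 0 0 1 1] by (simp add: sgni_def)
    \<comment> \<open>The word representing \<open>\<alpha>\<close> has coefficient 1, so its corner
      is the right-hand side of the module rule at \<open>f = 1\<close>, which is the value
      prescribed at \<open>lact 1 \<alpha> = \<alpha>\<close>.\<close>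
    have "D1 q (lact 1 \<alpha>) = D0 0 1 * i1 \<alpha> + i0 1 * D1 q \<alpha>"
      using mult1[of 0 q 1 \<alpha>] that by (simp add: sgni_def)
    moreover have "lact 1 \<alpha> = \<alpha>" using that by (simp add: lact_one O1par_AtA)
    moreover have "D (\<Phi> (wd (0, 1, [(q, \<alpha>)]))) = tri_d (\<Psi> (wd (0, 1, [(q, \<alpha>)])))"
      using that by (intro D\<Phi> wd_Om) simp
    ultimately show ?thesis using that
      by (simp add: wd_Om \<Phi>_wd lmul_single \<Psi>_def \<phi>0_def \<phi>1_def sgni_def add.commute)
  qed
  ultimately show ?thesis by blast
qed

text \<open>\<open>Ohom\<close> collects the forms congruent to a homogeneous one, so it is a
  condition on classes and can be tested after \<open>\<Phi>\<close>.\<close>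

lemma Ohom_iff:
  assumes "p < 2"
  shows "x \<in> Ohom G r p \<longleftrightarrow> x \<in> Om G \<and> \<Phi> x \<in> S (int r) (int p)"
proof -
  have "wpar w = p \<longleftrightarrow> even (int (wpar w) - int p)" for w :: "'a word"
    using assms by (auto simp: wpar_def mod2_eq_if dest!: less_two_cases)
  then have hom_words: "{w. valid_word G w \<and> wdeg w = r \<and> wpar w = p} = hom_words (int r) (int p)"
    unfolding hom_words_def by auto
  show ?thesis unfolding Ohom_def hom_words S_eq
    using oeq_iff_\<Phi> hw_Om by (auto simp: image_iff)
qed

lemma i0_T: "i0 f \<in> T"
  using i0_def T_eq embA_Om by simp

lemma i1_T: "\<alpha> \<in> Omega1 \<Longrightarrow> i1 \<alpha> \<in> T"
  using i1_def T_eq emb1_Om by simp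

end

subsection \<open>From a Lie superalgebroid to the bracket\<close>

lemma functional_exists:
  assumes "x \<notin> span B" shows "\<exists>\<phi> :: 'v::real_vector \<Rightarrow> real. linear \<phi>
      \<and> \<phi> x = 1 \<and> (\<forall>b\<in>B. \<phi> b = 0)"
proof -
  obtain C where C: "C \<subseteq> span B" "independent C" "span B \<subseteq> span C"
    using maximal_independent_subset by blast
  have "x \<notin> span C" using assms span_minimal[OF C(1) subspace_span] by blast
  then have ind: "independent (insert x C)" using C(2) by (simp add: independent_insert)
  obtain \<phi> where \<phi>: "linear \<phi>" "\<And>y. y \<in> insert x C \<Longrightarrow> \<phi> y = (if y =
      x then 1 else (0::real))"
    using linear_independent_extend[OF ind, of "\<lambda>y. if y = x then 1 else 0"] by blast
  have xC: "x \<notin> C" using \<open>x \<notin> span C\<close> span_base by blast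
  have "\<phi> y = 0" if "y \<in> span C" for y
    using that by (induct rule: span_induct_cases)
      (use \<phi> xC in \<open>auto simp: subspace_def linear_add linear_scale linear_0\<close>)
  then have "\<forall>b\<in>B. \<phi> b = 0" using C(3) span_base by blast
  then show ?thesis using \<phi> by auto
qed

text \<open>The element \<open>x\<close> takes \<open>dA b\<close> to
  \<open>(x * b) \<otimes> 1 - x \<otimes> b\<close>. Functionals with \<open>\<phi> x = 1\<close>,
  \<open>\<psi> b = 1\<close> and \<open>\<psi> 1 = 0\<close> give this the value -1; such a
  \<open>\<psi>\<close> exists because \<open>b\<close> is not a multiple of 1.\<close>

lemma lact_Omega1_faithful:
  fixes x b :: "'a::real_algebra_1"
  assumes "\<And>\<gamma>. \<gamma> \<in> Omega1 \<Longrightarrow> lact x \<gamma> = 0" "b \<notin> span {1}"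
  shows "x = 0"
proof (rule ccontr)
  assume "x \<noteq> 0"
  then have "x \<notin> span {}" by simp
  from functional_exists[OF this] obtain \<phi> :: "'a \<Rightarrow> real" where \<phi>: "linear \<phi>"
      "\<phi> x = 1" by blast
  from functional_exists[OF assms(2)] obtain \<psi> :: "'a \<Rightarrow> real" where \<psi>: "linear \<psi>"
      "\<psi> b = 1" "\<psi> 1 = 0" by blast
  have "lact x (dA b) = tensor (x * b) 1 - tensor x b"
    by (simp add: dA_def linear_diff[OF linear_lact])
  then have "(tensor (x * b) 1 - tensor x b) (\<phi>, \<psi>) = 0"
    using assms(1)[OF dA_Omega1, of b] by (simp add: fun_apply)
  then show False using \<phi> \<psi> by (simp add: tensor_def fun_apply)
qed

section \<open>The algebroid axioms and the compatibility of the anchor with brackets\<close>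

locale algebroid = graded_algebra G for G :: "int \<Rightarrow> 'a::real_algebra_1 set" +
  fixes brk :: "'a tens \<Rightarrow> 'a tens \<Rightarrow> 'a tens" and \<rho> :: "'a tens \<Rightarrow> 'a
      \<Rightarrow> 'a"
  assumes lie: "lie_superalgebroid G brk \<rho>"
begin

lemmas lie_conj = lie[unfolded lie_superalgebroid_def minus_one_power_eq_sgni of_nat_mult]

lemma rho_superderiv: "p < 2 \<Longrightarrow> \<alpha> \<in> O1par G p \<Longrightarrow> superderiv G p
    (\<rho> \<alpha>)"
  by (rule lie_conj[THEN conjunct2, THEN conjunct2, THEN conjunct1, rule_format])
lemma rho_lincomb: "\<alpha> \<in> Omega1 \<Longrightarrow> \<beta> \<in> Omega1 \<Longrightarrow> \<rho> (c
    *\<^sub>R \<alpha> + \<beta>) f = c *\<^sub>R \<rho> \<alpha> f + \<rho> \<beta> f"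
  using lie_conj[THEN conjunct2, THEN conjunct1, rule_format] by metis
lemma rho_lact: "\<alpha> \<in> Omega1 \<Longrightarrow> \<rho> (lact f \<alpha>) g = f * \<rho> \<alpha> g"
  using lie_conj[THEN conjunct2, THEN conjunct2, THEN conjunct2, THEN conjunct1, rule_format] by metis
lemma brk_lincomb_left: "\<alpha> \<in> Omega1 \<Longrightarrow> \<alpha>' \<in> Omega1 \<Longrightarrow>
    \<beta> \<in> Omega1 \<Longrightarrow>
    brk (c *\<^sub>R \<alpha> + \<alpha>') \<beta> = c *\<^sub>R brk \<alpha> \<beta> + brk \<alpha>' \<beta>"
  by (rule lie_conj[THEN conjunct2, THEN conjunct2, THEN conjunct2, THEN conjunct2, THEN conjunct2, THEN
      conjunct1, rule_format])
lemma brk_lincomb_right: "\<alpha> \<in> Omega1 \<Longrightarrow> \<beta> \<in> Omega1 \<Longrightarrow>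
    \<beta>' \<in> Omega1 \<Longrightarrow>
    brk \<alpha> (c *\<^sub>R \<beta> + \<beta>') = c *\<^sub>R brk \<alpha> \<beta> + brk \<alpha> \<beta>'"
  by (rule lie_conj[THEN conjunct2, THEN conjunct2, THEN conjunct2, THEN conjunct2, THEN conjunct2, THEN
      conjunct2, THEN conjunct1, rule_format])
lemma brk_Omega1: "\<alpha> \<in> Omega1 \<Longrightarrow> \<beta> \<in> Omega1 \<Longrightarrow> brk \<alpha>
    \<beta> \<in> Omega1"
  by (rule lie_conj[THEN conjunct2, THEN conjunct2, THEN conjunct2, THEN conjunct2, THEN conjunct1, rule_format])
lemma brk_O1par: "p < 2 \<Longrightarrow> q < 2 \<Longrightarrow> \<alpha> \<in> O1par G p \<Longrightarrow>
    \<beta> \<in> O1par G q \<Longrightarrow>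
    brk \<alpha> \<beta> \<in> O1par G ((p + q) mod 2)"
  by (rule lie_conj[THEN conjunct2, THEN conjunct2, THEN conjunct2, THEN conjunct2, THEN conjunct2, THEN
      conjunct2, THEN conjunct2, THEN conjunct1, rule_format])
lemma brk_anti: "p < 2 \<Longrightarrow> q < 2 \<Longrightarrow> \<alpha> \<in> O1par G p \<Longrightarrow>
    \<beta> \<in> O1par G q \<Longrightarrow>
    brk \<alpha> \<beta> = - (sgni (int p * int q) *\<^sub>R brk \<beta> \<alpha>)"
  by (rule lie_conj[THEN conjunct2, THEN conjunct2, THEN conjunct2, THEN conjunct2, THEN conjunct2, THEN
      conjunct2, THEN conjunct2, THEN conjunct2, THEN conjunct1, rule_format])
lemma brk_jacobi: "p < 2 \<Longrightarrow> q < 2 \<Longrightarrow> u < 2 \<Longrightarrow> \<alpha> \<in> O1par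
    G p \<Longrightarrow> \<beta> \<in> O1par G q \<Longrightarrow> \<gamma> \<in> O1par G u \<Longrightarrow>
    brk \<alpha> (brk \<beta> \<gamma>) = brk (brk \<alpha> \<beta>) \<gamma> + sgni (int p * int q) *\<^sub>R
        brk \<beta> (brk \<alpha> \<gamma>)"
  by (rule lie_conj[THEN conjunct2, THEN conjunct2, THEN conjunct2, THEN conjunct2, THEN conjunct2, THEN
      conjunct2, THEN conjunct2, THEN conjunct2, THEN conjunct2, THEN conjunct1, rule_format])
lemma brk_leibniz: "p < 2 \<Longrightarrow> q < 2 \<Longrightarrow> \<alpha> \<in> O1par G p \<Longrightarrow>
    f \<in> Apar G q \<Longrightarrow> \<beta> \<in> Omega1 \<Longrightarrow>
    brk \<alpha> (lact f \<beta>) = lact (\<rho> \<alpha> f) \<beta> + sgni (int p * int q) *\<^sub>R lact f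
        (brk \<alpha> \<beta>)"
  by (rule lie_conj[THEN conjunct2, THEN conjunct2, THEN conjunct2, THEN conjunct2, THEN conjunct2, THEN
      conjunct2, THEN conjunct2, THEN conjunct2, THEN conjunct2, THEN conjunct2, rule_format])

lemma rho_linear: "p < 2 \<Longrightarrow> \<alpha> \<in> O1par G p \<Longrightarrow> linear (\<rho> \<alpha>)"
  and rho_Apar: "p < 2 \<Longrightarrow> \<alpha> \<in> O1par G p \<Longrightarrow> q < 2 \<Longrightarrow> f
      \<in> Apar G q \<Longrightarrow> \<rho> \<alpha> f \<in> Apar G ((p + q) mod 2)"
  and rho_mult: "p < 2 \<Longrightarrow> \<alpha> \<in> O1par G p \<Longrightarrow> q < 2 \<Longrightarrow> f
      \<in> Apar G q \<Longrightarrow>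
    \<rho> \<alpha> (f * g) = \<rho> \<alpha> f * g + sgni (int p * int q) *\<^sub>R (f * \<rho> \<alpha> g)"
  using rho_superderiv[of p \<alpha>] unfolding superderiv_def minus_one_power_eq_sgni of_nat_mult by blast+

lemma rho_one: "p < 2 \<Longrightarrow> \<alpha> \<in> O1par G p \<Longrightarrow> \<rho> \<alpha> 1 = 0"
  using rho_mult[of p \<alpha> 0 1 1] by (simp add: sgni_def)

lemma rho_brk:
  assumes p: "p < 2" "\<alpha> \<in> O1par G p" and q: "q < 2" "\<beta> \<in> O1par G q" and s: "s < 2" "f
      \<in> Apar G s"
  shows "\<rho> \<alpha> (\<rho> \<beta> f) = \<rho> (brk \<alpha> \<beta>) f + sgni (int p * int q) *\<^sub>R
      \<rho> \<beta> (\<rho> \<alpha> f)"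
proof (cases "\<forall>b :: 'a. b \<in> span {1}")
  case True
  have "\<rho> \<gamma> g = 0" if "u < 2" "\<gamma> \<in> O1par G u" for \<gamma> g u
  proof -
    obtain c where "g = c *\<^sub>R 1" using True by (auto simp: span_singleton)
    then show ?thesis using rho_one[OF that] linear_scale[OF rho_linear[OF that]] by simp
  qed
  moreover have "brk \<alpha> \<beta> \<in> O1par G ((p + q) mod 2)" by (rule brk_O1par[OF p(1) q(1) p(2) q(2)])
  ultimately show ?thesis using p q by (metis add.right_neutral mod_less_divisor pos2 scaleR_zero_right)
next
  case False
  then obtain b :: 'a where b: "b \<notin> span {1}" by blast
  let ?x = "\<rho> \<alpha> (\<rho> \<beta> f) - (\<rho> (brk \<alpha> \<beta>) f + sgni (int p * int q)
      *\<^sub>R \<rho> \<beta> (\<rho> \<alpha> f))"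
  have O: "\<alpha> \<in> Omega1" "\<beta> \<in> Omega1" using p q by (auto intro: O1par_Omega1)
  have ab: "brk \<alpha> \<beta> \<in> O1par G ((p + q) mod 2)" by (rule brk_O1par[OF p(1) q(1) p(2) q(2)])
  have lin: "brk \<delta> (\<gamma> + c *\<^sub>R \<gamma>') = brk \<delta> \<gamma> + c *\<^sub>R brk \<delta>
      \<gamma>'"
    if "\<delta> \<in> Omega1" "\<gamma> \<in> Omega1" "\<gamma>' \<in> Omega1" for \<delta> \<gamma> \<gamma>' c
    using brk_lincomb_right[of \<delta> \<gamma>' \<gamma> c] that by (simp add: add.commute)
  have hom: "lact ?x \<gamma> = 0" if u: "u < 2" "\<gamma> \<in> O1par G u" for u \<gamma>
  proof -
    have \<gamma>: "\<gamma> \<in> Omega1" "\<gamma> \<in> AtA" using u by (auto intro: O1par_Omega1 O1par_AtA)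
    \<comment> \<open>In the Jacobi identity for \<open>lact f \<gamma>\<close> the middle terms of
      this expansion match those with \<open>\<delta>\<close> and \<open>\<epsilon>\<close>
      exchanged and drop out. The last term obeys the Jacobi identity for \<open>\<gamma>\<close>,
      so that only the action of \<open>?x\<close> on \<open>\<gamma>\<close> remains.\<close>
    have expand: "brk \<delta> (brk \<epsilon> (lact f \<gamma>)) =
        lact (\<rho> \<delta> (\<rho> \<epsilon> f)) \<gamma> + sgni (int d * (int e + int s)) *\<^sub>R lact
            (\<rho> \<epsilon> f) (brk \<delta> \<gamma>)
        + sgni (int e * int s) *\<^sub>R (lact (\<rho> \<delta> f) (brk \<epsilon> \<gamma>) + sgni (int d *
            int s) *\<^sub>R lact f (brk \<delta> (brk \<epsilon> \<gamma>)))"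
      if d: "d < 2" "\<delta> \<in> O1par G d" and e: "e < 2" "\<epsilon> \<in> O1par G e" for d \<delta> e \<epsilon>
    proof -
      have O': "\<delta> \<in> Omega1" "\<epsilon> \<in> Omega1" using d e by (auto intro: O1par_Omega1)
      have "brk \<delta> (brk \<epsilon> (lact f \<gamma>)) = brk \<delta> (lact (\<rho> \<epsilon> f)
          \<gamma>) + sgni (int e * int s) *\<^sub>R brk \<delta> (lact f (brk \<epsilon> \<gamma>))"
        unfolding brk_leibniz[OF e(1) s(1) e(2) s(2) \<gamma>(1)]
        by (intro lin O' lact_Omega1 \<gamma> brk_Omega1)
      also have "brk \<delta> (lact f (brk \<epsilon> \<gamma>)) = lact (\<rho> \<delta> f) (brk \<epsilon>
          \<gamma>) + sgni (int d * int s) *\<^sub>R lact f (brk \<delta> (brk \<epsilon> \<gamma>))"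
        by (intro brk_leibniz d s brk_Omega1 O' \<gamma>)
      also have "brk \<delta> (lact (\<rho> \<epsilon> f) \<gamma>) = lact (\<rho> \<delta> (\<rho> \<epsilon>
          f)) \<gamma> + sgni (int d * int ((e + s) mod 2)) *\<^sub>R lact (\<rho> \<epsilon> f) (brk \<delta>
            \<gamma>)"
        by (intro brk_leibniz d rho_Apar e s \<gamma>) simp
      also have "sgni (int d * int ((e + s) mod 2)) = sgni (int d * (int e + int s))"
        by (auto simp: sgni_def of_nat_mod)
      finally show ?thesis .
    qed
    have 3: "brk (brk \<alpha> \<beta>) (lact f \<gamma>) = lact (\<rho> (brk \<alpha> \<beta>) f) \<gamma> +
        sgni ((int p + int q) * int s) *\<^sub>R lact f (brk (brk \<alpha> \<beta>) \<gamma>)"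
    proof -
      have "sgni (int ((p + q) mod 2) * int s) = sgni ((int p + int q) * int s)"
        by (auto simp: sgni_def of_nat_mod)
      then show ?thesis using brk_leibniz[OF _ s(1) ab s(2) \<gamma>(1)] by simp
    qed
    have "lact f \<gamma> \<in> O1par G ((s + u) mod 2)" by (rule lact_O1par[OF s(2) u(2) s(1) u(1)])
    then have "brk \<alpha> (brk \<beta> (lact f \<gamma>)) = brk (brk \<alpha> \<beta>) (lact f \<gamma>) +
        sgni (int p * int q) *\<^sub>R brk \<beta> (brk \<alpha> (lact f \<gamma>))"
      by (intro brk_jacobi[OF p(1) q(1) _ p(2) q(2)]) auto
    moreover have "lact f (brk \<alpha> (brk \<beta> \<gamma>)) = lact f (brk (brk \<alpha> \<beta>) \<gamma>)
        + sgni (int p * int q) *\<^sub>R lact f (brk \<beta> (brk \<alpha> \<gamma>))"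
      unfolding brk_jacobi[OF p(1) q(1) u(1) p(2) q(2) u(2)] by simp
    moreover have "sgni (int p * (int q + int s)) = sgni (int p * int q) * sgni (int p * int s)"
      "sgni (int q * (int p + int s)) = sgni (int p * int q) * sgni (int q * int s)"
      "sgni ((int p + int q) * int s) = sgni (int p * int s) * sgni (int q * int s)"
      by (auto simp: sgni_def)
    ultimately have "lact (\<rho> \<alpha> (\<rho> \<beta> f)) \<gamma> = lact (\<rho> (brk \<alpha> \<beta>)
        f) \<gamma> + sgni (int p * int q) *\<^sub>R lact (\<rho> \<beta> (\<rho> \<alpha> f)) \<gamma>"
      unfolding expand[OF p q] expand[OF q p] 3 by (simp add: algebra_simps)
    then show ?thesis
      using lact_add_left[OF \<gamma>(2), of ?x "\<rho> (brk \<alpha> \<beta>) f + sgni (int p * int q)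
          *\<^sub>R \<rho> \<beta> (\<rho> \<alpha> f)"]
      by (simp add: lact_add_left[OF \<gamma>(2)] lact_scaleR_left[OF \<gamma>(2)])
  qed
  have "lact ?x \<gamma> = 0" if "\<gamma> \<in> Omega1" for \<gamma>
  proof -
    have "lact ?x (tcomp G 0 \<gamma> + tcomp G 1 \<gamma>) = 0"
      unfolding lact_add using hom[of 0 "tcomp G 0 \<gamma>"] hom[of 1 "tcomp G 1 \<gamma>"] tcomp_in[OF that] by simp
    then show ?thesis by (simp only: tcomp_decomp[OF that])
  qed
  from lact_Omega1_faithful[OF this b] show ?thesis by simp
qed

section \<open>The derivations attached to a function and to a one-form\<close>

lemma ad0_exists:
  assumes f: "p < 2" "f \<in> Apar G p"
  shows "\<exists>D. der (-1) (int p) D \<and> (\<forall>q g. q < 2 \<longrightarrow> g \<in> Apar G q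
      \<longrightarrow> D (i0 g) = 0)
    \<and> (\<forall>q \<alpha>. q < 2 \<longrightarrow> \<alpha> \<in> O1par G q \<longrightarrow> D (i1
        \<alpha>) = - (sgni (int p * int q) *\<^sub>R i0 (\<rho> \<alpha> f)))"
proof (rule der_exists[of "\<lambda>_ _. 0" "\<lambda>q \<alpha>. - (sgni (int p * int q) *\<^sub>R i0 (\<rho>
    \<alpha> f))"])
  fix q \<alpha> assume a: "q < 2" "\<alpha> \<in> O1par G q"
  show "- (sgni (int p * int q) *\<^sub>R i0 (\<rho> \<alpha> f)) \<in> S (1 + - 1) (int q + int p)"
    using i0_S[OF _ rho_Apar[OF a f], of "int q + int p"] by (simp add: S_neg S_scale of_nat_mod)
  show "- (sgni (int p * int q) *\<^sub>R i0 (\<rho> (\<alpha> + \<beta>) f)) =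
      - (sgni (int p * int q) *\<^sub>R i0 (\<rho> \<alpha> f)) + - (sgni (int p * int q) *\<^sub>R i0 (\<rho>
          \<beta> f))"
    if "\<beta> \<in> O1par G q" for \<beta>
    using rho_lincomb[of \<alpha> \<beta> 1 f] a that by (simp add: O1par_Omega1 scaleR_add_right)
  fix q' g assume g: "q' < 2" "g \<in> Apar G q'"
  \<comment> \<open>With value 0 on functions, the module rule asks for linearity over the algebra,
    which the anchor provides.\<close>
  have "i0 (\<rho> (lact g \<alpha>) f) = i0 g * i0 (\<rho> \<alpha> f)"
    using rho_lact[of \<alpha> g f] i0_mult[OF g(1) _ g(2) rho_Apar[OF a f]] a by (simp add: O1par_Omega1)
  moreover have "sgni (int p * int ((q' + q) mod 2)) = sgni (int p * int q') * sgni (int p * int q)"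
    by (auto simp: sgni_def of_nat_mod)
  ultimately show "- (sgni (int p * int ((q' + q) mod 2)) *\<^sub>R i0 (\<rho> (lact g \<alpha>) f)) =
      0 * i1 \<alpha> + sgni (int p * int q') *\<^sub>R (i0 g * - (sgni (int p * int q) *\<^sub>R i0 (\<rho>
          \<alpha> f)))"
    by simp
qed auto

text \<open>The derivation \<open>[f, _]\<close>. A one-form has shifted degree 0, so antisymmetry
  forces \<open>[f, \<alpha>]\<close> to be \<open>-(-1)^(p q) \<rho>(\<alpha>)(f)\<close>.\<close>

definition ad0 :: "nat \<Rightarrow> 'a \<Rightarrow> 'a form endo \<Rightarrow> 'a form endo" where
  "ad0 p f = (SOME D. der (-1) (int p) D \<and> (\<forall>q g. q < 2 \<longrightarrow> g \<in> Apar G q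
      \<longrightarrow> D (i0 g) = 0)
    \<and> (\<forall>q \<alpha>. q < 2 \<longrightarrow> \<alpha> \<in> O1par G q \<longrightarrow> D (i1
        \<alpha>) = - (sgni (int p * int q) *\<^sub>R i0 (\<rho> \<alpha> f))))"

lemma ad0:
  assumes "p < 2" "f \<in> Apar G p"
  shows ad0_der: "der (-1) (int p) (ad0 p f)"
    and ad0_i0: "q < 2 \<Longrightarrow> g \<in> Apar G q \<Longrightarrow> ad0 p f (i0 g) = 0"
    and ad0_i1: "q < 2 \<Longrightarrow> \<alpha> \<in> O1par G q \<Longrightarrow> ad0 p f (i1 \<alpha>) = -
        (sgni (int p * int q) *\<^sub>R i0 (\<rho> \<alpha> f))"
  using someI_ex[OF ad0_exists[OF assms], folded ad0_def] by blast+

text \<open>The product rule on functions is the derivation property of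
  \<open>\<rho> \<alpha>\<close>, and the module rule on one-forms is the Leibniz rule of the
  algebroid.\<close>

lemma ad1_exists:
  assumes a: "p < 2" "\<alpha> \<in> O1par G p"
  shows "\<exists>D. der 0 (int p) D \<and> (\<forall>q g. q < 2 \<longrightarrow> g \<in> Apar G q
      \<longrightarrow> D (i0 g) = i0 (\<rho> \<alpha> g))
    \<and> (\<forall>q \<beta>. q < 2 \<longrightarrow> \<beta> \<in> O1par G q \<longrightarrow> D (i1
        \<beta>) = i1 (brk \<alpha> \<beta>))"
proof (rule der_exists[of "\<lambda>_ g. i0 (\<rho> \<alpha> g)" "\<lambda>_ \<beta>. i1 (brk \<alpha> \<beta>)"])
  note O = O1par_Omega1[OF a(2)]
  fix q f assume f: "q < 2" "f \<in> Apar G q"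
  show "i0 (\<rho> \<alpha> f) \<in> S 0 (int q + int p)"
    by (rule i0_S[OF _ rho_Apar[OF a f]]) (auto simp: of_nat_mod)
  show "i0 (\<rho> \<alpha> (c *\<^sub>R f + g)) = c *\<^sub>R i0 (\<rho> \<alpha> f) + i0 (\<rho> \<alpha> g)"
      for c g
    by (simp add: linear_add[OF rho_linear[OF a]] linear_scale[OF rho_linear[OF a]])
  show "i0 (\<rho> \<alpha> (f * g)) = i0 (\<rho> \<alpha> f) * i0 g + sgni (int p * int q) *\<^sub>R (i0 f *
      i0 (\<rho> \<alpha> g))"
    if g: "q' < 2" "g \<in> Apar G q'" for q' g
    using i0_mult[OF _ g(1) rho_Apar[OF a f] g(2)] i0_mult[OF f(1) _ f(2) rho_Apar[OF a g]]
    by (simp add: rho_mult[OF a f])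
  fix q' \<beta> assume b: "q' < 2" "\<beta> \<in> O1par G q'"
  note O' = O1par_Omega1[OF b(2)]
  show "i1 (brk \<alpha> (lact f \<beta>)) = i0 (\<rho> \<alpha> f) * i1 \<beta> + sgni (int p * int q)
      *\<^sub>R (i0 f * i1 (brk \<alpha> \<beta>))"
    using i1_lact[OF _ b(1) rho_Apar[OF a f] b(2)] i1_lact[OF f(1) _ f(2) brk_O1par[OF a(1) b(1) a(2) b(2)]]
    by (simp add: brk_leibniz[OF a(1) f(1) a(2) f(2) O'] i1_add i1_scale lact_Omega1 O O' brk_Omega1
        Omega1_scale)
next
  note O = O1par_Omega1[OF a(2)]
  fix q \<beta> assume b: "q < 2" "\<beta> \<in> O1par G q"
  show "i1 (brk \<alpha> \<beta>) \<in> S (1 + 0) (int q + int p)"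
    unfolding add_0_right by (rule i1_S[OF _ brk_O1par[OF a(1) b(1) a(2) b(2)]]) (auto simp: of_nat_mod)
  show "i1 (brk \<alpha> (\<beta> + \<gamma>)) = i1 (brk \<alpha> \<beta>) + i1 (brk \<alpha> \<gamma>)" if c:
      "\<gamma> \<in> O1par G q" for \<gamma>
    using brk_lincomb_right[OF O O1par_Omega1[OF b(2)] O1par_Omega1[OF c], of 1]
    by (simp add: i1_add brk_Omega1 O O1par_Omega1[OF b(2)] O1par_Omega1[OF c])
qed

definition ad1 :: "nat \<Rightarrow> 'a tens \<Rightarrow> 'a form endo \<Rightarrow> 'a form endo" where
  "ad1 p \<alpha> = (SOME D. der 0 (int p) D \<and> (\<forall>q g. q < 2 \<longrightarrow> g \<in> Apar G q
      \<longrightarrow> D (i0 g) = i0 (\<rho> \<alpha> g))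
    \<and> (\<forall>q \<beta>. q < 2 \<longrightarrow> \<beta> \<in> O1par G q \<longrightarrow> D (i1
        \<beta>) = i1 (brk \<alpha> \<beta>)))"

lemma ad1:
  assumes "p < 2" "\<alpha> \<in> O1par G p"
  shows ad1_der: "der 0 (int p) (ad1 p \<alpha>)"
    and ad1_i0: "q < 2 \<Longrightarrow> g \<in> Apar G q \<Longrightarrow> ad1 p \<alpha> (i0 g) = i0 (\<rho>
        \<alpha> g)"
    and ad1_i1: "q < 2 \<Longrightarrow> \<beta> \<in> O1par G q \<Longrightarrow> ad1 p \<alpha> (i1 \<beta>)
        = i1 (brk \<alpha> \<beta>)"
  using someI_ex[OF ad1_exists[OF assms], folded ad1_def] by blast+

section \<open>Dependence of these derivations on the generator\<close>

lemma ad0_lincomb: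
  assumes "p < 2" "f \<in> Apar G p" "g \<in> Apar G p" "x \<in> T"
  shows "ad0 p (c *\<^sub>R f + g) x = c *\<^sub>R ad0 p f x + ad0 p g x"
proof -
  have fg: "c *\<^sub>R f + g \<in> Apar G p" using assms by (simp add: Apar_add Apar_scaleR)
  show ?thesis
    by (rule der_eqI[OF ad0_der[OF assms(1) fg] der_lincomb[OF ad0_der[OF assms(1,2)] ad0_der[OF assms(1,3)]]])
       (use assms fg in \<open>auto simp: ad0_i0 ad0_i1 linear_add[OF rho_linear] linear_scale[OF rho_linear]
           algebra_simps\<close>)
qed

text \<open>Both sides are derivations in \<open>x\<close> of the same bidegree; they vanish on
  functions, and on one-forms the anchor contributes its derivation property. Later this becomes the
  product rule for the values of \<open>[X, _]\<close> on functions.\<close>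

lemma ad0_mult:
  assumes "p < 2" "q < 2" "f \<in> Apar G p" "g \<in> Apar G q" "x \<in> T"
  shows "ad0 ((p + q) mod 2) (f * g) x = i0 f * ad0 q g x + sgni (int p * int q) *\<^sub>R (i0 g * ad0 p f x)"
proof -
  have fg: "(p + q) mod 2 < 2" "f * g \<in> Apar G ((p + q) mod 2)" using assms by (simp_all add: Apar_mult)
  have 1: "der (-1) (int q + int p) (ad0 ((p + q) mod 2) (f * g))"
    by (rule der_cong[OF ad0_der[OF fg]]) (auto simp: of_nat_mod)
  have 2: "der (-1) (int q + int p) (\<lambda>x. sgni (int p * int q) *\<^sub>R (i0 g * ad0 p f x) + i0 f * ad0
      q g x)"
    by (intro der_lincomb der_cong[OF der_left_mult[OF ad0_der[OF assms(1,3)] i0_S[OF assms(2,4), of "int q"]]]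
        der_cong[OF der_left_mult[OF ad0_der[OF assms(2,4)] i0_S[OF assms(1,3), of "int p"]]]) auto
  have "ad0 ((p + q) mod 2) (f * g) x = sgni (int p * int q) *\<^sub>R (i0 g * ad0 p f x) + i0 f * ad0 q g x"
  proof (rule der_eqI[OF 1 2 _ _ assms(5)])
    fix s \<alpha> assume a: "s < 2" "\<alpha> \<in> O1par G s"
    have r: "i0 (\<rho> \<alpha> (f * g)) = i0 (\<rho> \<alpha> f) * i0 g + sgni (int s * int p) *\<^sub>R (i0
        f * i0 (\<rho> \<alpha> g))"
      using i0_mult[OF _ assms(2) rho_Apar[OF a assms(1,3)] assms(4)]
        i0_mult[OF assms(1) _ assms(3) rho_Apar[OF a assms(2,4)]]
      by (simp add: rho_mult[OF a assms(1,3)])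
    have "i0 (\<rho> \<alpha> f) * i0 g = sgni (int ((s + p) mod 2) * int q) *\<^sub>R (i0 g * i0 (\<rho>
        \<alpha> f))"
      by (rule i0_i0_commute[OF _ assms(2) rho_Apar[OF a assms(1,3)] assms(4)]) simp
    also have "sgni (int ((s + p) mod 2) * int q) = sgni (int s * int q) * sgni (int p * int q)"
      by (auto simp: sgni_def of_nat_mod)
    finally have c: "i0 (\<rho> \<alpha> f) * i0 g = (sgni (int s * int q) * sgni (int p * int q)) *\<^sub>R
        (i0 g * i0 (\<rho> \<alpha> f))" .
    have sg: "sgni (int ((p + q) mod 2) * int s) = sgni (int s * int p) * sgni (int s * int q)"
      "sgni (int p * int s) = sgni (int s * int p)" "sgni (int q * int s) = sgni (int s * int q)"
      by (auto simp: sgni_def of_nat_mod)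
    show "ad0 ((p + q) mod 2) (f * g) (i1 \<alpha>) = sgni (int p * int q) *\<^sub>R (i0 g * ad0 p f (i1
        \<alpha>)) + i0 f * ad0 q g (i1 \<alpha>)"
      unfolding ad0_i1[OF fg a] ad0_i1[OF assms(1,3) a] ad0_i1[OF assms(2,4) a] r c sg
      by (simp add: scaleR_add_right mult_ac)
  qed (use assms fg in \<open>auto simp: ad0_i0\<close>)
  then show ?thesis by (simp add: add.commute)
qed

lemma ad1_add:
  assumes "p < 2" "\<alpha> \<in> O1par G p" "\<beta> \<in> O1par G p" "x \<in> T"
  shows "ad1 p (\<alpha> + \<beta>) x = ad1 p \<alpha> x + ad1 p \<beta> x"
proof -
  have ab: "\<alpha> + \<beta> \<in> O1par G p" using assms by (simp add: O1par_add)
  note O = O1par_Omega1[OF assms(2)] O1par_Omega1[OF assms(3)]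
  have "ad1 p (\<alpha> + \<beta>) x = 1 *\<^sub>R ad1 p \<alpha> x + ad1 p \<beta> x"
    by (rule der_eqI[OF ad1_der[OF assms(1) ab] der_lincomb[OF ad1_der[OF assms(1,2)] ad1_der[OF assms(1,3)]] _
        _ assms(4)])
       (use assms(1-3) ab O rho_lincomb[OF O, of 1] brk_lincomb_left[OF O, of _ 1] in
         \<open>auto simp: ad1_i0 ad1_i1 O1par_Omega1 i1_add brk_Omega1\<close>)
  then show ?thesis by simp
qed

text \<open>On functions this is linearity of the anchor. On one-forms the bracket is flipped by
  antisymmetry, expanded by the Leibniz rule in its second slot, and flipped back.\<close>

lemma ad1_lact:
  assumes f: "p < 2" "f \<in> Apar G p" and a: "q < 2" "\<alpha> \<in> O1par G q" and x: "x \<in> T"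
  shows "ad1 ((p + q) mod 2) (lact f \<alpha>) x = i0 f * ad1 q \<alpha> x + sgni (int p * int q) *\<^sub>R (i1
      \<alpha> * ad0 p f x)"
proof -
  have fa: "(p + q) mod 2 < 2" "lact f \<alpha> \<in> O1par G ((p + q) mod 2)" using f a by (simp_all add: lact_O1par)
  have 1: "der 0 (int q + int p) (ad1 ((p + q) mod 2) (lact f \<alpha>))"
    by (rule der_cong[OF ad1_der[OF fa]]) (auto simp: of_nat_mod)
  have 2: "der 0 (int q + int p) (\<lambda>x. sgni (int p * int q) *\<^sub>R (i1 \<alpha> * ad0 p f x) + i0 f *
      ad1 q \<alpha> x)"
    by (intro der_lincomb der_cong[OF der_left_mult[OF ad0_der[OF f] i1_S[OF a, of "int q"]]]
        der_cong[OF der_left_mult[OF ad1_der[OF a] i0_S[OF f, of "int p"]]]) auto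
  have "ad1 ((p + q) mod 2) (lact f \<alpha>) x = sgni (int p * int q) *\<^sub>R (i1 \<alpha> * ad0 p f x) + i0
      f * ad1 q \<alpha> x"
  proof (rule der_eqI[OF 1 2 _ _ x])
    fix s g assume g: "s < 2" "g \<in> Apar G s"
    show "ad1 ((p + q) mod 2) (lact f \<alpha>) (i0 g) = sgni (int p * int q) *\<^sub>R (i1 \<alpha> * ad0 p f
        (i0 g)) + i0 f * ad1 q \<alpha> (i0 g)"
      using i0_mult[OF f(1) _ f(2) rho_Apar[OF a g]]
      by (simp add: ad1_i0[OF fa g] ad1_i0[OF a g] ad0_i0[OF f g] rho_lact O1par_Omega1[OF a(2)])
  next
    fix s \<beta> assume b: "s < 2" "\<beta> \<in> O1par G s"
    note O = O1par_Omega1[OF a(2)] O1par_Omega1[OF b(2)]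
    have "brk (lact f \<alpha>) \<beta> = - (sgni (int ((p + q) mod 2) * int s) *\<^sub>R brk \<beta> (lact f
        \<alpha>))"
      by (rule brk_anti[OF fa(1) b(1) fa(2) b(2)])
    also have "brk \<beta> (lact f \<alpha>) = lact (\<rho> \<beta> f) \<alpha> + sgni (int s * int p)
        *\<^sub>R lact f (brk \<beta> \<alpha>)"
      by (rule brk_leibniz[OF b(1) f(1) b(2) f(2) O(1)])
    also have "brk \<beta> \<alpha> = - (sgni (int s * int q) *\<^sub>R brk \<alpha> \<beta>)"
      by (rule brk_anti[OF b(1) a(1) b(2) a(2)])
    finally have "brk (lact f \<alpha>) \<beta> = (- sgni (int ((p + q) mod 2) * int s)) *\<^sub>R lact (\<rho>
        \<beta> f) \<alpha>
        + (sgni (int ((p + q) mod 2) * int s) * sgni (int s * int p) * sgni (int s * int q)) *\<^sub>R lact f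
            (brk \<alpha> \<beta>)"
      by (simp add: linear_neg[OF linear_lact] scaleR_diff_right)
    moreover have "sgni (int ((p + q) mod 2) * int s) * sgni (int s * int p) * sgni (int s * int q) = 1"
      by (auto simp: sgni_def of_nat_mod)
    ultimately have "brk (lact f \<alpha>) \<beta> = (- sgni (int ((p + q) mod 2) * int s)) *\<^sub>R lact
        (\<rho> \<beta> f) \<alpha> + lact f (brk \<alpha> \<beta>)"
      by simp
    then have l: "i1 (brk (lact f \<alpha>) \<beta>) = (- sgni (int ((p + q) mod 2) * int s)) *\<^sub>R (i0
        (\<rho> \<beta> f) * i1 \<alpha>) + i0 f * i1 (brk \<alpha> \<beta>)"
      using i1_lincomb[of "lact (\<rho> \<beta> f) \<alpha>" "lact f (brk \<alpha> \<beta>)" "- sgni (int ((p +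
          q) mod 2) * int s)"]
        i1_lact[OF _ a(1) rho_Apar[OF b f] a(2)] i1_lact[OF f(1) _ f(2) brk_O1par[OF a(1) b(1) a(2) b(2)]]
      by (simp add: lact_Omega1 O brk_Omega1)
    have "i1 \<alpha> * i0 (\<rho> \<beta> f) = sgni (int ((s + p) mod 2) * int q) *\<^sub>R (i0 (\<rho>
        \<beta> f) * i1 \<alpha>)"
      by (rule i1_i0_commute[OF _ a(1) rho_Apar[OF b f] a(2)]) simp
    moreover have "sgni (int p * int q) * (sgni (int p * int s) * sgni (int ((s + p) mod 2) * int q)) = sgni
        (int ((p + q) mod 2) * int s)"
      by (auto simp: sgni_def of_nat_mod)
    ultimately show "ad1 ((p + q) mod 2) (lact f \<alpha>) (i1 \<beta>) = sgni (int p * int q) *\<^sub>R (i1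
        \<alpha> * ad0 p f (i1 \<beta>)) + i0 f * ad1 q \<alpha> (i1 \<beta>)"
      unfolding ad1_i1[OF fa b] ad1_i1[OF a b] ad0_i1[OF f b] l by simp
  qed
  then show ?thesis by (simp add: add.commute)
qed

text \<open>Characterises \<open>[X, _]\<close> for \<open>X\<close> of degree \<open>r\<close> and
  parity \<open>p\<close> by turning \<open>[f, X]\<close> and \<open>[\<alpha>, X]\<close> around.
  The degree part \<open>(r - 1) * (deg - 1)\<close> of the sign is congruent to
  \<open>r - 1\<close> against a function and 0 against a one-form.\<close>

definition adjoint_like :: "int \<Rightarrow> int \<Rightarrow> 'a form endo \<Rightarrow> ('a form endo
    \<Rightarrow> 'a form endo) \<Rightarrow> bool" where
  "adjoint_like r p X D \<longleftrightarrow> der (r - 1) p D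
    \<and> (\<forall>q f. q < 2 \<longrightarrow> f \<in> Apar G q \<longrightarrow> D (i0 f) = - (sgni (r - 1
        + p * int q) *\<^sub>R ad0 q f X))
    \<and> (\<forall>q \<alpha>. q < 2 \<longrightarrow> \<alpha> \<in> O1par G q \<longrightarrow> D (i1
        \<alpha>) = - (sgni (p * int q) *\<^sub>R ad1 q \<alpha> X))"

text \<open>The product and module rules for the prescribed values are \<open>ad0_mult\<close> and
  \<open>ad1_lact\<close> read at \<open>X\<close>; the signs agree after moving
  \<open>ad0 q f X\<close> across a generator.\<close>

lemma ad_exists:
  assumes X: "X \<in> S r p"
  shows "\<exists>D. adjoint_like r p X D"
  unfolding adjoint_like_def
proof (rule der_exists[of "\<lambda>q f. - (sgni (r - 1 + p * int q) *\<^sub>R ad0 q f X)" "\<lambda>q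
    \<alpha>. - (sgni (p * int q) *\<^sub>R ad1 q \<alpha> X)"])
  note XT = S_T[OF X]
  fix q f assume f: "q < 2" "f \<in> Apar G q"
  show "- (sgni (r - 1 + p * int q) *\<^sub>R ad0 q f X) \<in> S (r - 1) (int q + p)"
    using der_S[OF ad0_der[OF f] X] by (simp add: S_neg S_scale add.commute)
  show "- (sgni (r - 1 + p * int q) *\<^sub>R ad0 q (c *\<^sub>R f + g) X) =
      c *\<^sub>R - (sgni (r - 1 + p * int q) *\<^sub>R ad0 q f X) + - (sgni (r - 1 + p * int q) *\<^sub>R ad0 q g X)"
    if "g \<in> Apar G q" for c g
    using f that by (simp add: ad0_lincomb XT scaleR_add_right mult.commute)
  show "- (sgni (r - 1 + p * int ((q + q') mod 2)) *\<^sub>R ad0 ((q + q') mod 2) (f * g) X) =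
      - (sgni (r - 1 + p * int q) *\<^sub>R ad0 q f X) * i0 g
      + sgni (p * int q) *\<^sub>R (i0 f * - (sgni (r - 1 + p * int q') *\<^sub>R ad0 q' g X))"
    if g: "q' < 2" "g \<in> Apar G q'" for q' g
  proof -
    have c: "ad0 q f X * i0 g = sgni ((p + int q) * int q') *\<^sub>R (i0 g * ad0 q f X)"
      using S_i0_commute[OF der_S[OF ad0_der[OF f] X] g] by simp
    have sg: "sgni (r - 1 + p * int ((q + q') mod 2)) = sgni (p * int q) * sgni (r - 1 + p * int q')"
      "sgni (p * int q) * sgni (r - 1 + p * int q') * sgni (int q * int q') = sgni (r - 1 + p * int q) * sgni
          ((p + int q) * int q')"
      by (auto simp: sgni_def of_nat_mod)
    show ?thesis
      unfolding ad0_mult[OF f(1) g(1) f(2) g(2) XT] sg(1) scaleR_add_right scaleR_scaleR sg(2) by (simp add: c)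
  qed
  fix q' \<alpha> assume a: "q' < 2" "\<alpha> \<in> O1par G q'"
  have c: "ad0 q f X * i1 \<alpha> = sgni (r - 1 + (p + int q) * int q') *\<^sub>R (i1 \<alpha> * ad0 q f X)"
    using S_i1_commute[OF der_S[OF ad0_der[OF f] X] a] by simp
  have sg: "sgni (p * int ((q + q') mod 2)) = sgni (p * int q) * sgni (p * int q')"
    "sgni (p * int q) * sgni (p * int q') * sgni (int q * int q') = sgni (r - 1 + p * int q) * sgni (r - 1 + (p
        + int q) * int q')"
    by (auto simp: sgni_def of_nat_mod)
  show "- (sgni (p * int ((q + q') mod 2)) *\<^sub>R ad1 ((q + q') mod 2) (lact f \<alpha>) X) =
      - (sgni (r - 1 + p * int q) *\<^sub>R ad0 q f X) * i1 \<alpha>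
      + sgni (p * int q) *\<^sub>R (i0 f * - (sgni (p * int q') *\<^sub>R ad1 q' \<alpha> X))"
    unfolding ad1_lact[OF f a XT] sg(1) scaleR_add_right scaleR_scaleR sg(2) by (simp add: c)
next
  fix q \<alpha> assume a: "q < 2" "\<alpha> \<in> O1par G q"
  show "- (sgni (p * int q) *\<^sub>R ad1 q \<alpha> X) \<in> S (1 + (r - 1)) (int q + p)"
    using der_S[OF ad1_der[OF a] X] by (simp add: S_neg S_scale add.commute)
  show "- (sgni (p * int q) *\<^sub>R ad1 q (\<alpha> + \<beta>) X) =
      - (sgni (p * int q) *\<^sub>R ad1 q \<alpha> X) + - (sgni (p * int q) *\<^sub>R ad1 q \<beta> X)" if
          "\<beta> \<in> O1par G q" for \<beta>
    using a that by (simp add: ad1_add S_T[OF X] scaleR_add_right)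
qed

section \<open>The bracket with an arbitrary form\<close>

definition ad_word :: "'a word \<Rightarrow> 'a form endo \<Rightarrow> 'a form endo" where
  "ad_word w = (SOME D. adjoint_like (int (wdeg w)) (int (wpar w)) (lmul w) D)"

text \<open>Choosing on words and extending linearly makes the bracket linear in its first argument
  and covers inhomogeneous forms, although a single choice is determined on \<open>T\<close>
  only.\<close>

definition ad_form :: "'a form \<Rightarrow> 'a form endo \<Rightarrow> 'a form endo" where
  "ad_form = lext ad_word"

lemma ad_form_lext:
  "ad_form (x + y) = (\<lambda>z. ad_form x z + ad_form y z)" "ad_form (c *\<^sub>R x) = (\<lambda>z. c
      *\<^sub>R ad_form x z)" "ad_form 0 = (\<lambda>z. 0)"
  "ad_form (- x) = (\<lambda>z. - ad_form x z)" "ad_form (x - y) = (\<lambda>z. ad_form x z - ad_form y z)"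
  by (rule ext, simp add: ad_form_def plus_fun_apply zero_fun_apply minus_apply uminus_apply scaleR_fun_apply)+

lemma adjoint_like_ad_word:
  assumes w: "w \<in> hom_words r p" shows "adjoint_like r p (lmul w) (ad_word w)"
proof -
  have "w \<in> hom_words (int (wdeg w)) (int (wpar w))" using w by (simp add: hom_words_def)
  then have "lmul w \<in> S (int (wdeg w)) (int (wpar w))" unfolding S_def by (intro span_base) simp
  note * = someI_ex[OF ad_exists[OF this], folded ad_word_def]
  have r: "int (wdeg w) = r" and ev: "even (int (wpar w) - p)" using w by (auto simp: hom_words_def)
  have "sgni (k + int (wpar w) * l) = sgni (k + p * l)" for k l
    using ev by (intro sgni_cong) (simp flip: left_diff_distrib)
  from this this[of 0] show ?thesis
    using * der_cong[OF _ refl ev] unfolding adjoint_like_def r by (simp add: r)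
qed

lemma adjoint_like_subspace:
  assumes "adjoint_like r p X D" "adjoint_like r p Y E"
  shows "adjoint_like r p (X + Y) (D + E)" "adjoint_like r p (c *\<^sub>R X) (c *\<^sub>R D)" "adjoint_like r p 0 0"
  using assms der_lincomb[of "r - 1" p D E 1] der_scale[of "r - 1" p D c] der_zero[of "r - 1" p]
  unfolding adjoint_like_def
  by (auto simp: plus_fun_def scaleR_fun_def zero_fun_def linear_add[OF der_linear[OF ad0_der]] linear_add[OF
      der_linear[OF ad1_der]]
      linear_scale[OF der_linear[OF ad0_der]] linear_scale[OF der_linear[OF ad1_der]]
      linear_0[OF der_linear[OF ad0_der]] linear_0[OF der_linear[OF ad1_der]] scaleR_add_right mult.commute)

lemma adjoint_like_ad_form:
  assumes "x \<in> span (wd ` hom_words r p)" shows "adjoint_like r p (\<Phi> x) (ad_form x)"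
  using assms
proof (induct rule: span_induct_cases)
  case subspace
  have z: "adjoint_like r p 0 0"
    using der_zero[of "r - 1" p] unfolding adjoint_like_def
    by (auto simp: zero_fun_def linear_0[OF der_linear[OF ad0_der]] linear_0[OF der_linear[OF ad1_der]])
  show ?case
    by (rule subspace_pointwise_linear) (auto simp: ad_form_def intro: adjoint_like_subspace z)
next
  case (base b)
  then show ?case using adjoint_like_ad_word by (auto simp: ad_form_def \<Phi>_wd)
qed

lemma adjoint_like_unique:
  assumes "adjoint_like r p X D" "adjoint_like r p X E" "y \<in> T"
  shows "D y = E y"
  by (rule der_eqI[of "r - 1" p D E]) (use assms in \<open>auto simp: adjoint_like_def\<close>)

text \<open>A relator is homogeneous and represents 0, so its map is adjoint-like for 0. So is the
  zero map, and adjoint-like maps for the same element agree on \<open>T\<close>.\<close>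

lemma AD_Rid:
  assumes "x \<in> Rid G" "y \<in> T" shows "ad_form x y = 0"
proof -
  have sub: "subspace {x. ad_form x y = 0}"
    by (rule subspace_pointwise_linear) (auto simp: ad_form_lext)
  from assms(1) show ?thesis unfolding Rid_def
  proof (induct rule: span_induct_cases)
    case (base b)
    obtain r d where "b \<in> span (wd ` hwords G r d)" using Relators_homogeneous[OF base] by blast
    moreover have "hwords G r d \<subseteq> hom_words (int r) (int d)" by (auto simp: hwords_def hom_words_def)
    ultimately have "b \<in> span (wd ` hom_words (int r) (int d))" using span_mono[OF image_mono] by blast
    note b = adjoint_like_ad_form[OF this]
    have "\<Phi> b = 0" using \<Phi>_Rid[of b] span_base[OF base] by (simp add: Rid_def)
    from adjoint_like_unique[OF b[unfolded this] adjoint_like_subspace(2)[OF b b, of 0, simplified, unfolded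
        this] assms(2)]
    show ?case by (simp add: fun_apply)
  qed (rule sub)
qed

lemma linear_ad_word: "valid_word G w \<Longrightarrow> linear (ad_word w)"
  using adjoint_like_ad_word[of w "int (wdeg w)" "int (wpar w)"]
  by (auto simp: adjoint_like_def hom_words_def intro: der_linear)

lemma linear_ad_form:
  assumes "x \<in> Om G" shows "linear (ad_form x)"
  using assms unfolding Om_def
proof (induct rule: span_induct_cases)
  case subspace
  show ?case
    by (rule subspace_pointwise_linear)
       (auto simp: ad_form_lext linear_compose_add linear_compose_scale_right linear_zero)
next
  case (base b)
  then show ?case by (auto simp: ad_form_def linear_ad_word simp del: valid_word_simp)
qed

section \<open>The bracket on classes\<close>

definition B :: "'a form endo \<Rightarrow> 'a form endo \<Rightarrow> 'a form endo" where
  "B X = ad_form (sec X)"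

lemma B_linear_right: "linear (B X)"
  unfolding B_def by (rule linear_ad_form[OF sec(2)])

lemma B_left: "B (X + Y) Z = B X Z + B Y Z" "B (c *\<^sub>R X) Z = c *\<^sub>R B X Z" "B 0 Z = 0" "B (- X) Z =
    - B X Z"
  by (simp_all add: B_def ad_form_lext linear_add[OF sec(1)] linear_scale[OF sec(1)] linear_0[OF sec(1)]
      linear_neg[OF sec(1)])

lemmas B_right = linear_add[OF B_linear_right] linear_scale[OF B_linear_right] linear_0[OF B_linear_right]
  linear_neg[OF B_linear_right]

text \<open>\<open>sec X\<close> and a homogeneous representative of \<open>X\<close> differ by a
  relation, whose bracket vanishes on \<open>T\<close>; so \<open>B X\<close> inherits the
  properties of the latter.\<close>

lemma B_adjoint_like:
  assumes "X \<in> S r p" shows "adjoint_like r p X (B X)"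
proof -
  obtain x where x: "x \<in> span (wd ` hom_words r p)" "X = \<Phi> x" using assms by (auto simp: S_eq)
  note xO = hw_Om[OF x(1)]
  have eq: "B X y = ad_form x y" if "y \<in> T" for y
    using AD_Rid[OF sec_\<Phi>[OF xO] that] by (simp add: B_def x(2) ad_form_lext)
  note ad = adjoint_like_ad_form[OF x(1), folded x(2)]
  have "der (r - 1) p (B X)"
    using ad B_linear_right unfolding adjoint_like_def der_def by (auto simp: eq S_T T_mult)
  moreover have "i0 f \<in> T" if "q < 2" "f \<in> Apar G q" for q f using i0_S[OF that, of "int q"] S_T by simp
  moreover have "i1 f \<in> T" if "q < 2" "f \<in> O1par G q" for q f using i1_S[OF that, of "int q"] S_T by simp
  ultimately show ?thesis using ad unfolding adjoint_like_def by (auto simp: eq)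
qed

lemma B_der: "X \<in> S r p \<Longrightarrow> der (r - 1) p (B X)"
  using B_adjoint_like by (simp add: adjoint_like_def)

lemma B_S: "X \<in> S r p \<Longrightarrow> Y \<in> S s q \<Longrightarrow> B X Y \<in> S (r + s - 1) (p + q)"
  using der_S[OF B_der] by (force simp: algebra_simps)

lemma B_mult: "X \<in> S r p \<Longrightarrow> Y \<in> S s q \<Longrightarrow> Z \<in> T \<Longrightarrow>
    B X (Y * Z) = B X Y * Z + sgni ((r - 1) * s + p * q) *\<^sub>R (Y * B X Z)"
  by (rule der_mult[OF B_der])

section \<open>Generators, antisymmetry, and the Leibniz rule in the first argument\<close>

definition gen :: "int \<Rightarrow> int \<Rightarrow> 'a form endo \<Rightarrow> bool" where
  "gen t u z \<longleftrightarrow> (\<exists>q f. q < 2 \<and> f \<in> Apar G q \<and> z = i0 f \<and> t = 0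
      \<and> u = int q)
    \<or> (\<exists>q \<alpha>. q < 2 \<and> \<alpha> \<in> O1par G q \<and> z = i1 \<alpha> \<and> t = 1
        \<and> u = int q)"

lemma gen_i0: "q < 2 \<Longrightarrow> f \<in> Apar G q \<Longrightarrow> gen 0 (int q) (i0 f)"
  and gen_i1: "q < 2 \<Longrightarrow> \<alpha> \<in> O1par G q \<Longrightarrow> gen 1 (int q) (i1 \<alpha>)"
  by (auto simp: gen_def)

lemma gen_S: "gen t u z \<Longrightarrow> z \<in> S t u"
  by (auto simp: gen_def i0_S i1_S)

lemma der_eqI_gen:
  assumes "der k d D" "der k d E" "\<And>t u z. gen t u z \<Longrightarrow> D z = E z" "x \<in> T"
  shows "D x = E x"
  by (rule der_eqI[OF assms(1,2)]) (use assms(3,4) gen_i0 gen_i1 in blast)+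

text \<open>Consistency with the starting data: the values that antisymmetry prescribes for
  \<open>B (i0 f)\<close> are those of \<open>ad0 p f\<close> on generators.\<close>

lemma B_i0_eq:
  assumes f: "p < 2" "f \<in> Apar G p" and y: "y \<in> T"
  shows "B (i0 f) y = ad0 p f y"
proof (rule der_eqI[OF _ ad0_der[OF f] _ _ y])
  have ad: "adjoint_like 0 (int p) (i0 f) (B (i0 f))" by (rule B_adjoint_like[OF i0_S[OF f]]) simp
  then show "der (-1) (int p) (B (i0 f))" by (simp add: adjoint_like_def)
  show "B (i0 f) (i0 g) = ad0 p f (i0 g)" if "q < 2" "g \<in> Apar G q" for q g
    using ad that f by (simp add: adjoint_like_def ad0_i0)
  show "B (i0 f) (i1 \<alpha>) = ad0 p f (i1 \<alpha>)" if "q < 2" "\<alpha> \<in> O1par G q" for q \<alpha>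
    using ad that f by (simp add: adjoint_like_def ad0_i1 ad1_i0)
qed

text \<open>Here consistency on one-forms is the antisymmetry of \<open>brk\<close>.\<close>

lemma B_i1_eq:
  assumes a: "p < 2" "\<alpha> \<in> O1par G p" and y: "y \<in> T"
  shows "B (i1 \<alpha>) y = ad1 p \<alpha> y"
proof (rule der_eqI[OF _ ad1_der[OF a] _ _ y])
  have ad: "adjoint_like 1 (int p) (i1 \<alpha>) (B (i1 \<alpha>))" by (rule B_adjoint_like[OF i1_S[OF a]]) simp
  then show "der 0 (int p) (B (i1 \<alpha>))" by (simp add: adjoint_like_def)
  show "B (i1 \<alpha>) (i0 g) = ad1 p \<alpha> (i0 g)" if "q < 2" "g \<in> Apar G q" for q g
    using ad that a by (simp add: adjoint_like_def ad0_i1 ad1_i0 mult.commute)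
  show "B (i1 \<alpha>) (i1 \<beta>) = ad1 p \<alpha> (i1 \<beta>)" if b: "q < 2" "\<beta> \<in> O1par G q" for
      q \<beta>
  proof -
    have "i1 (brk \<alpha> \<beta>) = (- sgni (int p * int q)) *\<^sub>R i1 (brk \<beta> \<alpha>)"
      using brk_anti[OF a(1) b(1) a(2) b(2)] i1_scale[OF brk_Omega1[OF O1par_Omega1[OF b(2)] O1par_Omega1[OF
          a(2)]], of "- sgni (int p * int q)"]
      by simp
    then show ?thesis using ad a b by (simp add: adjoint_like_def ad1_i1)
  qed
qed

text \<open>Antisymmetry against a generator is built into \<open>adjoint_like\<close>, once
  \<open>ad0\<close> and \<open>ad1\<close> are recognised as \<open>B\<close> of the
  generator.\<close>

lemma B_gen_anti:
  assumes z: "gen t u z" and X: "X \<in> S r p"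
  shows "B X z = - (sgni ((r - 1) * (t - 1) + p * u) *\<^sub>R B z X)"
  using z unfolding gen_def
proof (elim disjE exE conjE)
  fix q f assume f: "q < 2" "f \<in> Apar G q" "z = i0 f" "t = 0" "u = int q"
  have "sgni ((r - 1) * (t - 1) + p * u) = sgni (r - 1 + p * int q)"
    unfolding f by (auto simp: sgni_def)
  then show ?thesis
    using B_adjoint_like[OF X] f by (simp add: adjoint_like_def B_i0_eq S_T[OF X])
next
  fix q \<alpha> assume f: "q < 2" "\<alpha> \<in> O1par G q" "z = i1 \<alpha>" "t = 1" "u = int q"
  then show ?thesis
    using B_adjoint_like[OF X] by (simp add: adjoint_like_def B_i1_eq S_T[OF X])
qed

text \<open>Both sides are derivations in \<open>Z\<close>. Against a generator \<open>z\<close> the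
  bracket can be turned around, expanded by the Leibniz rule in its second argument, and turned
  back; general antisymmetry will rest on this.\<close>

lemma B_mult_left:
  assumes X: "X \<in> S r p" and Y: "Y \<in> S s q" and Z: "Z \<in> T"
  shows "B (X * Y) Z = X * B Y Z + sgni (r * s + p * q) *\<^sub>R (Y * B X Z)"
proof -
  have 1: "der (r + s - 1) (p + q) (B (X * Y))" by (rule B_der[OF S_mult[OF X Y]])
  have 2: "der (r + s - 1) (p + q) (\<lambda>Z. sgni (r * s + p * q) *\<^sub>R (Y * B X Z) + X * B Y Z)"
    by (intro der_lincomb der_cong[OF der_left_mult[OF B_der[OF X] Y]] der_cong[OF der_left_mult[OF B_der[OF Y]
        X]]) auto
  have "B (X * Y) Z = sgni (r * s + p * q) *\<^sub>R (Y * B X Z) + X * B Y Z"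
  proof (rule der_eqI_gen[OF 1 2 _ Z])
    fix t u z assume z: "gen t u z"
    have zX: "B z X * Y = sgni ((t + r - 1) * s + (u + p) * q) *\<^sub>R (Y * B z X)"
      by (rule S_commute[OF Y B_S[OF gen_S[OF z] X]])
    have sg: "sgni ((r + s - 1) * (t - 1) + (p + q) * u) * sgni ((t + r - 1) * s + (u + p) * q)
        = sgni (r * s + p * q) * sgni ((r - 1) * (t - 1) + p * u)"
      "sgni ((r + s - 1) * (t - 1) + (p + q) * u) * sgni ((t - 1) * r + u * p) = sgni ((s - 1) * (t - 1) + q * u)"
      by (auto simp: sgni_def)
    have "B (X * Y) z = - (sgni ((r + s - 1) * (t - 1) + (p + q) * u) *\<^sub>R B z (X * Y))"
      by (rule B_gen_anti[OF z S_mult[OF X Y]])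
    also have "B z (X * Y) = B z X * Y + sgni ((t - 1) * r + u * p) *\<^sub>R (X * B z Y)"
      by (rule B_mult[OF gen_S[OF z] X S_T[OF Y]])
    finally have "B (X * Y) z = - ((sgni (r * s + p * q) * sgni ((r - 1) * (t - 1) + p * u)) *\<^sub>R (Y * B z X))
        - sgni ((s - 1) * (t - 1) + q * u) *\<^sub>R (X * B z Y)"
      unfolding zX scaleR_add_right scaleR_scaleR sg by simp
    then show "B (X * Y) z = sgni (r * s + p * q) *\<^sub>R (Y * B X z) + X * B Y z"
      by (simp add: B_gen_anti[OF z X] B_gen_anti[OF z Y])
  qed
  then show ?thesis by (simp add: add.commute)
qed

text \<open>Splitting a one-form off \<open>Y\<close>, the Leibniz rules in either argument produce
  terms that agree by the induction hypothesis, by antisymmetry against a generator and by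
  supercommutativity.\<close>

lemma B_anti:
  assumes "Y \<in> S s q" "X \<in> S r p"
  shows "B X Y = - (sgni ((r - 1) * (s - 1) + p * q) *\<^sub>R B Y X)"
proof -
  have "\<forall>r p X. X \<in> S r p \<longrightarrow> B X Y = - (sgni ((r - 1) * (s - 1) + p * q) *\<^sub>R B Y X)"
    using assms(1)
  proof (induct rule: S_induct)
    case (subspace s q)
    show ?case
      by (rule subspace_pointwise_linear) (auto simp: B_right B_left scaleR_add_right mult.commute)
  next
    case (base d f q)
    have "sgni ((r - 1) * (0 - 1) + p * q) = sgni ((r - 1) * (0 - 1) + p * int d)" for r p
      using base(3) by (intro sgni_cong) (simp flip: right_diff_distrib)
    then show ?case using B_gen_anti[OF gen_i0[OF base(1,2)]] by simp
  next
    case (step s q y d \<alpha>)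
    show ?case
    proof (intro allI impI)
      fix r p X assume X: "X \<in> S r p"
      note a = gen_i1[OF step(3,4)]
      note aS = gen_S[OF a]
      have 1: "B X (y * i1 \<alpha>) = B X y * i1 \<alpha> + sgni ((r - 1) * s + p * q) *\<^sub>R (y * B X (i1
          \<alpha>))"
        by (rule B_mult[OF X step(1) S_T[OF aS]])
      have 2: "B (y * i1 \<alpha>) X = y * B (i1 \<alpha>) X + sgni (s * 1 + q * int d) *\<^sub>R (i1 \<alpha>
          * B y X)"
        by (rule B_mult_left[OF step(1) aS S_T[OF X]])
      have 3: "B X y = - (sgni ((r - 1) * (s - 1) + p * q) *\<^sub>R B y X)" using step(2) X by blast
      have 4: "B X (i1 \<alpha>) = - (sgni ((r - 1) * (1 - 1) + p * int d) *\<^sub>R B (i1 \<alpha>) X)"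
        by (rule B_gen_anti[OF a X])
      have 5: "B y X * i1 \<alpha> = sgni ((s + r - 1) * 1 + (q + p) * int d) *\<^sub>R (i1 \<alpha> * B y X)"
        by (rule S_commute[OF aS B_S[OF step(1) X]])
      have sg: "sgni ((r - 1) * (s - 1) + p * q) * sgni ((s + r - 1) * 1 + (q + p) * int d)
          = sgni ((r - 1) * (s + 1 - 1) + p * (q + int d)) * sgni (s * 1 + q * int d)"
        "sgni ((r - 1) * s + p * q) * sgni ((r - 1) * (1 - 1) + p * int d) = sgni ((r - 1) * (s + 1 - 1) + p *
            (q + int d))"
        by (auto simp: sgni_def)
      have "B X (y * i1 \<alpha>) = - ((sgni ((r - 1) * (s - 1) + p * q) * sgni ((s + r - 1) * 1 + (q + p) *
          int d)) *\<^sub>R (i1 \<alpha> * B y X))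
          - (sgni ((r - 1) * s + p * q) * sgni ((r - 1) * (1 - 1) + p * int d)) *\<^sub>R (y * B (i1 \<alpha>) X)"
        unfolding 1 3 4 by (simp add: 5[simplified])
      then show "B X (y * i1 \<alpha>) = - (sgni ((r - 1) * (s + 1 - 1) + p * (q + int d)) *\<^sub>R B (y * i1
          \<alpha>) X)"
        unfolding 2 sg by (simp add: scaleR_add_right)
    qed
  qed
  then show ?thesis using assms(2) by blast
qed

section \<open>The Jacobi identity\<close>

definition Jac :: "int \<Rightarrow> int \<Rightarrow> int \<Rightarrow> int \<Rightarrow> 'a form endo
    \<Rightarrow> 'a form endo \<Rightarrow> 'a form endo \<Rightarrow> bool" where
  "Jac r p s q X Y Z \<longleftrightarrow> B X (B Y Z) = B (B X Y) Z + sgni ((r - 1) * (s - 1) + p * q)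
      *\<^sub>R B Y (B X Z)"

text \<open>The supercommutator of \<open>B X\<close> and \<open>B Y\<close> and the map
  \<open>B (B X Y)\<close> are derivations of equal bidegree.\<close>

lemma Jac_from_gen:
  assumes X: "X \<in> S r p" and Y: "Y \<in> S s q" and Z: "Z \<in> T"
    and gen: "\<And>t u z. gen t u z \<Longrightarrow> Jac r p s q X Y z"
  shows "Jac r p s q X Y Z"
proof -
  have 1: "der (r - 1 + (s - 1)) (p + q) (\<lambda>Z. B X (B Y Z) - sgni ((r - 1) * (s - 1) + p * q) *\<^sub>R
      B Y (B X Z))"
    by (rule der_commutator[OF B_der[OF X] B_der[OF Y]])
  have 2: "der (r - 1 + (s - 1)) (p + q) (B (B X Y))"
    by (rule der_cong[OF B_der[OF B_S[OF X Y]]]) auto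
  from der_eqI_gen[OF 1 2 _ Z] gen show ?thesis by (simp add: Jac_def algebra_simps)
qed

lemma Jac_swap12:
  assumes X: "X \<in> S r p" and Y: "Y \<in> S s q" and J: "Jac r p s q X Y Z"
  shows "Jac s q r p Y X Z"
proof -
  have sg: "sgni ((s - 1) * (r - 1) + q * p) = sgni ((r - 1) * (s - 1) + p * q)" by (simp add: mult.commute)
  show ?thesis
    using J unfolding Jac_def B_anti[OF X Y] sg by (simp add: B_left scaleR_add_right)
qed

text \<open>Antisymmetry is applied to \<open>B Y Z\<close>, to \<open>B (B X Y) Z\<close> and to
  \<open>B Y (B X Z)\<close>. The repeated subtraction in \<open>r + s - 1 - 1\<close> is the
  shifted degree of \<open>B X Y\<close>, whose degree is \<open>r + s - 1\<close>.\<close>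

lemma Jac_swap23:
  assumes X: "X \<in> S r p" and Y: "Y \<in> S s q" and Z: "Z \<in> S t u" and J: "Jac r p s q X Y Z"
  shows "Jac r p t u X Z Y"
proof -
  have 1: "B Z Y = - (sgni ((t - 1) * (s - 1) + u * q) *\<^sub>R B Y Z)" by (rule B_anti[OF Y Z])
  have 2: "B (B X Y) Z = - (sgni ((r + s - 1 - 1) * (t - 1) + (p + q) * u) *\<^sub>R B Z (B X Y))"
    by (rule B_anti[OF Z B_S[OF X Y]])
  have 3: "B Y (B X Z) = - (sgni ((s - 1) * (r + t - 1 - 1) + q * (p + u)) *\<^sub>R B (B X Z) Y)"
    by (rule B_anti[OF B_S[OF X Z] Y])
  have sg: "sgni ((t - 1) * (s - 1) + u * q) * sgni ((r + s - 1 - 1) * (t - 1) + (p + q) * u) = sgni ((r - 1) *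
      (t - 1) + p * u)"
    "sgni ((t - 1) * (s - 1) + u * q) * (sgni ((r - 1) * (s - 1) + p * q) * sgni ((s - 1) * (r + t - 1 - 1) + q
        * (p + u))) = 1"
    by (auto simp: sgni_def)
  have "B X (B Z Y) = - (sgni ((t - 1) * (s - 1) + u * q) *\<^sub>R (B (B X Y) Z + sgni ((r - 1) * (s - 1) + p
      * q) *\<^sub>R B Y (B X Z)))"
    using J unfolding 1 Jac_def by (simp add: B_right)
  also have "\<dots> = (sgni ((t - 1) * (s - 1) + u * q) * sgni ((r + s - 1 - 1) * (t - 1) + (p + q) * u))
      *\<^sub>R B Z (B X Y)
      + (sgni ((t - 1) * (s - 1) + u * q) * (sgni ((r - 1) * (s - 1) + p * q) * sgni ((s - 1) * (r + t - 1 - 1)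
          + q * (p + u)))) *\<^sub>R B (B X Z) Y"
    unfolding 2 3 by (simp add: scaleR_diff_right scaleR_add_right)
  finally show ?thesis unfolding Jac_def sg by simp
qed

lemma B_i0_i0: "p < 2 \<Longrightarrow> q < 2 \<Longrightarrow> f \<in> Apar G p \<Longrightarrow> g \<in> Apar
    G q \<Longrightarrow> B (i0 f) (i0 g) = 0"
  using B_i0_eq[of p f "i0 g"] ad0_i0[of p f q g] S_T[OF i0_S[of q g "int q"]] by simp

lemma B_i0_i1: "p < 2 \<Longrightarrow> q < 2 \<Longrightarrow> f \<in> Apar G p \<Longrightarrow> \<alpha>
    \<in> O1par G q \<Longrightarrow>
    B (i0 f) (i1 \<alpha>) = - (sgni (int p * int q) *\<^sub>R i0 (\<rho> \<alpha> f))"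
  using B_i0_eq[of p f "i1 \<alpha>"] ad0_i1[of p f q \<alpha>] S_T[OF i1_S[of q \<alpha> "int q"]] by simp

lemma B_i1_i0: "p < 2 \<Longrightarrow> q < 2 \<Longrightarrow> \<alpha> \<in> O1par G p \<Longrightarrow> f
    \<in> Apar G q \<Longrightarrow> B (i1 \<alpha>) (i0 f) = i0 (\<rho> \<alpha> f)"
  using B_i1_eq[of p \<alpha> "i0 f"] ad1_i0[of p \<alpha> q f] S_T[OF i0_S[of q f "int q"]] by simp

lemma B_i1_i1: "p < 2 \<Longrightarrow> q < 2 \<Longrightarrow> \<alpha> \<in> O1par G p \<Longrightarrow>
    \<beta> \<in> O1par G q \<Longrightarrow> B (i1 \<alpha>) (i1 \<beta>) = i1 (brk \<alpha> \<beta>)"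
  using B_i1_eq[of p \<alpha> "i1 \<beta>"] ad1_i1[of p \<alpha> q \<beta>] S_T[OF i1_S[of q \<beta> "int q"]] by simp

lemma Jac_000:
  assumes "p < 2" "f \<in> Apar G p" "q < 2" "g \<in> Apar G q" "u < 2" "h \<in> Apar G u"
  shows "Jac 0 (int p) 0 (int q) (i0 f) (i0 g) (i0 h)"
  using assms by (simp add: Jac_def B_i0_i0 B_right B_left)

text \<open>\<open>[f, \<alpha>]\<close> and \<open>[g, \<alpha>]\<close> are functions, so every
  term contains a bracket of two functions.\<close>

lemma Jac_001:
  assumes f: "p < 2" "f \<in> Apar G p" and g: "q < 2" "g \<in> Apar G q" and a: "u < 2" "\<alpha> \<in> O1par G u"
  shows "Jac 0 (int p) 0 (int q) (i0 f) (i0 g) (i1 \<alpha>)"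
  using B_i0_i0[OF f(1) _ f(2) rho_Apar[OF a g]] B_i0_i0[OF g(1) _ g(2) rho_Apar[OF a f]]
  by (simp add: Jac_def B_i0_i0[OF f(1) g(1) f(2) g(2)] B_i0_i1[OF g(1) a(1) g(2) a(2)] B_i0_i1[OF f(1) a(1)
      f(2) a(2)]
      B_right B_left)

lemma Jac_110:
  assumes a: "p < 2" "\<alpha> \<in> O1par G p" and b: "q < 2" "\<beta> \<in> O1par G q" and f: "u < 2" "f
      \<in> Apar G u"
  shows "Jac 1 (int p) 1 (int q) (i1 \<alpha>) (i1 \<beta>) (i0 f)"
  using B_i1_i0[OF a(1) _ a(2) rho_Apar[OF b f]] B_i1_i0[OF b(1) _ b(2) rho_Apar[OF a f]]
    B_i1_i0[OF _ f(1) brk_O1par[OF a(1) b(1) a(2) b(2)] f(2)]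
  by (simp add: Jac_def B_i1_i0[OF a(1) f(1) a(2) f(2)] B_i1_i0[OF b(1) f(1) b(2) f(2)] B_i1_i1[OF a(1) b(1)
      a(2) b(2)]
      rho_brk[OF a b f])

lemma Jac_111:
  assumes a: "p < 2" "\<alpha> \<in> O1par G p" and b: "q < 2" "\<beta> \<in> O1par G q" and c: "u < 2"
      "\<gamma> \<in> O1par G u"
  shows "Jac 1 (int p) 1 (int q) (i1 \<alpha>) (i1 \<beta>) (i1 \<gamma>)"
proof -
  note O = O1par_Omega1[OF a(2)] O1par_Omega1[OF b(2)] O1par_Omega1[OF c(2)]
  have "i1 (brk \<alpha> (brk \<beta> \<gamma>)) = i1 (brk (brk \<alpha> \<beta>) \<gamma>) + sgni (int p * int
      q) *\<^sub>R i1 (brk \<beta> (brk \<alpha> \<gamma>))"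
    unfolding brk_jacobi[OF a(1) b(1) c(1) a(2) b(2) c(2)]
    by (simp add: i1_add i1_scale O brk_Omega1 Omega1_scale)
  then show ?thesis
    using B_i1_i1[OF a(1) _ a(2) brk_O1par[OF b(1) c(1) b(2) c(2)]] B_i1_i1[OF b(1) _ b(2) brk_O1par[OF a(1)
        c(1) a(2) c(2)]]
      B_i1_i1[OF _ c(1) brk_O1par[OF a(1) b(1) a(2) b(2)] c(2)]
    by (simp add: Jac_def B_i1_i1[OF a(1) c(1) a(2) c(2)] B_i1_i1[OF b(1) c(1) b(2) c(2)] B_i1_i1[OF a(1) b(1)
        a(2) b(2)])
qed

text \<open>Up to order, only the number of one-forms in a triple of generators matters.
  Transpositions carry the eight degree patterns to the four already treated.\<close>

lemma Jac_gen:
  assumes g: "gen r p x" "gen s q y" "gen t u z"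
  shows "Jac r p s q x y z"
proof -
  note S = g[THEN gen_S]
  consider "r = 0" "s = 0" "t = 0" | "r = 0" "s = 0" "t = 1" | "r = 0" "s = 1" "t = 0" | "r = 1" "s = 0" "t = 0"
    | "r = 1" "s = 1" "t = 0" | "r = 1" "s = 0" "t = 1" | "r = 0" "s = 1" "t = 1" | "r = 1" "s = 1" "t = 1"
    using g by (auto simp: gen_def)
  then show ?thesis
  proof cases
    case 1 then show ?thesis using g Jac_000 by (auto simp: gen_def)
  next
    case 2 then show ?thesis using g Jac_001 by (auto simp: gen_def)
  next
    case 3
    then have "Jac r p t u x z y" using g Jac_001 by (auto simp: gen_def)
    then show ?thesis by (rule Jac_swap23[OF S(1,3,2)])
  next
    case 4
    then have "Jac s q t u y z x" using g Jac_001 by (auto simp: gen_def)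
    then have "Jac s q r p y x z" by (rule Jac_swap23[OF S(2,3,1)])
    then show ?thesis by (rule Jac_swap12[OF S(2,1)])
  next
    case 5 then show ?thesis using g Jac_110 by (auto simp: gen_def)
  next
    case 6
    then have "Jac r p t u x z y" using g Jac_110 by (auto simp: gen_def)
    then show ?thesis by (rule Jac_swap23[OF S(1,3,2)])
  next
    case 7
    then have "Jac s q t u y z x" using g Jac_110 by (auto simp: gen_def)
    then have "Jac s q r p y x z" by (rule Jac_swap23[OF S(2,3,1)])
    then show ?thesis by (rule Jac_swap12[OF S(2,1)])
  next
    case 8 then show ?thesis using g Jac_111 by (auto simp: gen_def)
  qed
qed

text \<open>The Jacobiator is a derivation in its last argument and symmetric up to sign,
  so it vanishes once it vanishes on generators.\<close>

lemma B_jacobi: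
  assumes X: "X \<in> S r p" and Y: "Y \<in> S s q" and Z: "Z \<in> T"
  shows "Jac r p s q X Y Z"
proof -
  \<comment> \<open>Arbitrary elements enter one slot at a time: here only the third argument is
    arbitrary, then two are, then all three. Each time a transposition brings an argument into the
    last slot, where generators suffice.\<close>
  have 1: "Jac t u s q z z' Y" if "gen t u z" "gen s q z'" "Y \<in> T" for t u z z' s q Y
    using Jac_from_gen[OF gen_S[OF that(1)] gen_S[OF that(2)] that(3)] Jac_gen that by blast
  have 2: "Jac t u r p z X Y" if z: "gen t u z" and X: "X \<in> S r p" and Y: "Y \<in> T" for t u z r p X Y
  proof (rule Jac_from_gen[OF gen_S[OF z] X Y])
    fix s q z' assume z': "gen s q z'"
    show "Jac t u r p z X z'"
      by (rule Jac_swap23[OF gen_S[OF z] gen_S[OF z'] X 1[OF z z' S_T[OF X]]])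
  qed
  show ?thesis
  proof (rule Jac_from_gen[OF X Y Z])
    fix t u z assume z: "gen t u z"
    have "Jac t u r p z X Y" by (rule 2[OF z X S_T[OF Y]])
    then have "Jac r p t u X z Y" by (rule Jac_swap12[OF gen_S[OF z] X])
    then show "Jac r p s q X Y z" by (rule Jac_swap23[OF X gen_S[OF z] Y])
  qed
qed

lemma B_T: "X \<in> T \<Longrightarrow> Y \<in> T \<Longrightarrow> B X Y \<in> T"
proof (induct rule: T_induct)
  case subspace
  show ?case by (rule subspace_pointwise_linear) (auto simp: B_left T_add T_scale)
next
  case (hom r p X)
  then show ?case using der_T[OF B_der] by blast
qed

section \<open>Values on inhomogeneous generators and the return to representatives\<close>

lemma B_i0_i0_all: "B (i0 f) (i0 g) = 0"
  unfolding i0_decomp[of f] i0_decomp[of g]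
  by (simp add: B_left B_right B_i0_i0[of 0 0] B_i0_i0[of 0 1] B_i0_i0[of 1 0] B_i0_i0[of 1 1] acomp_in)

lemma B_i1_i0_all:
  assumes "\<alpha> \<in> Omega1" shows "B (i1 \<alpha>) (i0 f) = i0 (\<rho> \<alpha> f)"
proof -
  have t: "tcomp G 0 \<alpha> \<in> O1par G 0" "tcomp G 1 \<alpha> \<in> O1par G 1" using tcomp_in[OF assms] by auto
  have 1: "\<rho> \<alpha> f = \<rho> (tcomp G 0 \<alpha>) f + \<rho> (tcomp G 1 \<alpha>) f"
    using rho_lincomb[OF t[THEN O1par_Omega1], of 1 f] by (simp add: tcomp_decomp[OF assms])
  have 2: "\<rho> \<beta> f = \<rho> \<beta> (acomp G 0 f) + \<rho> \<beta> (acomp G 1 f)" if "p < 2" "\<beta>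
      \<in> O1par G p" for p \<beta>
    using linear_add[OF rho_linear[OF that], of "acomp G 0 f" "acomp G 1 f"] by (simp add: acomp_decomp)
  show ?thesis
    unfolding 1 2[OF _ t(1), simplified] 2[OF _ t(2), simplified] i1_decomp[OF assms] i0_decomp[of f]
    using t by (simp add: B_left B_right B_i1_i0[of 0 0] B_i1_i0[of 0 1] B_i1_i0[of 1 0] B_i1_i0[of 1 1] acomp_in)
qed

lemma B_i1_i1_all:
  assumes "\<alpha> \<in> Omega1" "\<beta> \<in> Omega1" shows "B (i1 \<alpha>) (i1 \<beta>) = i1 (brk \<alpha>
      \<beta>)"
proof -
  have t: "tcomp G 0 \<alpha> \<in> O1par G 0" "tcomp G 1 \<alpha> \<in> O1par G 1" using tcomp_in[OF assms(1)]
      by auto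
  have u: "tcomp G 0 \<beta> \<in> O1par G 0" "tcomp G 1 \<beta> \<in> O1par G 1" using tcomp_in[OF assms(2)] by auto
  note O = t[THEN O1par_Omega1] u[THEN O1par_Omega1]
  have 1: "brk \<alpha> \<beta> = brk (tcomp G 0 \<alpha>) \<beta> + brk (tcomp G 1 \<alpha>) \<beta>"
    using brk_lincomb_left[OF O(1,2) assms(2), of 1] by (simp add: tcomp_decomp[OF assms(1)])
  have 2: "brk \<gamma> \<beta> = brk \<gamma> (tcomp G 0 \<beta>) + brk \<gamma> (tcomp G 1 \<beta>)" if
      "\<gamma> \<in> Omega1" for \<gamma>
    using brk_lincomb_right[OF that O(3,4), of 1] by (simp add: tcomp_decomp[OF assms(2)])
  show ?thesis
    unfolding 1 2[OF O(1)] 2[OF O(2)] i1_decomp[OF assms(1)] i1_decomp[OF assms(2)]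
    using t u O by (simp add: B_left B_right B_i1_i1[of 0 0] B_i1_i1[of 0 1] B_i1_i1[of 1 0] B_i1_i1[of 1 1]
      i1_add brk_Omega1 Omega1_add)
qed

definition form_bracket :: "'a form \<Rightarrow> 'a form \<Rightarrow> 'a form" where
  "form_bracket x y = sec (B (\<Phi> x) (\<Phi> y))"

lemma fbr_Om: "form_bracket x y \<in> Om G"
  by (simp add: form_bracket_def sec(2))

lemma \<Phi>_T: "x \<in> Om G \<Longrightarrow> \<Phi> x \<in> T"
  by (simp add: T_eq)

lemma \<Phi>_form_bracket: "x \<in> Om G \<Longrightarrow> y \<in> Om G \<Longrightarrow> \<Phi> (form_bracket
    x y) = B (\<Phi> x) (\<Phi> y)"
  by (simp add: form_bracket_def sec(3) B_T \<Phi>_T)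

lemma gerstenhaber_form_bracket: "gerstenhaber G form_bracket"
  unfolding gerstenhaber_def
proof (intro conjI allI ballI impI)
  note [simp] = fbr_Om \<Phi>_form_bracket Om_add Om_scale Om_neg
    Om_0 oeq_iff_\<Phi> wedge_Om \<Phi>_wedge
  show "form_bracket x y \<in> Om G" for x y by simp
  show "oeq G (form_bracket x y) (form_bracket x' y')"
    if "x \<in> Om G" "x' \<in> Om G" "y \<in> Om G" "y' \<in> Om G" "oeq G x x'" "oeq G y y'" for x x' y y'
    using that by simp
  show "oeq G (form_bracket (c *\<^sub>R x + x') y) (c *\<^sub>R form_bracket x y + form_bracket x' y)"
    if "x \<in> Om G" "x' \<in> Om G" "y \<in> Om G" for c x x' y
    using that by (simp add: B_left)
  show "oeq G (form_bracket x (c *\<^sub>R y + y')) (c *\<^sub>R form_bracket x y + form_bracket x y')"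
    if "x \<in> Om G" "y \<in> Om G" "y' \<in> Om G" for c x y y'
    using that by (simp add: B_right)
  fix r s p q x y assume p: "p < 2" and q: "q < 2" and x: "x \<in> Ohom G r p" and y: "y \<in> Ohom G s q"
  note X = x[unfolded Ohom_iff[OF p]] and Y = y[unfolded Ohom_iff[OF q]]
  have BS: "B (\<Phi> x) (\<Phi> y) \<in> S (int r + int s - 1) (int p + int q)"
    using B_S X Y by blast
  show "if r + s = 0 then oeq G (form_bracket x y) 0 else form_bracket x y \<in> Ohom G (r + s - 1) ((p + q) mod 2)"
  \<comment> \<open>For \<open>r + s = 0\<close> the value has degree -1, where the bigraded image
    is zero; otherwise \<open>r + s - 1\<close> means the same for natural numbers and
    integers.\<close>
  proof (cases "r + s = 0")
    case True
    then show ?thesis using BS S_neg_degree[of "-1" "int p + int q"] X Y by simp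
  next
    case False
    have "S (int r + int s - 1) (int p + int q) = S (int (r + s - 1)) (int ((p + q) mod 2))"
      using False by (subst S_cong[of "int ((p + q) mod 2)" "int p + int q"]) (auto simp: of_nat_diff of_nat_mod)
    with BS have "B (\<Phi> x) (\<Phi> y) \<in> S (int (r + s - 1)) (int ((p + q) mod 2))" by blast
    then show ?thesis using False X Y by (auto simp: Ohom_iff)
  qed
  show "oeq G (form_bracket x y) (- (sgni ((int r - 1) * (int s - 1) + int (p * q)) *\<^sub>R form_bracket y x))"
    using X Y B_anti[of "\<Phi> y" "int s" "int q" "\<Phi> x" "int r" "int p"] by simp
  fix t u z assume u: "u < 2" and z: "z \<in> Ohom G t u"
  note Z = z[unfolded Ohom_iff[OF u]]
  show "oeq G (form_bracket x (form_bracket y z)) (form_bracket (form_bracket x y) z + sgni ((int r - 1) * (int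
      s - 1) + int (p * q)) *\<^sub>R form_bracket y (form_bracket x z))"
    using X Y Z B_jacobi[of "\<Phi> x" "int r" "int p" "\<Phi> y" "int s" "int q" "\<Phi> z"] by (simp add:
        Jac_def \<Phi>_T)
  show "oeq G (form_bracket x (wedge y z)) (wedge (form_bracket x y) z + sgni ((int r - 1) * int s + int (p *
      q)) *\<^sub>R wedge y (form_bracket x z))"
    using X Y Z B_mult[of "\<Phi> x" "int r" "int p" "\<Phi> y" "int s" "int q" "\<Phi> z"] by (simp add: \<Phi>_T)
qed

lemma form_bracket_generators:
  "oeq G (form_bracket (embA G f) (embA G g)) 0"
  "\<alpha> \<in> Omega1 \<Longrightarrow> oeq G (form_bracket (emb1 G \<alpha>) (embA G f)) (embA G (\<rho>
      \<alpha> f))"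
  "\<alpha> \<in> Omega1 \<Longrightarrow> \<beta> \<in> Omega1 \<Longrightarrow> oeq G (form_bracket (emb1 G
      \<alpha>) (emb1 G \<beta>)) (emb1 G (brk \<alpha> \<beta>))"
  using B_i0_i0_all[of f g] B_i1_i0_all[of \<alpha> f] B_i1_i1_all[of \<alpha> \<beta>]
  by (simp_all add: oeq_iff_\<Phi> fbr_Om \<Phi>_form_bracket embA_Om emb1_Om brk_Omega1 Om_0 flip: i0_def i1_def)

end

subsection \<open>From the bracket to a Lie superalgebroid\<close>

context graded_algebra
begin

text \<open>Extended linearly, \<open>word0\<close> and \<open>word1\<close> invert the two
  embeddings: the former reads off the coefficient in degree 0, the latter contracts a word of
  degree 1 to the element \<open>f \<alpha>\<close> of the module.\<close>

definition word0 :: "'a word \<Rightarrow> 'a" where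
  "word0 w = (case w of (p, f, as) \<Rightarrow> if as = [] then f else 0)"

definition word1 :: "'a word \<Rightarrow> 'a tens" where
  "word1 w = (case w of (p, f, as) \<Rightarrow> (case as of [(q, \<alpha>)] \<Rightarrow> lact f \<alpha> | _
      \<Rightarrow> 0))"

lemma word1_simps [simp]:
  "word1 (p, f, []) = 0" "word1 (p, f, [(q, \<alpha>)]) = lact f \<alpha>" "word1 (p, f, a # b # as) = 0"
  by (simp_all add: word1_def split: prod.splits)

lemma word1_long: "length as \<noteq> 1 \<Longrightarrow> word1 (p, f, as) = 0"
  by (cases as rule: remdups_adj.cases) auto

lemma lext_word0_Rid:
  assumes "x \<in> Rid G" shows "lext word0 x = 0"
proof -
  have "lext word0 b = 0" if "b \<in> Relators G" for b
    using that by (cases rule: Relators_cases) (auto simp: word0_def)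
  then show ?thesis using lext_span_in[of x "Relators G" "{0}" word0] assms by (auto simp: Rid_def)
qed

text \<open>On words of degree 1 the relators become module axioms: additivity and homogeneity in
  \<open>f\<close>, additivity in \<open>\<alpha>\<close>, and associativity of the action. A swap
  relator involves words of degree at least 2, which are sent to 0.\<close>

lemma lext_word1_Rid:
  assumes "x \<in> Rid G" shows "lext word1 x = 0"
proof -
  have "lext word1 b = 0" if b: "b \<in> Relators G" for b
    using b
  proof (cases rule: Relators_cases)
    case (add0 p f g as)
    show ?thesis
    proof (cases "length as = 1")
      case True
      then obtain q \<alpha> where "as = [(q, \<alpha>)]" by (cases as) auto
      moreover from this have "\<alpha> \<in> AtA" using add0 by (auto intro: O1par_AtA)
      ultimately show ?thesis using add0(1) by (simp add: lact_add_left)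
    qed (simp add: add0 word1_long)
  next
    case (scale0 p c f as)
    show ?thesis
    proof (cases "length as = 1")
      case True
      then obtain q \<alpha> where "as = [(q, \<alpha>)]" by (cases as) auto
      moreover from this have "\<alpha> \<in> AtA" using scale0 by (auto intro: O1par_AtA)
      ultimately show ?thesis using scale0(1) by (simp add: lact_scaleR_left)
    qed (simp add: scale0 word1_long)
  next
    case (add1 p f us q \<alpha> \<beta> vs)
    then show ?thesis by (cases "us = [] \<and> vs = []") (auto simp: word1_long)
  next
    case (lact p f us q' g q \<alpha> vs)
    then show ?thesis by (cases "us = [] \<and> vs = []") (auto simp: word1_long lact_mult)
  next
    case (swap p f us q1 \<alpha>1 q2 \<alpha>2 vs)
    then show ?thesis by (simp add: word1_long)
  qed
  then show ?thesis using lext_span_in[of x "Relators G" "{0}" word1] assms by (auto simp: Rid_def)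
qed

text \<open>With its counterpart for one-forms, this lets identities of classes be read back in the
  algebra and in the module, where the algebroid laws are strict equalities.\<close>

lemma i0_inject: "i0 f = i0 g \<longleftrightarrow> f = g"
proof
  assume "i0 f = i0 g"
  then have "i0 (f - g) = 0" by simp
  then have "embA G (f - g) \<in> Rid G" using \<Phi>_eq_0_iff[OF embA_Om] by (simp add: i0_def)
  from lext_word0_Rid[OF this] show "f = g" by (simp add: embA_def word0_def acomp_decomp)
qed simp

lemma i1_inject:
  assumes "\<alpha> \<in> Omega1" "\<beta> \<in> Omega1" shows "i1 \<alpha> = i1 \<beta> \<longleftrightarrow>
      \<alpha> = \<beta>"
proof
  assume eq: "i1 \<alpha> = i1 \<beta>"
  have O: "\<alpha> - \<beta> \<in> Omega1" using assms subspace_diff[OF Omega1_subspace] by blast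
  have "i1 (\<alpha> - \<beta>) = 0" using i1_lincomb[OF assms(2,1), of "-1"] eq by simp
  then have "emb1 G (\<alpha> - \<beta>) \<in> Rid G" using \<Phi>_eq_0_iff[OF emb1_Om[OF O]] by (simp add: i1_def)
  from lext_word1_Rid[OF this] have "lact 1 (tcomp G 0 (\<alpha> - \<beta>)) + lact 1 (tcomp G 1 (\<alpha> -
      \<beta>)) = 0"
    by (simp add: emb1_def)
  then have "lact 1 (\<alpha> - \<beta>) = 0" by (simp add: tcomp_decomp[OF O] flip: lact_add)
  then show "\<alpha> = \<beta>" using lact_one[of "\<alpha> - \<beta>"] O Omega1_subset_AtA by auto
qed simp

lemma S0_obtain:
  assumes "x \<in> S 0 (int p)" "p < 2" obtains f where "f \<in> Apar G p" "x = i0 f"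
proof -
  have "\<exists>f\<in>Apar G p. x = i0 f"
    using assms(1) unfolding S_def
  proof (induct rule: span_induct_cases)
    case subspace
    have "subspace (i0 ` Apar G p)" by (rule linear_subspace_image[OF linear_i0 subspace_Apar])
    then show ?case by (simp add: image_def Bex_def)
  next
    case (base b)
    then obtain d f where "b = lmul (d, f, [])" "d < 2" "f \<in> Apar G d" "even (int d - int p)"
      by (auto simp: hom_words_iff)
    moreover from this have "d = p" using assms(2) by (auto dest!: less_two_cases)
    ultimately show ?case by (auto simp: lmul_Nil)
  qed
  then show ?thesis using that by blast
qed

text \<open>A word of degree 1 is a coefficient times a single one-form, and the module relation
  absorbs the coefficient into it.\<close>

lemma S1_obtain:
  assumes "x \<in> S 1 (int p)" "p < 2" obtains \<alpha> where "\<alpha> \<in> O1par G p" "x = i1 \<alpha>"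
proof -
  have "\<exists>\<alpha>. \<alpha> \<in> O1par G p \<and> x = i1 \<alpha>"
    using assms(1) unfolding S_def
  proof (induct rule: span_induct_cases)
    case subspace
    show ?case
    proof (rule subspace_pointwise_linear; (elim exE conjE)?)
      show "\<exists>\<gamma>. \<gamma> \<in> O1par G p \<and> x + y = i1 \<gamma>"
        if "\<alpha> \<in> O1par G p" "x = i1 \<alpha>" "\<beta> \<in> O1par G p" "y = i1 \<beta>" for x y
            \<alpha> \<beta>
        using that by (intro exI[of _ "\<alpha> + \<beta>"]) (simp add: O1par_add i1_add O1par_Omega1)
      show "\<exists>\<gamma>. \<gamma> \<in> O1par G p \<and> c *\<^sub>R x = i1 \<gamma>" if "\<alpha> \<in>
          O1par G p" "x = i1 \<alpha>" for c x \<alpha>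
        using that by (intro exI[of _ "c *\<^sub>R \<alpha>"]) (simp add: O1par_scaleR i1_scale O1par_Omega1)
      show "\<exists>\<gamma>. \<gamma> \<in> O1par G p \<and> 0 = i1 \<gamma>" by (intro exI[of _ 0]) simp
    qed
  next
    case (base b)
    then obtain d f as where b: "b = lmul (d, f, as)" "(d, f, as) \<in> hom_words 1 (int p)" by auto
    then obtain q \<alpha> where "as = [(q, \<alpha>)]" by (cases as) (auto simp: hom_words_iff)
    with b have b: "b = lmul (d, f, [(q, \<alpha>)])" and d: "d < 2" "f \<in> Apar G d" and q: "q < 2"
        "\<alpha> \<in> O1par G q"
      and ev: "even (int d + int q - int p)" by (auto simp: hom_words_iff)
    have "b = i1 (lact f \<alpha>)"
      using lmul_snoc[of d f "[]" q \<alpha>] d q by (simp add: b lmul_Nil i1_lact[OF d(1) q(1) d(2) q(2)])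
    moreover have "(d + q) mod 2 = p" using ev assms(2) by (auto simp: mod2_eq_if dest!: less_two_cases)
    ultimately show ?case using lact_O1par[OF d(2) q(2) d(1) q(1)] by auto
  qed
  then show ?thesis using that by blast
qed

end

section \<open>A given bracket, transported to classes\<close>

locale gerstenhaber_bracket = graded_algebra G for G :: "int \<Rightarrow> 'a::real_algebra_1 set" +
  fixes br :: "'a form \<Rightarrow> 'a form \<Rightarrow> 'a form"
  assumes gerst: "gerstenhaber G br"
begin

lemmas gerst_facts = conjunct1[OF gerst[unfolded gerstenhaber_def]]
  conjunct1[OF conjunct2[OF gerst[unfolded gerstenhaber_def]]]
  conjunct1[OF conjunct2[OF conjunct2[OF gerst[unfolded gerstenhaber_def]]]]
  conjunct1[OF conjunct2[OF conjunct2[OF conjunct2[OF gerst[unfolded gerstenhaber_def]]]]]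
  conjunct1[OF conjunct2[OF conjunct2[OF conjunct2[OF conjunct2[OF gerst[unfolded gerstenhaber_def]]]]]]
  conjunct1[OF conjunct2[OF conjunct2[OF conjunct2[OF conjunct2[OF conjunct2[OF gerst[unfolded gerstenhaber_def]]]]]]]
  conjunct1[OF conjunct2[OF conjunct2[OF conjunct2[OF conjunct2[OF conjunct2[OF conjunct2[OF gerst[unfolded
      gerstenhaber_def]]]]]]]]
  conjunct2[OF conjunct2[OF conjunct2[OF conjunct2[OF conjunct2[OF conjunct2[OF conjunct2[OF gerst[unfolded
      gerstenhaber_def]]]]]]]]

text \<open>\<open>br\<close> is bilinear only modulo relations and only on \<open>Om G\<close>;
  passing to classes through \<open>sec\<close> turns its laws into equalities for arguments in
  \<open>T\<close>.\<close>

definition C :: "'a form endo \<Rightarrow> 'a form endo \<Rightarrow> 'a form endo" where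
  "C X Y = \<Phi> (br (sec X) (sec Y))"

lemma br_Om: "x \<in> Om G \<Longrightarrow> y \<in> Om G \<Longrightarrow> br x y \<in> Om G"
  by (rule gerst_facts(1)[rule_format])

lemma \<Phi>_br:
  assumes "x \<in> Om G" "y \<in> Om G" shows "\<Phi> (br x y) = C (\<Phi> x) (\<Phi> y)"
proof -
  have "oeq G (br x y) (br (sec (\<Phi> x)) (sec (\<Phi> y)))"
    by (rule gerst_facts(2)[rule_format])
       (use assms in \<open>auto simp: sec(2) oeq_iff_\<Phi> sec(3) T_eq\<close>)
  then show ?thesis using assms by (simp add: C_def oeq_iff_\<Phi> br_Om sec(2))
qed

lemma C_left:
  assumes "X \<in> T" "X' \<in> T" "Y \<in> T" shows "C (c *\<^sub>R X + X') Y = c *\<^sub>R C X Y + C X' Y"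
proof -
  have "oeq G (br (c *\<^sub>R sec X + sec X') (sec Y)) (c *\<^sub>R br (sec X) (sec Y) + br (sec X') (sec Y))"
    by (rule gerst_facts(3)[rule_format]) (simp_all add: sec(2))
  then show ?thesis using assms
    by (simp add: oeq_iff_\<Phi> br_Om sec(2) Om_add Om_scale \<Phi>_br sec(3))
qed

lemma C_right:
  assumes "X \<in> T" "Y \<in> T" "Y' \<in> T" shows "C X (c *\<^sub>R Y + Y') = c *\<^sub>R C X Y + C X Y'"
proof -
  have "oeq G (br (sec X) (c *\<^sub>R sec Y + sec Y')) (c *\<^sub>R br (sec X) (sec Y) + br (sec X) (sec Y'))"
    by (rule gerst_facts(4)[rule_format]) (simp_all add: sec(2))
  then show ?thesis using assms
    by (simp add: oeq_iff_\<Phi> br_Om sec(2) Om_add Om_scale \<Phi>_br sec(3))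
qed

lemma C_add: "X \<in> T \<Longrightarrow> X' \<in> T \<Longrightarrow> Y \<in> T \<Longrightarrow> C (X + X') Y
    = C X Y + C X' Y"
  "X \<in> T \<Longrightarrow> Y \<in> T \<Longrightarrow> Y' \<in> T \<Longrightarrow> C X (Y + Y') = C X Y + C X Y'"
  using C_left[of X X' Y 1] C_right[of X Y Y' 1] by simp_all

lemma C_0: "Y \<in> T \<Longrightarrow> C 0 Y = 0" "X \<in> T \<Longrightarrow> C X 0 = 0"
  \<comment> \<open>With \<open>c = -1\<close> and zero arguments the first law reads
    \<open>C 0 Y = - C 0 Y + C 0 Y\<close>.\<close>
  using C_left[of 0 0 Y "-1"] C_right[of X 0 0 "-1"] by simp_all

lemma C_scale: "X \<in> T \<Longrightarrow> Y \<in> T \<Longrightarrow> C (c *\<^sub>R X) Y = c *\<^sub>R C X Y"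
  "X \<in> T \<Longrightarrow> Y \<in> T \<Longrightarrow> C X (c *\<^sub>R Y) = c *\<^sub>R C X Y"
  using C_left[of X 0 Y c] C_right[of X Y 0 c] by (simp_all add: C_0)

lemma sec_Ohom: "p < 2 \<Longrightarrow> X \<in> S (int r) (int p) \<Longrightarrow> sec X \<in> Ohom G r p"
  by (simp add: Ohom_iff sec(2) sec(3) S_T)

lemma C_degree:
  assumes "p < 2" "q < 2" "X \<in> S (int r) (int p)" "Y \<in> S (int s) (int q)"
  shows "r + s = 0 \<Longrightarrow> C X Y = 0"
    and "r + s \<noteq> 0 \<Longrightarrow> C X Y \<in> S (int (r + s - 1)) (int ((p + q) mod 2))"
proof -
  have "if r + s = 0 then oeq G (br (sec X) (sec Y)) 0 else br (sec X) (sec Y) \<in> Ohom G (r + s - 1) ((p +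
      q) mod 2)"
    by (rule gerst_facts(5)[rule_format])
       (use assms sec_Ohom in auto)
  then show "r + s = 0 \<Longrightarrow> C X Y = 0" "r + s \<noteq> 0 \<Longrightarrow> C X Y \<in> S (int (r +
      s - 1)) (int ((p + q) mod 2))"
    by (auto simp: oeq_iff_\<Phi> br_Om sec(2) Om_0 Ohom_iff C_def)
qed

lemma C_anti:
  assumes "p < 2" "q < 2" "X \<in> S (int r) (int p)" "Y \<in> S (int s) (int q)"
  shows "C X Y = - (sgni ((int r - 1) * (int s - 1) + int p * int q) *\<^sub>R C Y X)"
proof -
  have "oeq G (br (sec X) (sec Y)) (- (sgni ((int r - 1) * (int s - 1) + int (p * q)) *\<^sub>R br (sec Y) (sec X)))"
    by (rule gerst_facts(6)[rule_format])
       (use assms sec_Ohom in auto)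
  then show ?thesis
    by (simp add: oeq_iff_\<Phi> br_Om sec(2) Om_neg Om_scale C_def)
qed

lemma C_jacobi:
  assumes "p < 2" "q < 2" "u < 2" "X \<in> S (int r) (int p)" "Y \<in> S (int s) (int q)" "Z \<in> S (int t) (int u)"
  shows "C X (C Y Z) = C (C X Y) Z + sgni ((int r - 1) * (int s - 1) + int p * int q) *\<^sub>R C Y (C X Z)"
proof -
  have "oeq G (br (sec X) (br (sec Y) (sec Z))) (br (br (sec X) (sec Y)) (sec Z)
      + sgni ((int r - 1) * (int s - 1) + int (p * q)) *\<^sub>R br (sec Y) (br (sec X) (sec Z)))"
    by (rule gerst_facts(7)[rule_format,
          OF assms(1-3) sec_Ohom[OF assms(1,4)] sec_Ohom[OF assms(2,5)] sec_Ohom[OF assms(3,6)]])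
  then show ?thesis using S_T[OF assms(4)] S_T[OF assms(5)] S_T[OF assms(6)]
    by (simp add: oeq_iff_\<Phi> br_Om sec(2) Om_add Om_scale \<Phi>_br sec(3))
qed

lemma C_leibniz:
  assumes "p < 2" "q < 2" "u < 2" "X \<in> S (int r) (int p)" "Y \<in> S (int s) (int q)" "Z \<in> S (int t) (int u)"
  shows "C X (Y * Z) = C X Y * Z + sgni ((int r - 1) * int s + int p * int q) *\<^sub>R (Y * C X Z)"
proof -
  have "oeq G (br (sec X) (wedge (sec Y) (sec Z))) (wedge (br (sec X) (sec Y)) (sec Z)
      + sgni ((int r - 1) * int s + int (p * q)) *\<^sub>R wedge (sec Y) (br (sec X) (sec Z)))"
    by (rule gerst_facts(8)[rule_format,
          OF assms(1-3) sec_Ohom[OF assms(1,4)] sec_Ohom[OF assms(2,5)] sec_Ohom[OF assms(3,6)]])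
  then show ?thesis using S_T[OF assms(4)] S_T[OF assms(5)] S_T[OF assms(6)]
    by (simp add: oeq_iff_\<Phi> br_Om sec(2) wedge_Om \<Phi>_wedge Om_add Om_scale \<Phi>_br sec(3))
qed

section \<open>The induced anchor and bracket of one-forms\<close>

lemma i0_Sn: "p < 2 \<Longrightarrow> f \<in> Apar G p \<Longrightarrow> i0 f \<in> S (int 0) (int p)" by (simp
    add: i0_S)
lemma i1_Sn: "p < 2 \<Longrightarrow> \<alpha> \<in> O1par G p \<Longrightarrow> i1 \<alpha> \<in> S (int 1)
    (int p)" by (simp add: i1_S)

text \<open>Form degree -1 makes the class \<open>[\<alpha>, f]\<close> a function; the choice is
  unique because \<open>i0\<close> is injective.\<close>

definition anchor :: "'a tens \<Rightarrow> 'a \<Rightarrow> 'a" where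
  "anchor \<alpha> f = (SOME g. i0 g = C (i1 \<alpha>) (i0 f))"

text \<open>The choice is confined to \<open>Omega1\<close>, since injectivity of \<open>i1\<close>
  is established there.\<close>

definition bracket1 :: "'a tens \<Rightarrow> 'a tens \<Rightarrow> 'a tens" where
  "bracket1 \<alpha> \<beta> = (SOME \<gamma>. \<gamma> \<in> Omega1 \<and> i1 \<gamma> = C (i1 \<alpha>) (i1
      \<beta>))"

lemma C_i1_i0_hom:
  assumes "p < 2" "\<alpha> \<in> O1par G p" "q < 2" "f \<in> Apar G q"
  shows "\<exists>g\<in>Apar G ((p + q) mod 2). i0 g = C (i1 \<alpha>) (i0 f)"
proof -
  have "C (i1 \<alpha>) (i0 f) \<in> S (int (1 + 0 - 1)) (int ((p + q) mod 2))"
    by (rule C_degree(2)[OF assms(1,3) i1_Sn[OF assms(1,2)] i0_Sn[OF assms(3,4)]]) simp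
  then have "C (i1 \<alpha>) (i0 f) \<in> S 0 (int ((p + q) mod 2))" by simp
  then show ?thesis by (rule S0_obtain) auto
qed

lemma C_i1_i1_hom:
  assumes "p < 2" "\<alpha> \<in> O1par G p" "q < 2" "\<beta> \<in> O1par G q"
  shows "\<exists>\<gamma>\<in>O1par G ((p + q) mod 2). i1 \<gamma> = C (i1 \<alpha>) (i1 \<beta>)"
proof -
  have "C (i1 \<alpha>) (i1 \<beta>) \<in> S (int (1 + 1 - 1)) (int ((p + q) mod 2))"
    by (rule C_degree(2)[OF assms(1,3) i1_Sn[OF assms(1,2)] i1_Sn[OF assms(3,4)]]) simp
  then have "C (i1 \<alpha>) (i1 \<beta>) \<in> S 1 (int ((p + q) mod 2))" by simp
  then show ?thesis by (rule S1_obtain) auto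
qed

text \<open>The degree law speaks of bihomogeneous arguments, so \<open>\<alpha>\<close> and
  \<open>f\<close> are split by parity and preimages of the four brackets are added.\<close>

lemma i0_anchor:
  assumes "\<alpha> \<in> Omega1" shows "i0 (anchor \<alpha> f) = C (i1 \<alpha>) (i0 f)"
proof -
  have "\<exists>g. i0 g = C (i1 (tcomp G p \<alpha>)) (i0 (acomp G q f))" if "p < 2" "q < 2" for p q
    using C_i1_i0_hom[OF that(1) tcomp_in[OF assms that(1)] that(2) acomp_in[OF that(2)]] by blast
  from this[of 0 0] this[of 0 1] this[of 1 0] this[of 1 1] obtain g00 g01 g10 g11 where
    g: "i0 g00 = C (i1 (tcomp G 0 \<alpha>)) (i0 (acomp G 0 f))" "i0 g01 = C (i1 (tcomp G 0 \<alpha>)) (i0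
        (acomp G 1 f))"
      "i0 g10 = C (i1 (tcomp G 1 \<alpha>)) (i0 (acomp G 0 f))" "i0 g11 = C (i1 (tcomp G 1 \<alpha>)) (i0
          (acomp G 1 f))"
    by auto
  have t: "tcomp G 0 \<alpha> \<in> Omega1" "tcomp G 1 \<alpha> \<in> Omega1"
    using tcomp_in[OF assms, THEN O1par_Omega1] by simp_all
  have "C (i1 \<alpha>) (i0 f) = i0 (g00 + g01 + g10 + g11)"
    unfolding i1_decomp[OF assms] i0_decomp[of f] using t by (simp add: C_add i0_T i1_T T_add g)
  then show ?thesis unfolding anchor_def by (metis (mono_tags) someI_ex)
qed

lemma bracket1:
  assumes "\<alpha> \<in> Omega1" "\<beta> \<in> Omega1"
  shows bracket1_Omega1: "bracket1 \<alpha> \<beta> \<in> Omega1" and i1_bracket1: "i1 (bracket1 \<alpha>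
      \<beta>) = C (i1 \<alpha>) (i1 \<beta>)"
proof -
  have "\<exists>g. g \<in> Omega1 \<and> i1 g = C (i1 (tcomp G p \<alpha>)) (i1 (tcomp G q \<beta>))" if "p <
      2" "q < 2" for p q
    using C_i1_i1_hom[OF that(1) tcomp_in[OF assms(1) that(1)] that(2) tcomp_in[OF assms(2) that(2)]]
        O1par_Omega1 by blast
  from this[of 0 0] this[of 0 1] this[of 1 0] this[of 1 1] obtain g00 g01 g10 g11 where
    g: "i1 g00 = C (i1 (tcomp G 0 \<alpha>)) (i1 (tcomp G 0 \<beta>))" "i1 g01 = C (i1 (tcomp G 0 \<alpha>))
        (i1 (tcomp G 1 \<beta>))"
      "i1 g10 = C (i1 (tcomp G 1 \<alpha>)) (i1 (tcomp G 0 \<beta>))" "i1 g11 = C (i1 (tcomp G 1 \<alpha>)) (i1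
          (tcomp G 1 \<beta>))"
    and gO: "g00 \<in> Omega1" "g01 \<in> Omega1" "g10 \<in> Omega1" "g11 \<in> Omega1"
    by auto
  have t: "tcomp G 0 \<alpha> \<in> Omega1" "tcomp G 1 \<alpha> \<in> Omega1" "tcomp G 0 \<beta> \<in> Omega1"
      "tcomp G 1 \<beta> \<in> Omega1"
    using tcomp_in[OF assms(1), THEN O1par_Omega1] tcomp_in[OF assms(2), THEN O1par_Omega1] by simp_all
  have "i1 (g00 + g01 + g10 + g11) = C (i1 \<alpha>) (i1 \<beta>)" "g00 + g01 + g10 + g11 \<in> Omega1"
    unfolding i1_decomp[OF assms(1)] i1_decomp[OF assms(2)]
    using t gO by (simp_all add: C_add i1_T T_add g i1_add Omega1_add)
  then have "\<exists>\<gamma>. \<gamma> \<in> Omega1 \<and> i1 \<gamma> = C (i1 \<alpha>) (i1 \<beta>)" by blast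
  from someI_ex[OF this] show "bracket1 \<alpha> \<beta> \<in> Omega1" "i1 (bracket1 \<alpha> \<beta>) = C (i1
      \<alpha>) (i1 \<beta>)"
    by (auto simp: bracket1_def)
qed

section \<open>The anchor as an even module map into derivations\<close>

lemma anchor_Apar:
  assumes "p < 2" "\<alpha> \<in> O1par G p" "q < 2" "f \<in> Apar G q"
  shows "anchor \<alpha> f \<in> Apar G ((p + q) mod 2)"
  using C_i1_i0_hom[OF assms] i0_anchor[OF O1par_Omega1[OF assms(2)], of f] by (metis i0_inject)

lemma bracket1_O1par:
  assumes "p < 2" "\<alpha> \<in> O1par G p" "q < 2" "\<beta> \<in> O1par G q"
  shows "bracket1 \<alpha> \<beta> \<in> O1par G ((p + q) mod 2)"
  using C_i1_i1_hom[OF assms] bracket1[OF O1par_Omega1[OF assms(2)] O1par_Omega1[OF assms(4)]]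
  by (metis i1_inject O1par_Omega1)

lemma anchor_linear: "\<alpha> \<in> Omega1 \<Longrightarrow> linear (anchor \<alpha>)"
  by (intro linearI; subst i0_inject[symmetric]) (simp_all add: i0_anchor C_add C_scale i0_T i1_T)

lemma anchor_lincomb:
  "\<alpha> \<in> Omega1 \<Longrightarrow> \<beta> \<in> Omega1 \<Longrightarrow> anchor (c *\<^sub>R \<alpha>
      + \<beta>) f = c *\<^sub>R anchor \<alpha> f + anchor \<beta> f"
  by (subst i0_inject[symmetric])
     (simp add: i0_anchor C_left i0_T i1_T i1_lincomb Omega1_add Omega1_scale)

text \<open>In the Gerstenhaber Leibniz rule a one-form has shifted degree 0, which leaves only the
  parity sign. The second function is then split by parity.\<close>

lemma anchor_mult:
  assumes a: "p < 2" "\<alpha> \<in> O1par G p" and f: "q < 2" "f \<in> Apar G q"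
  shows "anchor \<alpha> (f * g) = anchor \<alpha> f * g + sgni (int p * int q) *\<^sub>R (f * anchor \<alpha> g)"
proof -
  note O = O1par_Omega1[OF a(2)]
  have hom: "anchor \<alpha> (f * g) = anchor \<alpha> f * g + sgni (int p * int q) *\<^sub>R (f * anchor \<alpha> g)"
    if g: "u < 2" "g \<in> Apar G u" for u g
  proof (subst i0_inject[symmetric])
    have "i0 (anchor \<alpha> (f * g)) = C (i1 \<alpha>) (i0 f) * i0 g + sgni ((int 1 - 1) * int 0 + int p *
        int q) *\<^sub>R (i0 f * C (i1 \<alpha>) (i0 g))"
      unfolding i0_anchor[OF O] i0_mult[OF f(1) g(1) f(2) g(2)]
      by (rule C_leibniz[OF a(1) f(1) g(1) i1_Sn[OF a] i0_Sn[OF f] i0_Sn[OF g]])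
    then show "i0 (anchor \<alpha> (f * g)) = i0 (anchor \<alpha> f * g + sgni (int p * int q) *\<^sub>R (f *
        anchor \<alpha> g))"
      using i0_mult[OF _ g(1) anchor_Apar[OF a f] g(2)] i0_mult[OF f(1) _ f(2) anchor_Apar[OF a g]]
      by (simp add: i0_anchor[OF O])
  qed
  have "anchor \<alpha> (f * (acomp G 0 g + acomp G 1 g)) =
      anchor \<alpha> f * (acomp G 0 g + acomp G 1 g) + sgni (int p * int q) *\<^sub>R (f * anchor \<alpha>
          (acomp G 0 g + acomp G 1 g))"
    by (simp add: distrib_left linear_add[OF anchor_linear[OF O]] hom[of 0] hom[of 1] acomp_in scaleR_add_right)
  then show ?thesis by (simp add: acomp_decomp)
qed

lemma anchor_superderiv: "p < 2 \<Longrightarrow> \<alpha> \<in> O1par G p \<Longrightarrow> superderiv G p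
    (anchor \<alpha>)"
  unfolding superderiv_def minus_one_power_eq_sgni of_nat_mult
  by (auto intro: anchor_linear O1par_Omega1 anchor_Apar anchor_mult)

text \<open>Linearity comes from the Leibniz rule in the other slot: \<open>[f \<alpha>, g]\<close>
  is turned into \<open>[g, f \<alpha>]\<close> and expanded, the term with \<open>[g, f]\<close>
  vanishes for degree reasons, and \<open>[g, \<alpha>]\<close> is turned back.\<close>

lemma anchor_lact:
  assumes "\<alpha> \<in> Omega1" shows "anchor (lact f \<alpha>) g = f * anchor \<alpha> g"
proof -
  have hom: "anchor (lact f \<alpha>) g = f * anchor \<alpha> g"
    if f: "p < 2" "f \<in> Apar G p" and a: "q < 2" "\<alpha> \<in> O1par G q" and g: "u < 2" "g \<in> Apar G
        u" for p f q \<alpha> u g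
  proof (subst i0_inject[symmetric])
    note O = O1par_Omega1[OF a(2)]
    note fa = lact_O1par[OF f(2) a(2) f(1) a(1)]
    have 0: "C (i0 g) (i0 f) = 0" by (rule C_degree(1)[OF g(1) f(1) i0_Sn[OF g] i0_Sn[OF f]]) simp
    have "i0 (anchor (lact f \<alpha>) g) = C (i1 (lact f \<alpha>)) (i0 g)" by (rule i0_anchor[OF lact_Omega1[OF O]])
    also have "\<dots> = - (sgni ((int 1 - 1) * (int 0 - 1) + int ((p + q) mod 2) * int u) *\<^sub>R C (i0 g)
        (i1 (lact f \<alpha>)))"
      by (rule C_anti[OF _ g(1) i1_Sn[OF _ fa] i0_Sn[OF g]]) auto
    also have "C (i0 g) (i1 (lact f \<alpha>)) = C (i0 g) (i0 f) * i1 \<alpha>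
        + sgni ((int 0 - 1) * int 0 + int u * int p) *\<^sub>R (i0 f * C (i0 g) (i1 \<alpha>))"
      unfolding i1_lact[OF f(1) a(1) f(2) a(2)]
      by (rule C_leibniz[OF g(1) f(1) a(1) i0_Sn[OF g] i0_Sn[OF f] i1_Sn[OF a]])
    also have "C (i0 g) (i1 \<alpha>) = - (sgni ((int 0 - 1) * (int 1 - 1) + int u * int q) *\<^sub>R C (i1
        \<alpha>) (i0 g))"
      by (rule C_anti[OF g(1) a(1) i0_Sn[OF g] i1_Sn[OF a]])
    finally have "i0 (anchor (lact f \<alpha>) g) =
        (sgni (int ((p + q) mod 2) * int u) * (sgni (int u * int p) * sgni (int u * int q))) *\<^sub>R (i0 f *
            C (i1 \<alpha>) (i0 g))"
      by (simp add: 0)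
    also have "sgni (int ((p + q) mod 2) * int u) * (sgni (int u * int p) * sgni (int u * int q)) = 1"
      by (auto simp: sgni_def of_nat_mod)
    finally show "i0 (anchor (lact f \<alpha>) g) = i0 (f * anchor \<alpha> g)"
      using i0_mult[OF f(1) _ f(2) anchor_Apar[OF a g]] by (simp add: i0_anchor[OF O])
  qed
  \<comment> \<open>Homogeneity of \<open>g\<close>, of \<open>f\<close> and of
    \<open>\<alpha>\<close> is removed in this order by splitting into even and odd parts.\<close>
  have hom2: "anchor (lact f \<alpha>) g = f * anchor \<alpha> g"
    if f: "p < 2" "f \<in> Apar G p" and a: "q < 2" "\<alpha> \<in> O1par G q" for p f q \<alpha> g
  proof -
    note O = O1par_Omega1[OF a(2)]
    have "anchor (lact f \<alpha>) (acomp G 0 g + acomp G 1 g) = f * anchor \<alpha> (acomp G 0 g + acomp G 1 g)"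
      using hom[OF f a, of 0] hom[OF f a, of 1]
      by (simp add: linear_add[OF anchor_linear[OF O]] linear_add[OF anchor_linear[OF lact_Omega1[OF O]]]
          acomp_in distrib_left)
    then show ?thesis by (simp add: acomp_decomp)
  qed
  have add: "anchor (\<beta> + \<gamma>) g = anchor \<beta> g + anchor \<gamma> g" if "\<beta> \<in> Omega1"
      "\<gamma> \<in> Omega1" for \<beta> \<gamma> g
    using anchor_lincomb[OF that, of 1 g] by simp
  have hom3: "anchor (lact f \<alpha>) g = f * anchor \<alpha> g" if a: "q < 2" "\<alpha> \<in> O1par G q" for
      q \<alpha> f g
  proof -
    note O = O1par_Omega1[OF a(2)]
    have "anchor (lact (acomp G 0 f + acomp G 1 f) \<alpha>) g = (acomp G 0 f + acomp G 1 f) * anchor \<alpha> g"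
      using hom2[of 0 "acomp G 0 f", OF _ _ a] hom2[of 1 "acomp G 1 f", OF _ _ a]
      by (simp add: lact_add_left[OF O1par_AtA[OF a(2)]] add lact_Omega1[OF O] acomp_in distrib_right)
    then show ?thesis by (simp add: acomp_decomp)
  qed
  have t: "tcomp G 0 \<alpha> \<in> O1par G 0" "tcomp G 1 \<alpha> \<in> O1par G 1" using tcomp_in[OF assms] by auto
  have "anchor (lact f (tcomp G 0 \<alpha> + tcomp G 1 \<alpha>)) g = f * anchor (tcomp G 0 \<alpha> + tcomp G
      1 \<alpha>) g"
    using hom3[OF _ t(1)] hom3[OF _ t(2)] t[THEN O1par_Omega1] by (simp add: add lact_Omega1 distrib_left)
  then show ?thesis by (simp only: tcomp_decomp[OF assms])
qed

lemma anchor_DerA: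
  assumes "\<alpha> \<in> Omega1" shows "anchor \<alpha> \<in> DerA G"
proof -
  have t: "tcomp G 0 \<alpha> \<in> O1par G 0" "tcomp G 1 \<alpha> \<in> O1par G 1" using tcomp_in[OF assms] by auto
  have "anchor \<alpha> = (\<lambda>a. anchor (tcomp G 0 \<alpha>) a + anchor (tcomp G 1 \<alpha>) a)"
    using anchor_lincomb[OF t[THEN O1par_Omega1], of 1] by (simp add: tcomp_decomp[OF assms] fun_eq_iff)
  then show ?thesis unfolding DerA_def using anchor_superderiv[of 0] anchor_superderiv[of 1] t by auto
qed

section \<open>The Lie superalgebra laws and the Leibniz rule\<close>

lemma bracket1_left: "\<alpha> \<in> Omega1 \<Longrightarrow> \<alpha>' \<in> Omega1 \<Longrightarrow> \<beta>
    \<in> Omega1 \<Longrightarrow>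
    bracket1 (c *\<^sub>R \<alpha> + \<alpha>') \<beta> = c *\<^sub>R bracket1 \<alpha> \<beta> + bracket1
        \<alpha>' \<beta>"
  by (subst i1_inject[symmetric])
     (simp_all add: bracket1 i1_lincomb C_left i1_T Omega1_add Omega1_scale)

lemma bracket1_right: "\<alpha> \<in> Omega1 \<Longrightarrow> \<beta> \<in> Omega1 \<Longrightarrow> \<beta>'
    \<in> Omega1 \<Longrightarrow>
    bracket1 \<alpha> (c *\<^sub>R \<beta> + \<beta>') = c *\<^sub>R bracket1 \<alpha> \<beta> + bracket1
        \<alpha> \<beta>'"
  by (subst i1_inject[symmetric])
     (simp_all add: bracket1 i1_lincomb C_right i1_T Omega1_add Omega1_scale)

lemma bracket1_anti:
  assumes a: "p < 2" "\<alpha> \<in> O1par G p" and b: "q < 2" "\<beta> \<in> O1par G q"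
  shows "bracket1 \<alpha> \<beta> = - (sgni (int p * int q) *\<^sub>R bracket1 \<beta> \<alpha>)"
proof -
  note O = O1par_Omega1[OF a(2)] O1par_Omega1[OF b(2)]
  have "i1 (bracket1 \<alpha> \<beta>) = i1 ((- sgni (int p * int q)) *\<^sub>R bracket1 \<beta> \<alpha>)"
    using C_anti[OF a(1) b(1) i1_Sn[OF a] i1_Sn[OF b]]
    unfolding i1_scale[OF bracket1_Omega1[OF O(2,1)]] by (simp add: i1_bracket1 O)
  then have "bracket1 \<alpha> \<beta> = (- sgni (int p * int q)) *\<^sub>R bracket1 \<beta> \<alpha>"
    using i1_inject[OF bracket1_Omega1[OF O] Omega1_scale[OF bracket1_Omega1[OF O(2,1)]]] by blast
  then show ?thesis by simp
qed

lemma bracket1_jacobi: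
  assumes a: "p < 2" "\<alpha> \<in> O1par G p" and b: "q < 2" "\<beta> \<in> O1par G q" and c: "u < 2"
      "\<gamma> \<in> O1par G u"
  shows "bracket1 \<alpha> (bracket1 \<beta> \<gamma>) = bracket1 (bracket1 \<alpha> \<beta>) \<gamma> + sgni
      (int p * int q) *\<^sub>R bracket1 \<beta> (bracket1 \<alpha> \<gamma>)"
proof -
  note O = O1par_Omega1[OF a(2)] O1par_Omega1[OF b(2)] O1par_Omega1[OF c(2)]
  show ?thesis
    using C_jacobi[OF a(1) b(1) c(1) i1_Sn[OF a] i1_Sn[OF b] i1_Sn[OF c]]
    by (subst i1_inject[symmetric])
       (simp_all add: O bracket1 i1_add i1_scale Omega1_add Omega1_scale)
qed

text \<open>For homogeneous \<open>\<beta>\<close> the class of \<open>lact f \<beta>\<close> is the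
  product \<open>i0 f * i1 \<beta>\<close>, so this is the Gerstenhaber Leibniz rule for a function
  times a one-form.\<close>

lemma bracket1_leibniz:
  assumes a: "p < 2" "\<alpha> \<in> O1par G p" and f: "q < 2" "f \<in> Apar G q" and \<beta>: "\<beta> \<in> Omega1"
  shows "bracket1 \<alpha> (lact f \<beta>) = lact (anchor \<alpha> f) \<beta> + sgni (int p * int q) *\<^sub>R
      lact f (bracket1 \<alpha> \<beta>)"
proof -
  note O = O1par_Omega1[OF a(2)]
  have hom: "bracket1 \<alpha> (lact f \<beta>) = lact (anchor \<alpha> f) \<beta> + sgni (int p * int q)
      *\<^sub>R lact f (bracket1 \<alpha> \<beta>)"
    if b: "u < 2" "\<beta> \<in> O1par G u" for u \<beta>
  proof -
    note O' = O1par_Omega1[OF b(2)]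
    have "C (i1 \<alpha>) (i0 f * i1 \<beta>) = C (i1 \<alpha>) (i0 f) * i1 \<beta> + sgni ((int 1 - 1) * int 0
        + int p * int q) *\<^sub>R (i0 f * C (i1 \<alpha>) (i1 \<beta>))"
      by (rule C_leibniz[OF a(1) f(1) b(1) i1_Sn[OF a] i0_Sn[OF f] i1_Sn[OF b]])
    then show ?thesis
      using i1_lact[OF f(1) b(1) f(2) b(2)] i1_lact[OF _ b(1) anchor_Apar[OF a f] b(2)]
        i1_lact[OF f(1) _ f(2) bracket1_O1par[OF a b]]
      by (subst i1_inject[symmetric])
         (simp_all add: O O' bracket1 i0_anchor i1_add i1_scale lact_Omega1 Omega1_add Omega1_scale)
  qed
  have t: "tcomp G 0 \<beta> \<in> O1par G 0" "tcomp G 1 \<beta> \<in> O1par G 1" using tcomp_in[OF \<beta>] by auto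
  have add: "bracket1 \<alpha> (\<gamma> + \<delta>) = bracket1 \<alpha> \<gamma> + bracket1 \<alpha> \<delta>"
      if "\<gamma> \<in> Omega1" "\<delta> \<in> Omega1" for \<gamma> \<delta>
    using bracket1_right[OF O that, of 1] by simp
  have "bracket1 \<alpha> (lact f (tcomp G 0 \<beta> + tcomp G 1 \<beta>)) = lact (anchor \<alpha> f) (tcomp G
      0 \<beta> + tcomp G 1 \<beta>)
      + sgni (int p * int q) *\<^sub>R lact f (bracket1 \<alpha> (tcomp G 0 \<beta> + tcomp G 1 \<beta>))"
    using hom[OF _ t(1)] hom[OF _ t(2)] t[THEN O1par_Omega1] by (simp add: add lact_Omega1 scaleR_add_right)
  then show ?thesis by (simp only: tcomp_decomp[OF \<beta>])
qed

lemma lie_superalgebroid_bracket1: "lie_superalgebroid G bracket1 anchor"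
  unfolding lie_superalgebroid_def minus_one_power_eq_sgni of_nat_mult
  by (intro conjI ballI allI impI)
     ((rule anchor_DerA; assumption) | (rule ext, rule anchor_lincomb; assumption) | (rule anchor_superderiv;
         assumption)
      | (rule ext, rule anchor_lact; assumption) | (rule bracket1_Omega1; assumption) | (rule bracket1_left;
          assumption)
      | (rule bracket1_right; assumption) | (rule bracket1_O1par; assumption) | (rule bracket1_anti; assumption)
      | (rule bracket1_jacobi; assumption) | (rule bracket1_leibniz; assumption))+

lemma bracket1_compatible:
  "\<alpha> \<in> Omega1 \<Longrightarrow> \<beta> \<in> Omega1 \<Longrightarrow> oeq G (emb1 G (bracket1
      \<alpha> \<beta>)) (br (emb1 G \<alpha>) (emb1 G \<beta>))"
  "\<alpha> \<in> Omega1 \<Longrightarrow> oeq G (embA G (anchor \<alpha> f)) (br (emb1 G \<alpha>) (embA G f))"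
  by (simp_all add: oeq_iff_\<Phi> br_Om embA_Om emb1_Om bracket1 \<Phi>_br i0_anchor flip: i0_def i1_def)

end

theorem mainTheorem5:
  fixes G :: "int \<Rightarrow> 'a::real_algebra_1 set"
  assumes "graded_supercomm_algebra G"
  shows
    "(\<forall>br. gerstenhaber G br \<longrightarrow>
        (\<exists>brk \<rho>. lie_superalgebroid G brk \<rho> \<and>
           (\<forall>\<alpha> \<in> Omega1. \<forall>\<beta> \<in> Omega1. oeq G (emb1 G (brk \<alpha>
            \<beta>)) (br (emb1 G \<alpha>) (emb1 G \<beta>))) \<and>
           (\<forall>\<alpha> \<in> Omega1. \<forall>f. oeq G (embA G (\<rho> \<alpha> f)) (br (emb1 G
            \<alpha>) (embA G f)))))
     \<and>
     (\<forall>brk \<rho>. lie_superalgebroid G brk \<rho> \<longrightarrow>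
        (\<exists>br. gerstenhaber G br \<and>
           (\<forall>f g. oeq G (br (embA G f) (embA G g)) 0) \<and>
           (\<forall>\<alpha> \<in> Omega1. \<forall>f. oeq G (br (emb1 G \<alpha>) (embA G f)) (embA G (\<rho>
            \<alpha> f))) \<and>
           (\<forall>\<alpha> \<in> Omega1. \<forall>\<beta> \<in> Omega1. oeq G (br (emb1 G \<alpha>) (emb1 G
            \<beta>)) (emb1 G (brk \<alpha> \<beta>)))))
     \<and>
     ((\<exists>br. gerstenhaber G br) \<longleftrightarrow> (\<exists>brk \<rho>. lie_superalgebroid G brk \<rho>))"
  (is "?a \<and> ?b \<and> ?c")
proof -
  interpret graded_algebra G using assms by unfold_locales
  have a: ?a
  proof (intro allI impI)
    fix br assume "gerstenhaber G br"
    then interpret gerstenhaber_bracket G br by unfold_locales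
    show "\<exists>brk \<rho>. lie_superalgebroid G brk \<rho> \<and>
        (\<forall>\<alpha> \<in> Omega1. \<forall>\<beta> \<in> Omega1. oeq G (emb1 G (brk \<alpha> \<beta>))
            (br (emb1 G \<alpha>) (emb1 G \<beta>))) \<and>
        (\<forall>\<alpha> \<in> Omega1. \<forall>f. oeq G (embA G (\<rho> \<alpha> f)) (br (emb1 G \<alpha>)
            (embA G f)))"
      using lie_superalgebroid_bracket1 bracket1_compatible by blast
  qed
  have b: ?b
  proof (intro allI impI)
    fix brk \<rho> assume "lie_superalgebroid G brk \<rho>"
    then interpret algebroid G brk \<rho> by unfold_locales
    show "\<exists>br. gerstenhaber G br \<and> (\<forall>f g. oeq G (br (embA G f) (embA G g)) 0) \<and>
        (\<forall>\<alpha> \<in> Omega1. \<forall>f. oeq G (br (emb1 G \<alpha>) (embA G f)) (embA G (\<rho>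
            \<alpha> f))) \<and>
        (\<forall>\<alpha> \<in> Omega1. \<forall>\<beta> \<in> Omega1. oeq G (br (emb1 G \<alpha>) (emb1 G
            \<beta>)) (emb1 G (brk \<alpha> \<beta>)))"
      using gerstenhaber_form_bracket form_bracket_generators by blast
  qed
  have "\<exists>brk \<rho>. lie_superalgebroid G brk \<rho>" if "gerstenhaber G br" for br
    using a[rule_format, OF that] by (elim exE conjE) (intro exI)
  moreover have "\<exists>br. gerstenhaber G br" if "lie_superalgebroid G brk \<rho>" for brk \<rho>
    using b[rule_format, OF that] by (elim exE conjE) (intro exI)
  ultimately have ?c by (intro iffI; elim exE)
  with a b show ?thesis by (intro conjI)
qed

end
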